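(* Let $0<\alpha<4$. Assume that $u\in L^1_{\mathrm{loc}}(\mathbb R^4)$ is a normal distributional solution of $$\Delta^2u=\left(\int_{\mathbb R^4}\frac{e^{u(y)}}{|x-y|^{\alpha}}\,dy\right)e^{u(x)}\quad\text{in }\mathbb R^4$$ satisfying $$\int_{\mathbb R^4}e^{\frac{8}{8-\alpha}u(x)}\,dx<+\infty .$$ Then $u\in C^\infty(\mathbb R^4)$, and there exist $\mu>0$ and $\zeta\in\mathbb R^4$ such that $u=U_{\mu,\zeta}$, where $$U_{\mu,\zeta}(x):=\frac{8-\alpha}{2}\log\left(\frac{C_\alpha\mu}{1+\mu^2|x-\zeta|^2}\right),\qquad C_\alpha:=\left(\frac{12(8-\alpha)(6-\alpha)(4-\alpha)}{\pi^2}\right)^{\frac1{8-\alpha}} .$$ Moreover, $$\int_{\mathbb R^4}e^{\frac{8}{8-\alpha}U_{\mu,\zeta}(x)}\,dx=\frac{\pi^2}{6}C_\alpha^4$$ and $$\int_{\mathbb R^4}\int_{\mathbb R^4}\frac{e^{U_{\mu,\zeta}(x)}e^{U_{\mu,\zeta}(y)}}{|x-y|^\alpha}\,dx\,dy=8\pi^2(8-\alpha).$$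
   Context: All functions are real-valued. For a solution $u$ put $$F(x):=\left(\int_{\mathbb R^4}\frac{e^{u(y)}}{|x-y|^\alpha}\,dy\right)e^{u(x)} .$$ A distributional solution of $\Delta^2u=F$ is a function $u\in L^1_{\mathrm{loc}}(\mathbb R^4)$ with $F\in L^1_{\mathrm{loc}}(\mathbb R^4)$ such that $\int u\,\Delta^2\varphi\,dx=\int F\varphi\,dx$ for all $\varphi\in C_c^\infty(\mathbb R^4)$. The solution is called normal if there is a constant $C\in\mathbb R$ such that $$u(x)=-\frac1{8\pi^2}\int_{\mathbb R^4}\log|x-y|\,F(y)\,dy+C,$$ where the integral is finite for every $x\in\mathbb R^4$. *)

theory Defs
  imports "HOL-Analysis.Analysis"
begin

definition partial_deriv :: "'a::euclidean_space \<Rightarrow> ('a \<Rightarrow> real) \<Rightarrow> 'a \<Rightarrow> real" where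
  "partial_deriv b f x = frechet_derivative f (at x) b"

primrec C_order :: "nat \<Rightarrow> ('a::euclidean_space \<Rightarrow> real) \<Rightarrow> bool" where
  "C_order 0 f \<longleftrightarrow> continuous_on UNIV f"
| "C_order (Suc n) f \<longleftrightarrow>
     (\<forall>x. f differentiable (at x)) \<and> (\<forall>b\<in>Basis. C_order n (partial_deriv b f))"

definition C_infinity :: "('a::euclidean_space \<Rightarrow> real) \<Rightarrow> bool" where
  "C_infinity f \<longleftrightarrow> (\<forall>n. C_order n f)"

definition test_function :: "('a::euclidean_space \<Rightarrow> real) \<Rightarrow> bool" where
  "test_function \<phi> \<longleftrightarrow> C_infinity \<phi> \<and> compact (closure {x. \<phi> x \<noteq> 0})"

definition laplacian :: "('a::euclidean_space \<Rightarrow> real) \<Rightarrow> 'a \<Rightarrow> real" where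
  "laplacian f x = (\<Sum>b\<in>Basis. partial_deriv b (partial_deriv b f) x)"

definition locally_integrable :: "('a::euclidean_space \<Rightarrow> real) \<Rightarrow> bool" where
  "locally_integrable f \<longleftrightarrow> (\<forall>K. compact K \<longrightarrow> f absolutely_integrable_on K)"

(* On the diagonal y = x the quotient is 0 by the conventions for powr and division;
   this is a null set, so the integrals below are unaffected. *)
definition riesz_integrand :: "real \<Rightarrow> (real^4 \<Rightarrow> real) \<Rightarrow> real^4 \<Rightarrow> real^4 \<Rightarrow> real" where
  "riesz_integrand \<alpha> u x y = exp (u y) / norm (x - y) powr \<alpha>"

definition rhs :: "real \<Rightarrow> (real^4 \<Rightarrow> real) \<Rightarrow> real^4 \<Rightarrow> real" where
  "rhs \<alpha> u x = (\<integral>y. riesz_integrand \<alpha> u x y \<partial>lebesgue) * exp (u x)"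

(* The Bochner integral of a non-integrable function is 0, so finiteness of the inner
   integral defining rhs must be required; as an element of L^1_loc, rhs only has to be
   finite almost everywhere. *)
definition distributional_solution :: "real \<Rightarrow> (real^4 \<Rightarrow> real) \<Rightarrow> bool" where
  "distributional_solution \<alpha> u \<longleftrightarrow>
     locally_integrable u \<and>
     (AE x in lebesgue. integrable lebesgue (riesz_integrand \<alpha> u x)) \<and>
     locally_integrable (rhs \<alpha> u) \<and>
     (\<forall>\<phi>. test_function \<phi> \<longrightarrow>
        (\<integral>x. u x * laplacian (laplacian \<phi>) x \<partial>lebesgue) = (\<integral>x. rhs \<alpha> u x * \<phi> x \<partial>lebesgue))"

(* ln 0 = 0 only affects the null set y = x. *)
definition normal_solution :: "real \<Rightarrow> (real^4 \<Rightarrow> real) \<Rightarrow> bool" where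
  "normal_solution \<alpha> u \<longleftrightarrow>
     distributional_solution \<alpha> u \<and>
     (\<exists>C. \<forall>x. integrable lebesgue (\<lambda>y. ln (norm (x - y)) * rhs \<alpha> u y) \<and>
        u x = - (1 / (8 * pi\<^sup>2)) * (\<integral>y. ln (norm (x - y)) * rhs \<alpha> u y \<partial>lebesgue) + C)"

definition C_const :: "real \<Rightarrow> real" where
  "C_const \<alpha> = (12 * (8 - \<alpha>) * (6 - \<alpha>) * (4 - \<alpha>) / pi\<^sup>2) powr (1 / (8 - \<alpha>))"

definition bubble :: "real \<Rightarrow> real \<Rightarrow> real^4 \<Rightarrow> real^4 \<Rightarrow> real" where
  "bubble \<alpha> \<mu> \<zeta> x =
     (8 - \<alpha>) / 2 * ln (C_const \<alpha> * \<mu> / (1 + \<mu>\<^sup>2 * (norm (x - \<zeta>))\<^sup>2))"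

end

theory Submission
  imports Defs
begin

text \<open>Write \<open>E = exp u\<close>, \<open>V\<close> for its Riesz potential and \<open>F = V * E\<close>. Truncating \<open>F\<close> at a
  high level and applying Jensen's inequality to the logarithmic potential of the rest bounds \<open>E\<close> by
  a weakly singular potential of \<open>F\<close>, from which \<open>V\<close>, \<open>u\<close> and \<open>F\<close> are bounded above. Integrability
  of \<open>exp (8 / (8 - \<alpha>) * u)\<close> gives enough decay for a Pohozaev identity, which shows that \<open>u\<close> behaves
  like \<open>- (8 - \<alpha>) * ln (norm x)\<close> at infinity. This is exactly the rate for which the Kelvin transform
  preserves the system, so moving spheres yield, for every centre \<open>x\<close>, a radius \<open>\<rho> x\<close> such that \<open>u\<close> is
  invariant under inversion in the sphere around \<open>x\<close> of radius \<open>\<rho> x\<close>, and \<open>E\<close> is a constant multiple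
  of \<open>\<rho> powr (- (8 - \<alpha>))\<close>. Invariance also gives that the integral of
  \<open>(norm (x - y))\<^sup>2 * \<rho> y powr (-10)\<close> over \<open>y\<close> equals \<open>(\<rho> x)\<^sup>2\<close> times a constant; hence \<open>\<rho>\<^sup>2\<close> is a
  quadratic polynomial and \<open>u\<close> is a bubble. The total mass, known from the Pohozaev identity, fixes the
  constant. Smoothness is read off the explicit formula.\<close>

subsection \<open>Radial integrals\<close>

text \<open>The exponent \<open>8 / (8 - \<alpha>)\<close> enters twice: through Young's inequality,
  which controls the far part of \<open>V\<close>, and through \<open>slope_gt\<close>, which gives
  \<open>exp u\<close> the decay rate \<open>(8 - \<alpha>) / 2\<close>. That is only half of the
  true rate, but just enough for \<open>F\<close> to be of order \<open>norm x powr (-4)\<close>, so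
  that \<open>u\<close> changes under a dilation by at most a constant times
  \<open>\<bar>t - 1\<bar>\<close>, uniformly in space. With this the Pohozaev argument compares the
  dilations by \<open>t\<close> and \<open>1 / t\<close> and meets neither boundary terms nor
  derivatives. A fourth order equation has no maximum principle. The spheres are therefore moved on
  the two coupled integral equations for \<open>u\<close> and \<open>V\<close>: inversion folds them
  into a ball, where both reflected kernels are positive. The spheres stop because
  \<open>u x + (8 - \<alpha>) * ln (norm x)\<close> tends to the finite value \<open>c0\<close>
  along rays. This value is the same for every centre, so the stopping radius at \<open>x\<close> is
  an explicit function of \<open>u x\<close>. Comparing two centres is then replaced by a single
  moment identity, whose kernel is a polynomial.\<close>

lemma ball_in_borel [measurable]: "ball (x::'a::metric_space) r \<in> sets borel"
  by simp

text \<open>Polar coordinates for radial functions, obtained without a surface measure: both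
  measures give a half-line \<open>{..a}\<close> the volume \<open>pi\<^sup>2 / 2 * a ^ 4\<close> of
  a ball, and half-lines generate the Borel sets. The density is the derivative of this volume;
  \<open>2 * pi\<^sup>2\<close> is the area of the unit sphere.\<close>

lemma distr_norm_lborel:
  "distr (lborel :: (real^4) measure) borel norm
     = density lborel (\<lambda>r. ennreal (2 * pi\<^sup>2 * r ^ 3) * indicator {0..} r)"
    (is "?M = ?N")
proof (rule measure_eqI_generator_eq[where \<Omega>=UNIV and E="range (\<lambda>a::real. {..a})" and A="\<lambda>n. {..real n}"])
  show "Int_stable (range (\<lambda>a::real. {..a}))"
    by (auto simp: Int_stable_def)
  show "sets ?M = sigma_sets UNIV (range (\<lambda>a::real. {..a}))"
    by (simp add: borel_eq_atMost)
  show "sets ?N = sigma_sets UNIV (range (\<lambda>a::real. {..a}))"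
    by (simp add: borel_eq_atMost)
  show "(\<Union>i. {..real i}) = UNIV"
    by (auto simp: real_arch_simple)
  have M: "emeasure ?M {..a} = (if a < 0 then 0 else ennreal (pi\<^sup>2 / 2 * a ^ 4))" for a
  proof -
    have "emeasure ?M {..a} = emeasure (lborel :: (real^4) measure) (norm -` {..a})"
      by (subst emeasure_distr) auto
    also have "norm -` {..a} = (if a < 0 then {} else cball (0::real^4) a)"
      by (auto simp: order_trans[OF norm_ge_zero] not_less intro: dual_order.strict_trans1[OF norm_ge_zero])
         (meson norm_ge_zero order.trans order_less_le_trans leD)
    finally show ?thesis
      by (auto simp: emeasure_cball unit_ball_vol_numeral fact_numeral)
  qed
  have N: "emeasure ?N {..a} = (if a < 0 then 0 else ennreal (pi\<^sup>2 / 2 * a ^ 4))" for a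
  proof (cases "a < 0")
    case True
    then have "(\<lambda>r. ennreal (2 * pi\<^sup>2 * r ^ 3) * indicator {0..} r * indicator {..a} r) = (\<lambda>r. 0)"
      by (auto simp: indicator_def)
    then show ?thesis using True
      by (subst emeasure_density) auto
  next
    case False
    have "emeasure ?N {..a} = (\<integral>\<^sup>+r. ennreal (2 * pi\<^sup>2 * r ^ 3) * indicator {0..a} r \<partial>lborel)"
      by (subst emeasure_density) (auto simp: indicator_def intro!: nn_integral_cong)
    also have "\<dots> = ennreal (pi\<^sup>2 / 2 * a ^ 4 - pi\<^sup>2 / 2 * 0 ^ 4)"
      using False by (intro nn_integral_FTC_Icc) (auto intro!: derivative_eq_intros)
    finally show ?thesis using False by simp
  qed
  show "emeasure ?M X = emeasure ?N X" if "X \<in> range (\<lambda>a::real. {..a})" for X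
    using that M N by auto
  show "emeasure ?M {..real i} \<noteq> \<infinity>" for i
    using M by simp
qed auto

lemma nn_integral_radial:
  assumes "f \<in> borel_measurable borel"
  shows "(\<integral>\<^sup>+x. f (norm (x::real^4)) \<partial>lborel)
     = (\<integral>\<^sup>+r. ennreal (2 * pi\<^sup>2 * r ^ 3) * indicator {0..} r * f r \<partial>lborel)"
proof -
  have "(\<integral>\<^sup>+x. f (norm (x::real^4)) \<partial>lborel) = integral\<^sup>N (distr (lborel :: (real^4) measure) borel norm) f"
    using assms by (subst nn_integral_distr) auto
  also have "\<dots> = (\<integral>\<^sup>+r. ennreal (2 * pi\<^sup>2 * r ^ 3) * indicator {0..} r * f r \<partial>lborel)"
    unfolding distr_norm_lborel using assms by (subst nn_integral_density) auto
  finally show ?thesis .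
qed

section \<open>Affine substitutions\<close>

lemma nn_integral_dilation:
  fixes f :: "'a::euclidean_space \<Rightarrow> ennreal"
  assumes [measurable]: "f \<in> borel_measurable borel" and c: "c \<noteq> 0"
  shows "(\<integral>\<^sup>+x. f x \<partial>lborel) = ennreal (\<bar>c\<bar> ^ DIM('a)) * (\<integral>\<^sup>+x. f (t + c *\<^sub>R x) \<partial>lborel)"
  by (subst lborel_affine[OF c, of t])
     (simp add: nn_integral_density nn_integral_distr nn_integral_cmult)

lemma nn_integral_translation:
  fixes f :: "'a::euclidean_space \<Rightarrow> ennreal"
  assumes [measurable]: "f \<in> borel_measurable borel"
  shows "(\<integral>\<^sup>+x. f (x + t) \<partial>lborel) = (\<integral>\<^sup>+x. f x \<partial>lborel)"
  using nn_integral_dilation[OF assms, of 1 t] by (simp add: add.commute)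

lemma nn_integral_reflect:
  fixes f :: "'a::euclidean_space \<Rightarrow> ennreal"
  assumes [measurable]: "f \<in> borel_measurable borel"
  shows "(\<integral>\<^sup>+y. f (x - y) \<partial>lborel) = (\<integral>\<^sup>+y. f y \<partial>lborel)"
  using nn_integral_dilation[OF assms, of "-1" x] by simp

lemma lborel_distr_translation:
  "distr lborel borel (\<lambda>x. x + t) = (lborel :: 'a::euclidean_space measure)"
  using lborel_affine[of 1 t] by (simp add: density_1 add.commute)

lemma integral_translation:
  fixes f :: "'a::euclidean_space \<Rightarrow> real"
  assumes [measurable]: "f \<in> borel_measurable borel"
  shows "(\<integral>x. f (x + t) \<partial>lborel) = (\<integral>x. f x \<partial>lborel)"
  by (subst (2) lborel_distr_translation[of t, symmetric], subst integral_distr) auto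

lemma integrable_translation_iff:
  fixes f :: "'a::euclidean_space \<Rightarrow> real"
  assumes [measurable]: "f \<in> borel_measurable borel"
  shows "integrable lborel (\<lambda>x. f (x + t)) \<longleftrightarrow> integrable lborel f"
  by (subst (2) lborel_distr_translation[of t, symmetric], subst integrable_distr_eq) auto

section \<open>Power kernels in dimension four\<close>

lemma nn_integral_power_ball:
  assumes "a < 4" "0 < r"
  shows "(\<integral>\<^sup>+y. ennreal (norm (y::real^4) powr (-a) * indicator (ball 0 r) y) \<partial>lborel)
     = ennreal (2 * pi\<^sup>2 / (4 - a) * r powr (4 - a))"
proof -
  have "(\<integral>\<^sup>+y. ennreal (norm (y::real^4) powr (-a) * indicator (ball 0 r) y) \<partial>lborel)
     = (\<integral>\<^sup>+y. (\<lambda>s. ennreal (s powr (-a) * indicator {..<r} s)) (norm (y::real^4)) \<partial>lborel)"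
    by (intro nn_integral_cong) (auto simp: indicator_def)
  also have "\<dots> = (\<integral>\<^sup>+s. ennreal (2 * pi\<^sup>2 * s ^ 3) * indicator {0..} s * ennreal (s powr (-a) * indicator {..<r} s) \<partial>lborel)"
    by (rule nn_integral_radial) measurable
  also have "\<dots> = (\<integral>\<^sup>+s. ennreal (2 * pi\<^sup>2 * s powr (3 - a)) * indicator {0..r} s \<partial>lborel)"
  proof (rule nn_integral_cong_AE)
    have "AE s in lborel. s \<notin> {0, r}"
      by (rule AE_not_in) (simp add: finite_imp_null_set_lborel)
    then show "AE s in lborel. ennreal (2 * pi\<^sup>2 * s ^ 3) * indicator {0..} s * ennreal (s powr (-a) * indicator {..<r} s)
        = ennreal (2 * pi\<^sup>2 * s powr (3 - a)) * indicator {0..r} s"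
    proof eventually_elim
      case (elim s)
      have "s ^ 3 * s powr (-a) = s powr (3 - a)" if "s > 0"
        using that by (simp add: powr_diff powr_minus field_simps)
      then show ?case using elim
        by (auto simp: indicator_def ennreal_mult[symmetric] mult.assoc)
    qed
  qed
  also have "\<dots> = (\<integral>\<^sup>+s. ennreal (indicator {0..r} s * (2 * pi\<^sup>2 * s powr (3 - a))) \<partial>lborel)"
    by (intro nn_integral_cong) (auto simp: indicator_def)
  also have "\<dots> = ennreal (2 * pi\<^sup>2 / (4 - a) * r powr (4 - a) - 0)"
  proof (rule nn_integral_has_integral_lebesgue)
    have "((\<lambda>s. 2 * pi\<^sup>2 * s powr (3 - a)) has_integral (2 * pi\<^sup>2 * (r powr (3 - a + 1) / (3 - a + 1)))) {0..r}"
      using assms by (intro has_integral_mult_right has_integral_powr_from_0) auto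
    then show "((\<lambda>s. 2 * pi\<^sup>2 * s powr (3 - a)) has_integral (2 * pi\<^sup>2 / (4 - a) * r powr (4 - a) - 0)) {0..r}"
      by (simp add: field_simps)
  qed auto
  finally show ?thesis by simp
qed

lemma nn_integral_power_tail:
  assumes "4 < a" "0 < r"
  shows "(\<integral>\<^sup>+y. ennreal (norm (y::real^4) powr (-a) * indicator (- ball 0 r) y) \<partial>lborel)
     = ennreal (2 * pi\<^sup>2 / (a - 4) * r powr (4 - a))"
proof -
  have "(\<integral>\<^sup>+y. ennreal (norm (y::real^4) powr (-a) * indicator (- ball 0 r) y) \<partial>lborel)
     = (\<integral>\<^sup>+y. (\<lambda>s. ennreal (s powr (-a) * indicator {r..} s)) (norm (y::real^4)) \<partial>lborel)"
    by (intro nn_integral_cong) (auto simp: indicator_def)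
  also have "\<dots> = (\<integral>\<^sup>+s. ennreal (2 * pi\<^sup>2 * s ^ 3) * indicator {0..} s * ennreal (s powr (-a) * indicator {r..} s) \<partial>lborel)"
    by (rule nn_integral_radial) measurable
  also have "\<dots> = (\<integral>\<^sup>+s. ennreal (2 * pi\<^sup>2 * s powr (3 - a)) * indicator {r..} s \<partial>lborel)"
  proof (rule nn_integral_cong)
    fix s :: real
    have "s ^ 3 * s powr (-a) = s powr (3 - a)" if "s > 0"
      using that by (simp add: powr_diff powr_minus field_simps)
    then show "ennreal (2 * pi\<^sup>2 * s ^ 3) * indicator {0..} s * ennreal (s powr (-a) * indicator {r..} s)
        = ennreal (2 * pi\<^sup>2 * s powr (3 - a)) * indicator {r..} s"
      using assms by (auto simp: indicator_def ennreal_mult[symmetric] mult.assoc)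
  qed
  also have "\<dots> = ennreal (0 - (- (2 * pi\<^sup>2 / (a - 4) * r powr (4 - a))))"
  proof (rule nn_integral_FTC_atLeast)
    show "((\<lambda>s. - (2 * pi\<^sup>2 / (a - 4) * s powr (4 - a))) has_real_derivative 2 * pi\<^sup>2 * s powr (3 - a)) (at s)"
      if "r \<le> s" for s
      proof -
      have "((\<lambda>s. s powr (4 - a)) has_real_derivative (4 - a) * s powr (4 - a - 1)) (at s)"
        using that assms by (intro has_real_derivative_powr) auto
      from DERIV_cmult[OF this, of "- (2 * pi\<^sup>2 / (a - 4))"]
      have "((\<lambda>s. - (2 * pi\<^sup>2 / (a - 4) * s powr (4 - a))) has_real_derivative
          - (2 * pi\<^sup>2 / (a - 4)) * ((4 - a) * s powr (4 - a - 1))) (at s)"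
        by simp
      moreover have "- (2 * pi\<^sup>2 / (a - 4)) * ((4 - a) * z) = 2 * pi\<^sup>2 * z" for z :: real
        using assms by (simp add: divide_simps) (simp add: algebra_simps)
      moreover have "4 - a - 1 = 3 - a" by simp
      ultimately show ?thesis by simp
    qed
    have "((\<lambda>s. s powr (4 - a)) \<longlongrightarrow> 0) at_top"
      using assms by (intro tendsto_neg_powr filterlim_ident) auto
    from tendsto_mult_right_zero[OF this, of "- (2 * pi\<^sup>2 / (a - 4))"]
    show "((\<lambda>s. - (2 * pi\<^sup>2 / (a - 4) * s powr (4 - a))) \<longlongrightarrow> 0) at_top"
      by simp
  qed auto
  finally show ?thesis by simp
qed

lemma power_kernel_ball:
  fixes x :: "real^4"
  assumes "a < 4" "0 < r"
  shows "has_bochner_integral lborel (\<lambda>y. norm (x - y) powr (-a) * indicator (ball x r) y)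
            (2 * pi\<^sup>2 / (4 - a) * r powr (4 - a))"
proof (rule has_bochner_integral_nn_integral)
  have "(\<integral>\<^sup>+y. ennreal (norm (x - y) powr (-a) * indicator (ball x r) y) \<partial>lborel)
     = (\<integral>\<^sup>+y. (\<lambda>z. ennreal (norm z powr (-a) * indicator (ball 0 r) z)) (x - y) \<partial>lborel)"
    by (intro nn_integral_cong) (auto simp: indicator_def dist_norm norm_minus_commute)
  also have "\<dots> = ennreal (2 * pi\<^sup>2 / (4 - a) * r powr (4 - a))"
    by (rule trans[OF nn_integral_reflect nn_integral_power_ball[OF assms]]) measurable
  finally show "(\<integral>\<^sup>+y. ennreal (norm (x - y) powr (-a) * indicator (ball x r) y) \<partial>lborel)
     = ennreal (2 * pi\<^sup>2 / (4 - a) * r powr (4 - a))" .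
qed (use assms in auto)

lemma power_kernel_tail:
  fixes x :: "real^4"
  assumes "4 < a" "0 < r"
  shows "has_bochner_integral lborel (\<lambda>y. norm (x - y) powr (-a) * indicator (- ball x r) y)
            (2 * pi\<^sup>2 / (a - 4) * r powr (4 - a))"
proof (rule has_bochner_integral_nn_integral)
  have "(\<integral>\<^sup>+y. ennreal (norm (x - y) powr (-a) * indicator (- ball x r) y) \<partial>lborel)
     = (\<integral>\<^sup>+y. (\<lambda>z. ennreal (norm z powr (-a) * indicator (- ball 0 r) z)) (x - y) \<partial>lborel)"
    by (intro nn_integral_cong) (auto simp: indicator_def dist_norm norm_minus_commute)
  also have "\<dots> = ennreal (2 * pi\<^sup>2 / (a - 4) * r powr (4 - a))"
    by (rule trans[OF nn_integral_reflect nn_integral_power_tail[OF assms]]) measurable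
  finally show "(\<integral>\<^sup>+y. ennreal (norm (x - y) powr (-a) * indicator (- ball x r) y) \<partial>lborel)
     = ennreal (2 * pi\<^sup>2 / (a - 4) * r powr (4 - a))" .
qed (use assms in auto)

text \<open>Within distance \<open>r\<close> the bound on \<open>f\<close> meets an integrable
  singularity; beyond it the kernel is at most \<open>r powr (-a)\<close>. Since \<open>M\<close> is
  only a bound near \<open>x\<close>, the radius can later grow with \<open>norm x\<close> or be
  tuned to a small set.\<close>

lemma riesz_potential_bound:
  fixes f :: "real^4 \<Rightarrow> real" and x :: "real^4"
  assumes f: "integrable lborel f" and f0: "\<And>y. 0 \<le> f y"
    and M: "\<And>y. norm (x - y) < r \<Longrightarrow> f y \<le> M" and a: "0 \<le> a" "a < 4" and r: "0 < r"
  shows "integrable lborel (\<lambda>y. f y * norm (x - y) powr (-a))"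
    and "(\<integral>y. f y * norm (x - y) powr (-a) \<partial>lborel)
      \<le> M * (2 * pi\<^sup>2 / (4 - a) * r powr (4 - a)) + r powr (-a) * (\<integral>y. f y \<partial>lborel)"
proof -
  have [measurable]: "f \<in> borel_measurable borel" using f by auto
  let ?g = "\<lambda>y. M * (norm (x - y) powr (-a) * indicator (ball x r) y) + r powr (-a) * f y"
  have g: "has_bochner_integral lborel ?g
     (M * (2 * pi\<^sup>2 / (4 - a) * r powr (4 - a)) + r powr (-a) * (\<integral>y. f y \<partial>lborel))"
    using a r f by (intro has_bochner_integral_add has_bochner_integral_mult_right power_kernel_ball
        has_bochner_integral_integrable) auto
  have le: "f y * norm (x - y) powr (-a) \<le> ?g y" for y
  proof (cases "y \<in> ball x r")
    case True
    then have "f y * norm (x - y) powr (-a) \<le> M * norm (x - y) powr (-a)"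
      by (intro mult_right_mono M) (auto simp: dist_norm)
    then show ?thesis using True f0[of y] by (simp add: add_increasing2)
  next
    case False
    then have "r \<le> norm (x - y)" by (simp add: dist_norm)
    then have "norm (x - y) powr (-a) \<le> r powr (-a)"
      using r a by (intro powr_mono2') auto
    then show ?thesis using False f0[of y] by (simp add: mult_left_mono mult.commute)
  qed
  show int: "integrable lborel (\<lambda>y. f y * norm (x - y) powr (-a))"
    by (rule Bochner_Integration.integrable_bound[OF integrable.intros[OF g]])
       (use le f0 in \<open>auto intro!: AE_I2 simp: abs_mult intro: order_trans[OF _ abs_ge_self]\<close>)
  show "(\<integral>y. f y * norm (x - y) powr (-a) \<partial>lborel)
      \<le> M * (2 * pi\<^sup>2 / (4 - a) * r powr (4 - a)) + r powr (-a) * (\<integral>y. f y \<partial>lborel)"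
    unfolding has_bochner_integral_integral_eq[OF g, symmetric]
    by (rule integral_mono[OF int integrable.intros[OF g] le])
qed

subsection \<open>Inversion and change of variables\<close>

text \<open>Centred at the origin; other centres are reached by translating \<open>u\<close>.
  Division by zero fixes the origin instead of sending it to infinity, which keeps the map an
  involution.\<close>

definition inversion :: "real \<Rightarrow> 'a::real_inner \<Rightarrow> 'a" where
  "inversion l y = (l\<^sup>2 / (norm y)\<^sup>2) *\<^sub>R y"

lemma inversion_0 [simp]: "inversion l 0 = 0"
  by (simp add: inversion_def)

lemma norm_inversion: "norm (inversion l y) = l\<^sup>2 / norm y"
  by (simp add: inversion_def power2_eq_square)

lemma inversion_eq_0_iff [simp]: "l \<noteq> 0 \<Longrightarrow> inversion l y = 0 \<longleftrightarrow> y = 0"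
  by (simp add: inversion_def)

lemma inversion_inversion [simp]: "l \<noteq> 0 \<Longrightarrow> inversion l (inversion l y) = y"
  by (cases "y = 0") (simp_all add: inversion_def power2_eq_square field_simps)

lemma inversion_measurable [measurable]:
  "(inversion l :: 'a::euclidean_space \<Rightarrow> 'a) \<in> borel_measurable borel"
  unfolding inversion_def[abs_def] by measurable

lemma norm_inversion_diff:
  assumes "x \<noteq> 0" "y \<noteq> 0"
  shows "norm (inversion l x - inversion l y) = l\<^sup>2 * norm (x - y) / (norm x * norm y)"
proof -
  have "(norm (inversion l x - inversion l y))\<^sup>2 = (l\<^sup>2 * norm (x - y) / (norm x * norm y))\<^sup>2"
    using assms unfolding inversion_def
    by (simp add: power2_norm_eq_inner power_divide power_mult_distrib inner_diff inner_commute divide_simps)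
       (simp add: algebra_simps power2_eq_square inner_commute)
  then show ?thesis by (simp add: power2_eq_iff_nonneg)
qed

text \<open>The squared distance from \<open>x\<close> to the inverse of \<open>y\<close>, scaled by \<open>norm y / l\<close>,
  exceeds the squared distance from \<open>x\<close> to \<open>y\<close> by this gap.\<close>

definition reflection_gap :: "real \<Rightarrow> 'a::real_inner \<Rightarrow> 'a \<Rightarrow> real" where
  "reflection_gap l x y = (l\<^sup>2 - (norm x)\<^sup>2) * (l\<^sup>2 - (norm y)\<^sup>2) / l\<^sup>2"

lemma reflection_gap_commute: "reflection_gap l x y = reflection_gap l y x"
  by (simp add: reflection_gap_def mult.commute)

lemma reflection_gap_pos: "norm x < l \<Longrightarrow> norm y < l \<Longrightarrow> 0 < reflection_gap l x y"
  unfolding reflection_gap_def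
  by (intro divide_pos_pos mult_pos_pos)
     (auto simp: power_strict_mono intro: le_less_trans[OF norm_ge_zero] dest: le_less_trans[OF norm_ge_zero])

lemma norm_diff_inversion:
  assumes "y \<noteq> 0" "0 < l"
  shows "norm (x - inversion l y) = l / norm y * sqrt ((norm (x - y))\<^sup>2 + reflection_gap l x y)"
proof -
  have "(norm (x - inversion l y))\<^sup>2 = (l / norm y)\<^sup>2 * ((norm (x - y))\<^sup>2 + reflection_gap l x y)"
    using assms unfolding inversion_def reflection_gap_def
    by (simp add: power2_norm_eq_inner power_divide power_mult_distrib inner_diff inner_commute divide_simps)
       (simp add: algebra_simps power2_eq_square power4_eq_xxxx inner_commute)
  then have "sqrt ((norm (x - inversion l y))\<^sup>2)
      = sqrt ((l / norm y)\<^sup>2 * ((norm (x - y))\<^sup>2 + reflection_gap l x y))"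
    by simp
  then show ?thesis using assms by (simp add: real_sqrt_mult)
qed

text \<open>The derivative is a homothety composed with the reflection in the hyperplane orthogonal
  to \<open>y\<close>. This form makes the Jacobian determinant immediate.\<close>

lemma inversion_has_derivative:
  fixes y :: "'a::real_inner"
  assumes "y \<noteq> 0"
  shows "(inversion l has_derivative
     (\<lambda>h. (l\<^sup>2 / (norm y)\<^sup>2) *\<^sub>R (h - (2 * (y \<bullet> h) / (norm y)\<^sup>2) *\<^sub>R y))) (at y within S)"
proof -
  have "((\<lambda>y. (l\<^sup>2 / (y \<bullet> y)) *\<^sub>R y) has_derivative
     (\<lambda>h. (l\<^sup>2 / (y \<bullet> y)) *\<^sub>R h + (- l\<^sup>2 * (2 * (y \<bullet> h)) / (y \<bullet> y)\<^sup>2) *\<^sub>R y)) (at y within S)"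
    using assms
    by (auto intro!: derivative_eq_intros simp: inner_commute power2_eq_square field_simps fun_eq_iff)
  moreover have "inversion l = (\<lambda>y. (l\<^sup>2 / (y \<bullet> y)) *\<^sub>R (y::'a))"
    by (simp add: inversion_def power2_norm_eq_inner fun_eq_iff)
  moreover have "(\<lambda>h. (l\<^sup>2 / (norm y)\<^sup>2) *\<^sub>R (h - (2 * (y \<bullet> h) / (norm y)\<^sup>2) *\<^sub>R y))
     = (\<lambda>h. (l\<^sup>2 / (y \<bullet> y)) *\<^sub>R h + (- l\<^sup>2 * (2 * (y \<bullet> h)) / (y \<bullet> y)\<^sup>2) *\<^sub>R y)"
    unfolding power2_norm_eq_inner by (simp add: fun_eq_iff algebra_simps power2_eq_square)
  ultimately show ?thesis by simp
qed

lemma orthogonal_transformation_reflection: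
  fixes y :: "'a::real_inner"
  assumes "y \<noteq> 0"
  shows "orthogonal_transformation (\<lambda>h. h - (2 * (y \<bullet> h) / (norm y)\<^sup>2) *\<^sub>R y)"
  unfolding orthogonal_transformation_def
proof safe
  show "linear (\<lambda>h. h - (2 * (y \<bullet> h) / (norm y)\<^sup>2) *\<^sub>R y)"
    by (rule linearI) (auto simp: inner_add_right algebra_simps add_divide_distrib)
  show "(v - (2 * (y \<bullet> v) / (norm y)\<^sup>2) *\<^sub>R y) \<bullet> (w - (2 * (y \<bullet> w) / (norm y)\<^sup>2) *\<^sub>R y) = v \<bullet> w" for v w
    using assms
    by (simp add: power2_norm_eq_inner inner_diff inner_commute divide_simps)
qed

lemma abs_det_inversion_derivative:
  fixes y :: "real^'n"
  assumes "y \<noteq> 0"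
  shows "\<bar>det (matrix (\<lambda>h. (l\<^sup>2 / (norm y)\<^sup>2) *\<^sub>R (h - (2 * (y \<bullet> h) / (norm y)\<^sup>2) *\<^sub>R y)))\<bar>
     = (l / norm y) ^ (2 * CARD('n))"
proof -
  let ?R = "\<lambda>h. h - (2 * (y \<bullet> h) / (norm y)\<^sup>2) *\<^sub>R y" and ?k = "l\<^sup>2 / (norm y)\<^sup>2"
  have R: "orthogonal_transformation ?R"
    by (rule orthogonal_transformation_reflection[OF assms])
  have "matrix (\<lambda>h. ?k *\<^sub>R ?R h) = matrix ((\<lambda>h. ?k *\<^sub>R h) \<circ> ?R)"
    by (simp add: o_def)
  also have "\<dots> = matrix ((*\<^sub>R) ?k) ** matrix ?R"
    using R by (subst matrix_compose) (auto simp: orthogonal_transformation_def intro: linearI simp: algebra_simps)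
  finally have "\<bar>det (matrix (\<lambda>h. ?k *\<^sub>R ?R h))\<bar> = \<bar>?k ^ CARD('n)\<bar>"
    using orthogonal_transformation_det[OF R] by (simp add: det_mul det_matrix_scaleR abs_mult)
  then show ?thesis
    by (simp add: power_mult power_divide)
qed

text \<open>Lebesgue measure is determined by its values on boxes. A box without the origin is the
  injective differentiable image of \<open>S\<close>, so the change of variables formula computes
  its volume; the origin, where inversion is not differentiable, costs only a null set.\<close>

theorem lborel_eq_distr_inversion:
  assumes l: "0 < l"
  shows "lborel = distr (density lborel (\<lambda>y::real^'n::{finite,wellorder}. ennreal ((l / norm y) ^ (2 * CARD('n))))) borel (inversion l)"
proof (rule lborel_eqI)
  fix a b :: "real^'n::{finite,wellorder}"
  assume ab: "\<And>i. i \<in> Basis \<Longrightarrow> a \<bullet> i \<le> b \<bullet> i"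
  let ?J = "\<lambda>y::real^'n::{finite,wellorder}. (l / norm y) ^ (2 * CARD('n))"
  let ?m = "\<Prod>i\<in>Basis. (b - a) \<bullet> i"
  define S where "S = inversion l -` box a b - {0}"
  have S: "S \<in> sets borel"
    unfolding S_def using measurable_sets[OF inversion_measurable, of "box a b" l] by auto
  have "inversion l ` S = box a b - {0}"
  proof (intro equalityI subsetI; clarsimp)
    fix y assume "y \<in> box a b" "y \<noteq> 0"
    then have "inversion l y \<in> S" using l by (auto simp: S_def)
    then show "y \<in> inversion l ` S"
      using l by (intro image_eqI[of _ _ "inversion l y"]) auto
  qed (use l in \<open>auto simp: S_def\<close>)
  moreover have "inversion l ` S \<in> lmeasurable \<and> measure lebesgue (inversion l ` S) = ?m \<longleftrightarrow>
      ((\<lambda>y. \<bar>det (matrix (\<lambda>h. (l\<^sup>2 / (norm y)\<^sup>2) *\<^sub>R (h - (2 * (y \<bullet> h) / (norm y)\<^sup>2) *\<^sub>R y)))\<bar>) has_integral ?m) S"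
  proof (rule has_measure_differentiable_image)
    show "S \<in> sets lebesgue" using S by auto
    show "inj_on (inversion l) S"
      using l by (metis inj_on_inverseI inversion_inversion less_irrefl)
  qed (auto simp: S_def intro: inversion_has_derivative)
  moreover have "measure lebesgue (box a b - {0}) = measure lebesgue (box a b)"
    by (rule measure_Diff_null_set) (auto simp: negligible_iff_null_sets[symmetric])
  moreover have "box a b - {0} \<in> lmeasurable"
    by (intro fmeasurable_Diff) auto
  moreover have "measure lebesgue (box a b) = ?m"
    using ab by (simp add: measure_completion)
  ultimately have "((\<lambda>y. \<bar>det (matrix (\<lambda>h. (l\<^sup>2 / (norm y)\<^sup>2) *\<^sub>R (h - (2 * (y \<bullet> h) / (norm y)\<^sup>2) *\<^sub>R y)))\<bar>) has_integral ?m) S"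
    by simp
  then have "(?J has_integral ?m) S"
    by (rule has_integral_eq[rotated]) (auto simp: S_def abs_det_inversion_derivative)
  then have "(\<integral>\<^sup>+y. ennreal (?J y) * indicator S y \<partial>lborel) = ennreal ?m"
    by (rule nn_integral_has_integral_lebesgue'[rotated]) (use l in auto)
  moreover have "emeasure (distr (density lborel (\<lambda>y. ennreal (?J y))) borel (inversion l)) (box a b)
      = (\<integral>\<^sup>+y. ennreal (?J y) * indicator (inversion l -` box a b) y \<partial>lborel)"
    using measurable_sets[OF inversion_measurable, of "box a b" l]
    by (subst emeasure_distr) (auto simp: emeasure_density)
  moreover have "\<dots> = (\<integral>\<^sup>+y. ennreal (?J y) * indicator S y \<partial>lborel)"
    by (intro nn_integral_cong) (auto simp: S_def indicator_def)
  ultimately show "emeasure (distr (density lborel (\<lambda>y. ennreal (?J y))) borel (inversion l)) (box a b) = ennreal ?m"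
    by simp
qed simp

lemma nn_integral_inversion:
  fixes f :: "real^4 \<Rightarrow> ennreal"
  assumes l: "0 < l" and [measurable]: "f \<in> borel_measurable borel"
  shows "(\<integral>\<^sup>+y. f y \<partial>lborel) = (\<integral>\<^sup>+y. ennreal ((l / norm y) ^ 8) * f (inversion l y) \<partial>lborel)"
  by (subst lborel_eq_distr_inversion[OF l]) (simp add: nn_integral_distr nn_integral_density)

lemma
  fixes f :: "real^4 \<Rightarrow> real"
  assumes l: "0 < l" and [measurable]: "f \<in> borel_measurable borel"
  shows integral_inversion:
      "(\<integral>y. f y \<partial>lborel) = (\<integral>y. (l / norm y) ^ 8 * f (inversion l y) \<partial>lborel)" (is ?thesis1)
    and integrable_inversion_iff:
      "integrable lborel f \<longleftrightarrow> integrable lborel (\<lambda>y. (l / norm y) ^ 8 * f (inversion l y))" (is ?thesis2)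
proof -
  show ?thesis1 using l
    by (subst lborel_eq_distr_inversion[OF l]) (simp add: integral_distr integral_density)
  show ?thesis2 using l
    by (subst lborel_eq_distr_inversion[OF l]) (simp add: integrable_distr_eq integrable_density)
qed

text \<open>Jensen's inequality through the tangent of \<open>exp\<close> at \<open>t\<close>, the
  integral of \<open>f * h\<close>. The mass of \<open>f\<close> is only bounded by
  \<open>\<eta>\<close>, so \<open>(1 - t)\<close> times the mass is compared with
  \<open>(1 - t) * \<eta>\<close>, which has the right direction only for \<open>t \<ge> 1\<close>;
  the summand \<open>exp 1\<close> pays for smaller \<open>t\<close>. The right side may be
  infinite.\<close>

lemma exp_integral_le_Jensen:
  assumes f: "integrable M f" and f0: "\<And>y. 0 \<le> f y" and m: "(\<integral>y. f y \<partial>M) \<le> \<eta>" and \<eta>: "0 < \<eta>"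
    and fh: "integrable M (\<lambda>y. f y * h y)" and [measurable]: "h \<in> borel_measurable M"
  shows "ennreal (exp (\<integral>y. f y * h y \<partial>M))
     \<le> ennreal (exp 1) + ennreal (1 / \<eta>) * (\<integral>\<^sup>+y. ennreal (f y * exp (\<eta> * h y)) \<partial>M)"
proof -
  define t where "t = (\<integral>y. f y * h y \<partial>M)"
  have [measurable]: "f \<in> borel_measurable M" using f by auto
  consider "t \<le> 1" | "1 < t" "(\<integral>\<^sup>+y. ennreal (f y * exp (\<eta> * h y)) \<partial>M) = \<infinity>"
    | "1 < t" "(\<integral>\<^sup>+y. ennreal (f y * exp (\<eta> * h y)) \<partial>M) < \<infinity>"
    by (metis infinity_ennreal_def not_le top.not_eq_extremum)
  then show ?thesis
  proof cases
    case 1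
    then have "ennreal (exp t) \<le> ennreal (exp 1)" by simp
    then show ?thesis unfolding t_def by (rule order_trans) simp
  next
    case 2
    then show ?thesis using \<eta> by (simp add: ennreal_mult_top)
  next
    case 3
    have int: "integrable M (\<lambda>y. f y * exp (\<eta> * h y))"
      using 3 f0 by (intro integrableI_nonneg) auto
    have ptw: "f y * (exp t * (1 + \<eta> * h y - t)) \<le> f y * exp (\<eta> * h y)" for y
    proof (rule mult_left_mono[OF _ f0])
      have "exp t * (1 + (\<eta> * h y - t)) \<le> exp t * exp (\<eta> * h y - t)"
        by (intro mult_left_mono exp_ge_add_one_self) auto
      then show "exp t * (1 + \<eta> * h y - t) \<le> exp (\<eta> * h y)"
        by (simp add: exp_add[symmetric] algebra_simps)
    qed
    have eq: "f y * (exp t * (1 + \<eta> * h y - t)) = exp t * (1 - t) * f y + exp t * \<eta> * (f y * h y)" for y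
      by (simp add: algebra_simps)
    have "exp t * \<eta> \<le> exp t * (1 - t) * (\<integral>y. f y \<partial>M) + exp t * \<eta> * t"
    proof -
      have "0 \<le> (t - 1) * (\<eta> - (\<integral>y. f y \<partial>M))" using 3 m by simp
      then have "exp t * 0 \<le> exp t * ((t - 1) * (\<eta> - (\<integral>y. f y \<partial>M)))"
        by (intro mult_left_mono) auto
      then show ?thesis by (simp add: algebra_simps)
    qed
    also have "\<dots> = (\<integral>y. exp t * (1 - t) * f y + exp t * \<eta> * (f y * h y) \<partial>M)"
      using f fh by (simp add: t_def)
    also have "\<dots> = (\<integral>y. f y * (exp t * (1 + \<eta> * h y - t)) \<partial>M)"
      by (simp add: eq)
    also have "\<dots> \<le> (\<integral>y. f y * exp (\<eta> * h y) \<partial>M)"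
      using f fh int ptw by (intro integral_mono) (auto simp: eq)
    finally have "exp t \<le> 1 / \<eta> * (\<integral>y. f y * exp (\<eta> * h y) \<partial>M)"
      using \<eta> by (simp add: field_simps)
    then have "ennreal (exp t) \<le> ennreal (1 / \<eta> * (\<integral>y. f y * exp (\<eta> * h y) \<partial>M))"
      by (rule ennreal_leI)
    also have "\<dots> = ennreal (1 / \<eta>) * (\<integral>\<^sup>+y. ennreal (f y * exp (\<eta> * h y)) \<partial>M)"
    proof -
      have "ennreal (1 / \<eta> * (\<integral>y. f y * exp (\<eta> * h y) \<partial>M)) = ennreal (1 / \<eta>) * ennreal (\<integral>y. f y * exp (\<eta> * h y) \<partial>M)"
        using \<eta> f0 by (intro ennreal_mult) auto
      also have "ennreal (\<integral>y. f y * exp (\<eta> * h y) \<partial>M) = (\<integral>\<^sup>+y. ennreal (f y * exp (\<eta> * h y)) \<partial>M)"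
        using int f0 by (intro nn_integral_eq_integral[symmetric]) auto
      finally show ?thesis .
    qed
    finally show ?thesis unfolding t_def by (rule order_trans) simp
  qed
qed

subsection \<open>Boundedness\<close>

definition local_kernel :: "real \<Rightarrow> real^4 \<Rightarrow> real" where
  "local_kernel a z = (if norm z < 1 then norm z powr (-a) else 0)"

lemma local_kernel_measurable [measurable]: "local_kernel a \<in> borel_measurable borel"
  unfolding local_kernel_def[abs_def] by measurable

lemma local_kernel_nonneg [simp]: "0 \<le> local_kernel a z"
  by (simp add: local_kernel_def)

lemma local_kernel_diff_eq:
  "local_kernel a (x - y) = norm (x - y) powr (-a) * indicator (ball x 1) y"
  by (simp add: local_kernel_def indicator_def dist_norm)

lemma local_kernel_commute: "local_kernel a (x - y) = local_kernel a (y - x)"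
  by (simp add: local_kernel_def norm_minus_commute)

lemma has_bochner_integral_local_kernel:
  "a < 4 \<Longrightarrow> has_bochner_integral lborel (\<lambda>y. local_kernel a (x - y)) (2 * pi\<^sup>2 / (4 - a))"
  using power_kernel_ball[of a 1 x] by (simp add: local_kernel_diff_eq)

lemma nn_integral_local_kernel:
  assumes "a < 4"
  shows "(\<integral>\<^sup>+y. ennreal (local_kernel a (x - y)) \<partial>lborel) = ennreal (2 * pi\<^sup>2 / (4 - a))"
  using has_bochner_integral_local_kernel[OF assms, of x]
  by (subst nn_integral_eq_integral) (auto simp: has_bochner_integral_iff)

text \<open>Whichever point is nearer dominates both factors. This bounds the integral of a product
  of two kernels uniformly in their centres, as a convolution estimate would, provided that
  \<open>a + b < 4\<close>.\<close>

lemma local_kernel_mult_le: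
  assumes "0 \<le> a" "0 \<le> b"
  shows "local_kernel a z * local_kernel b w \<le> local_kernel (a + b) z + local_kernel (a + b) w"
proof (cases "norm z < 1 \<and> norm w < 1 \<and> z \<noteq> 0 \<and> w \<noteq> 0")
  case True
  then consider "norm z \<le> norm w" | "norm w \<le> norm z" by linarith
  then show ?thesis
  proof cases
    case 1
    then have "norm w powr (-b) \<le> norm z powr (-b)"
      using True assms by (intro powr_mono2') auto
    then have "norm z powr (-a) * norm w powr (-b) \<le> norm z powr (-(a + b))"
      using powr_add[of "norm z" "-a" "-b"] by (simp add: mult_left_mono)
    then show ?thesis using True by (simp add: local_kernel_def add_increasing2)
  next
    case 2
    then have "norm z powr (-a) \<le> norm w powr (-a)"
      using True assms by (intro powr_mono2') auto
    then have "norm z powr (-a) * norm w powr (-b) \<le> norm w powr (-(a + b))"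
      using powr_add[of "norm w" "-a" "-b"] by (simp add: mult_right_mono)
    then show ?thesis using True by (simp add: local_kernel_def add_increasing)
  qed
qed (auto simp: local_kernel_def)

lemma neg_ln_le_inverse: "0 \<le> s \<Longrightarrow> - ln s \<le> s powr (-1)" for s :: real
proof (cases "s = 0")
  case False
  moreover assume "0 \<le> s"
  ultimately have s: "0 < s" by simp
  have "ln (inverse s) \<le> inverse s - 1" using s by (intro ln_le_minus_one) simp
  then show ?thesis using s by (simp add: ln_inverse powr_minus)
qed simp

definition riesz :: "real \<Rightarrow> (real^4 \<Rightarrow> real) \<Rightarrow> real^4 \<Rightarrow> real" where
  "riesz \<alpha> u x = (\<integral>y. exp (u y) * norm (x - y) powr (-\<alpha>) \<partial>lborel)"

definition source :: "real \<Rightarrow> (real^4 \<Rightarrow> real) \<Rightarrow> real^4 \<Rightarrow> real" where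
  "source \<alpha> u x = riesz \<alpha> u x * exp (u x)"

text \<open>The hypotheses transferred to Borel sets. The additive constant \<open>c0\<close> is a
  parameter because translates of \<open>u\<close> satisfy the same assumptions with the same
  \<open>c0\<close>, a fact that ties the inversion radii at different centres together.\<close>

locale choquard_solution =
  fixes \<alpha> c0 :: real and u :: "real^4 \<Rightarrow> real"
  assumes \<alpha>: "0 < \<alpha>" "\<alpha> < 4"
    and u_meas [measurable]: "u \<in> borel_measurable borel"
    and F_int: "integrable lborel (source \<alpha> u)"
    and lnF_int: "\<And>x. integrable lborel (\<lambda>y. ln (norm (x - y)) * source \<alpha> u y)"
    and u_eq: "\<And>x. u x = - (1 / (8 * pi\<^sup>2)) * (\<integral>y. ln (norm (x - y)) * source \<alpha> u y \<partial>lborel) + c0"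
    and Ep_int: "integrable lborel (\<lambda>x. exp (8 / (8 - \<alpha>) * u x))"
begin

abbreviation "V \<equiv> riesz \<alpha> u"
abbreviation "F \<equiv> source \<alpha> u"

definition mass :: real where "mass = (\<integral>x. F x \<partial>lborel)"

lemma V_measurable [measurable]: "V \<in> borel_measurable borel"
  unfolding riesz_def[abs_def] by measurable

lemma F_measurable [measurable]: "F \<in> borel_measurable borel"
  unfolding source_def[abs_def] by measurable

lemma V_nonneg: "0 \<le> V x"
  unfolding riesz_def by (intro Bochner_Integration.integral_nonneg) simp

lemma F_nonneg: "0 \<le> F x"
  unfolding source_def using V_nonneg by simp

lemma nn_integral_F: "(\<integral>\<^sup>+x. ennreal (F x) \<partial>lborel) = ennreal mass"
  unfolding mass_def using F_int F_nonneg by (intro nn_integral_eq_integral) auto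

lemma mass_nonneg: "0 \<le> mass"
  unfolding mass_def using F_nonneg by (intro Bochner_Integration.integral_nonneg) auto

lemma truncation_remainder_small:
  assumes "0 < \<eta>"
  obtains T where "0 \<le> T" "(\<integral>x. max 0 (F x - T) \<partial>lborel) \<le> \<eta>"
proof -
  have "(\<lambda>n. \<integral>x. max 0 (F x - real n) \<partial>lborel) \<longlonglongrightarrow> (\<integral>x. 0 \<partial>(lborel :: (real^4) measure))"
  proof (rule integral_dominated_convergence[where w = F])
    show "AE x in lborel. (\<lambda>n. max 0 (F x - real n)) \<longlonglongrightarrow> 0"
    proof (intro AE_I2)
      fix x
      have "eventually (\<lambda>n. max 0 (F x - real n) = 0) sequentially"
        using eventually_ge_at_top[of "nat \<lceil>F x\<rceil>"]
        by eventually_elim (auto simp: nat_ceiling_le_eq)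
      then show "(\<lambda>n. max 0 (F x - real n)) \<longlonglongrightarrow> 0"
        by (rule tendsto_eventually)
    qed
    show "AE x in lborel. norm (max 0 (F x - real n)) \<le> F x" for n
      using F_nonneg by (auto intro!: AE_I2)
  qed (use F_int in auto)
  then have "eventually (\<lambda>n. (\<integral>x. max 0 (F x - real n) \<partial>lborel) < \<eta>) sequentially"
    using assms by (intro order_tendstoD) simp_all
  then obtain n where "(\<integral>x. max 0 (F x - real n) \<partial>lborel) < \<eta>"
    by (auto simp: eventually_sequentially)
  then show ?thesis by (intro that[of "real n"]) auto
qed

text \<open>Beyond distance 1 the kernel \<open>- ln (norm (x - y))\<close> is not positive, so
  dropping that part bounds \<open>u\<close> from above. What remains is dominated by the power
  kernel of exponent 1.\<close>

lemma
  defines "h \<equiv> \<lambda>x y. - ln (norm (x - y)) * indicator (ball x 1) y"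
  shows neg_ln_local_nonneg: "0 \<le> h x y"
    and neg_ln_local_le: "h x y \<le> local_kernel 1 (x - y)"
    and neg_ln_local_integrable: "integrable lborel (\<lambda>y. F y * h x y)"
    and u_le_neg_ln_local: "u x \<le> 1 / (8 * pi\<^sup>2) * (\<integral>y. F y * h x y \<partial>lborel) + c0"
proof -
  show h0: "0 \<le> h x y" for y
    by (cases "x = y") (auto simp: h_def dist_norm indicator_def)
  show "h x y \<le> local_kernel 1 (x - y)"
    using neg_ln_le_inverse[of "norm (x - y)"] by (auto simp: h_def local_kernel_diff_eq indicator_def)
  have [measurable]: "(\<lambda>y. h x y) \<in> borel_measurable borel" unfolding h_def by measurable
  show int: "integrable lborel (\<lambda>y. F y * h x y)"
    by (rule Bochner_Integration.integrable_bound[OF lnF_int[of x]])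
       (auto simp: h_def abs_mult indicator_def)
  have "- ln (norm (x - y)) * F y \<le> F y * h x y" for y
  proof (cases "y \<in> ball x 1")
    case False
    then have "0 \<le> ln (norm (x - y))" by (simp add: dist_norm)
    then show ?thesis using False F_nonneg[of y] by (simp add: h_def)
  qed (simp add: h_def)
  then have "(\<integral>y. - (ln (norm (x - y)) * F y) \<partial>lborel) \<le> (\<integral>y. F y * h x y \<partial>lborel)"
    using lnF_int[of x] int by (intro integral_mono) auto
  then have "- (\<integral>y. ln (norm (x - y)) * F y \<partial>lborel) \<le> (\<integral>y. F y * h x y \<partial>lborel)"
    by simp
  then have "1 / (8 * pi\<^sup>2) * - (\<integral>y. ln (norm (x - y)) * F y \<partial>lborel)
      \<le> 1 / (8 * pi\<^sup>2) * (\<integral>y. F y * h x y \<partial>lborel)"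
    by (intro mult_left_mono) auto
  then show "u x \<le> 1 / (8 * pi\<^sup>2) * (\<integral>y. F y * h x y \<partial>lborel) + c0"
    using u_eq[of x] by simp
qed

text \<open>Only the part of the source above a high level \<open>T\<close>, whose mass is small, makes
  the logarithmic potential unbounded; Jensen's inequality turns its exponential into an
  integral against a weakly singular kernel.\<close>

lemma exp_u_le_weak_potential:
  assumes "0 < \<epsilon>"
  obtains A where "0 < A"
    "\<And>x. ennreal (exp (u x)) \<le> ennreal A * (1 + (\<integral>\<^sup>+y. ennreal (F y * local_kernel \<epsilon> (x - y)) \<partial>lborel))"
proof -
  define c where "c = 1 / (8 * pi\<^sup>2)"
  have c: "0 < c" by (simp add: c_def)
  \<comment> \<open>With this mass \<open>exp (\<eta> * (c * h x y))\<close> is exactly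
    \<open>norm (x - y) powr (-\<epsilon>)\<close> for \<open>y\<close> in the punctured unit ball
    around \<open>x\<close>, so any \<open>\<epsilon>\<close> can be reached by truncating high
    enough.\<close>
  define \<eta> where "\<eta> = \<epsilon> / c"
  have \<eta>: "0 < \<eta>" using assms c by (simp add: \<eta>_def)
  obtain T where T: "0 \<le> T" "(\<integral>x. max 0 (F x - T) \<partial>lborel) \<le> \<eta>"
    by (rule truncation_remainder_small[OF \<eta>])
  define F2 where "F2 x = max 0 (F x - T)" for x
  define h where "h x y = - ln (norm (x - y)) * indicator (ball x 1) y" for x y :: "real^4"
  note h = neg_ln_local_nonneg[folded h_def] neg_ln_local_le[folded h_def]
    neg_ln_local_integrable[folded h_def] u_le_neg_ln_local[folded h_def c_def]
  define K where "K = c * (T * (2 * pi\<^sup>2 / 3)) + c0"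
  define A where "A = exp K * (exp 1 + 1 / \<eta> * mass + 1 / \<eta>)"
  have A: "0 < A" unfolding A_def using \<eta> mass_nonneg by (intro mult_pos_pos add_pos_nonneg) auto
  have F2: "0 \<le> F2 y" "F2 y \<le> F y" "F y \<le> F2 y + T" for y
    using T F_nonneg[of y] by (auto simp: F2_def)
  have [measurable]: "F2 \<in> borel_measurable borel" unfolding F2_def[abs_def] by measurable
  have F2_int: "integrable lborel F2"
    by (rule Bochner_Integration.integrable_bound[OF F_int]) (use F2 F_nonneg in auto)
  have [measurable]: "(\<lambda>y. h x y) \<in> borel_measurable borel" for x unfolding h_def by measurable
  have bound: "ennreal (exp (u x)) \<le> ennreal A * (1 + (\<integral>\<^sup>+y. ennreal (F y * local_kernel \<epsilon> (x - y)) \<partial>lborel))" for x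
  proof -
    define \<Phi> where "\<Phi> = (\<integral>\<^sup>+y. ennreal (F y * local_kernel \<epsilon> (x - y)) \<partial>lborel)"
    have F2h: "integrable lborel (\<lambda>y. F2 y * h x y)"
      by (rule Bochner_Integration.integrable_bound[OF h(3)[of x]])
         (use F2 F_nonneg h(1)[of x] in \<open>auto simp: abs_mult intro!: mult_right_mono\<close>)
    have k1: "integrable lborel (\<lambda>y. local_kernel 1 (x - y))"
      "(\<integral>y. local_kernel 1 (x - y) \<partial>lborel) = 2 * pi\<^sup>2 / 3"
      using has_bochner_integral_local_kernel[of 1 x] by (auto simp: has_bochner_integral_iff)
    have "(\<integral>y. F y * h x y \<partial>lborel) \<le> (\<integral>y. F2 y * h x y + T * local_kernel 1 (x - y) \<partial>lborel)"
    proof (rule integral_mono)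
      fix y
      have "F y * h x y \<le> (F2 y + T) * h x y"
        by (intro mult_right_mono F2 h)
      also have "\<dots> \<le> F2 y * h x y + T * local_kernel 1 (x - y)"
        using T h(2)[of x y] by (simp add: distrib_right mult_left_mono)
      finally show "F y * h x y \<le> F2 y * h x y + T * local_kernel 1 (x - y)" .
    qed (use h(3)[of x] F2h k1 in auto)
    also have "\<dots> = (\<integral>y. F2 y * h x y \<partial>lborel) + T * (2 * pi\<^sup>2 / 3)"
      using F2h k1 by simp
    finally have "c * (\<integral>y. F y * h x y \<partial>lborel) \<le> c * ((\<integral>y. F2 y * h x y \<partial>lborel) + T * (2 * pi\<^sup>2 / 3))"
      using c by (intro mult_left_mono) auto
    then have "u x \<le> K + c * (\<integral>y. F2 y * h x y \<partial>lborel)"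
      using h(4)[of x] by (simp add: K_def algebra_simps)
    also have "c * (\<integral>y. F2 y * h x y \<partial>lborel) = (\<integral>y. F2 y * (c * h x y) \<partial>lborel)"
      by (simp add: mult.left_commute)
    finally have "exp (u x) \<le> exp K * exp (\<integral>y. F2 y * (c * h x y) \<partial>lborel)"
      by (simp add: exp_add[symmetric])
    then have "ennreal (exp (u x)) \<le> ennreal (exp K * exp (\<integral>y. F2 y * (c * h x y) \<partial>lborel))"
      by (rule ennreal_leI)
    also have "\<dots> = ennreal (exp K) * ennreal (exp (\<integral>y. F2 y * (c * h x y) \<partial>lborel))"
      by (simp add: ennreal_mult)
    also have "ennreal (exp (\<integral>y. F2 y * (c * h x y) \<partial>lborel))
        \<le> ennreal (exp 1) + ennreal (1 / \<eta>) * (\<integral>\<^sup>+y. ennreal (F2 y * exp (\<eta> * (c * h x y))) \<partial>lborel)"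
    proof (rule exp_integral_le_Jensen[OF F2_int])
      have "integrable lborel (\<lambda>y. c * (F2 y * h x y))" using F2h by simp
      then show "integrable lborel (\<lambda>y. F2 y * (c * h x y))" by (simp add: mult.left_commute)
    qed (use F2 T \<eta> in \<open>auto simp: F2_def\<close>)
    also have "(\<integral>\<^sup>+y. ennreal (F2 y * exp (\<eta> * (c * h x y))) \<partial>lborel)
        \<le> (\<integral>\<^sup>+y. ennreal (F y) + ennreal (F y * local_kernel \<epsilon> (x - y)) \<partial>lborel)"
    proof (rule nn_integral_mono)
      fix y
      \<comment> \<open>The summand 1 covers the points outside the ball and the diagonal, where
        \<open>h\<close> vanishes.\<close>
      have "exp (\<eta> * (c * h x y)) \<le> 1 + local_kernel \<epsilon> (x - y)"
        using c by (auto simp: \<eta>_def h_def local_kernel_diff_eq indicator_def powr_def)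
      then have "F2 y * exp (\<eta> * (c * h x y)) \<le> F y * (1 + local_kernel \<epsilon> (x - y))"
        using F2 F_nonneg by (intro mult_mono) auto
      then have "F2 y * exp (\<eta> * (c * h x y)) \<le> F y + F y * local_kernel \<epsilon> (x - y)"
        by (simp add: algebra_simps)
      then have "ennreal (F2 y * exp (\<eta> * (c * h x y))) \<le> ennreal (F y + F y * local_kernel \<epsilon> (x - y))"
        by (rule ennreal_leI)
      also have "\<dots> = ennreal (F y) + ennreal (F y * local_kernel \<epsilon> (x - y))"
        using F_nonneg by (intro ennreal_plus) auto
      finally show "ennreal (F2 y * exp (\<eta> * (c * h x y))) \<le> \<dots>" .
    qed
    also have "\<dots> = ennreal mass + \<Phi>"
      unfolding \<Phi>_def by (subst nn_integral_add) (auto simp: nn_integral_F)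
    also have "ennreal (exp K) * (ennreal (exp 1) + ennreal (1 / \<eta>) * (ennreal mass + \<Phi>))
       = ennreal (exp K * (exp 1 + 1 / \<eta> * mass)) + ennreal (exp K * (1 / \<eta>)) * \<Phi>"
    proof -
      have e: "0 \<le> 1 / \<eta>" using \<eta> by simp
      have "ennreal (exp 1) + ennreal (1 / \<eta>) * ennreal mass = ennreal (exp 1 + 1 / \<eta> * mass)"
        unfolding ennreal_mult[OF e mass_nonneg, symmetric]
        using e mass_nonneg by (intro ennreal_plus[symmetric] mult_nonneg_nonneg) auto
      then have "ennreal (exp 1) + ennreal (1 / \<eta>) * (ennreal mass + \<Phi>)
          = ennreal (exp 1 + 1 / \<eta> * mass) + ennreal (1 / \<eta>) * \<Phi>"
        by (simp only: distrib_left add.assoc[symmetric])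
      moreover have "0 \<le> exp 1 + 1 / \<eta> * mass"
        using e mass_nonneg by (intro add_nonneg_nonneg mult_nonneg_nonneg) auto
      ultimately show ?thesis
        using e by (simp only: ennreal_mult[of "exp K"] exp_ge_zero mult.assoc) (simp only: distrib_left)
    qed
    also have "\<dots> \<le> ennreal A * 1 + ennreal A * \<Phi>"
    proof (intro add_mono mult_right_mono)
      have "exp K * (exp 1 + 1 / \<eta> * mass) \<le> A"
        unfolding A_def using \<eta> by (intro mult_left_mono) auto
      then show "ennreal (exp K * (exp 1 + 1 / \<eta> * mass)) \<le> ennreal A * 1"
        by (simp add: ennreal_leI)
      have "exp K * (1 / \<eta>) \<le> A"
        unfolding A_def using \<eta> mass_nonneg by (intro mult_left_mono) (auto intro: add_nonneg_nonneg)
      then show "ennreal (exp K * (1 / \<eta>)) \<le> ennreal A"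
        by (rule ennreal_leI)
    qed auto
    also have "\<dots> = ennreal A * (1 + \<Phi>)"
      by (simp add: distrib_left)
    finally show ?thesis unfolding \<Phi>_def
      by (auto simp: mult_left_mono)
  qed
  show ?thesis using that[OF A bound] .
qed

text \<open>After inserting the weak bound for \<open>exp u\<close> and exchanging the integrals,
  the inner one contains two kernels of total exponent \<open>a + \<epsilon>\<close>, and the outer
  one is the mass of \<open>F\<close>. The case \<open>a = \<alpha>\<close> serves \<open>V\<close>,
  the case \<open>a = 1\<close> serves \<open>u\<close>.\<close>

lemma exp_u_local_potential_bounded:
  assumes a: "0 \<le> a" "a < 4"
  obtains B where "0 \<le> B" "\<And>x. (\<integral>\<^sup>+y. ennreal (exp (u y) * local_kernel a (x - y)) \<partial>lborel) \<le> ennreal B"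
proof -
  \<comment> \<open>Half of the available gap, so that \<open>a + \<epsilon>\<close> stays below the
    dimension.\<close>
  define \<epsilon> where "\<epsilon> = (4 - a) / 2"
  have \<epsilon>: "0 < \<epsilon>" "a + \<epsilon> < 4" "\<epsilon> \<le> 2" using a by (auto simp: \<epsilon>_def field_simps)
  obtain A where A: "0 < A"
    "\<And>x. ennreal (exp (u x)) \<le> ennreal A * (1 + (\<integral>\<^sup>+y. ennreal (F y * local_kernel \<epsilon> (x - y)) \<partial>lborel))"
    using exp_u_le_weak_potential[OF \<epsilon>(1)] by blast
  define \<kappa> where "\<kappa> = 2 * pi\<^sup>2 / (4 - a)"
  define \<kappa>' where "\<kappa>' = 2 * pi\<^sup>2 / (4 - (a + \<epsilon>))"
  have \<kappa>: "0 \<le> \<kappa>" "0 \<le> \<kappa>'" using a \<epsilon> by (auto simp: \<kappa>_def \<kappa>'_def)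
  have "(\<integral>\<^sup>+y. ennreal (exp (u y) * local_kernel a (x - y)) \<partial>lborel) \<le> ennreal (A * (\<kappa> + 2 * \<kappa>' * mass))" for x
  proof -
    have "(\<integral>\<^sup>+y. ennreal (exp (u y) * local_kernel a (x - y)) \<partial>lborel)
       \<le> (\<integral>\<^sup>+y. ennreal A * (ennreal (local_kernel a (x - y))
            + (\<integral>\<^sup>+z. ennreal (F z * local_kernel \<epsilon> (y - z) * local_kernel a (x - y)) \<partial>lborel)) \<partial>lborel)"
    proof (rule nn_integral_mono)
      fix y
      have "ennreal (exp (u y) * local_kernel a (x - y)) = ennreal (exp (u y)) * ennreal (local_kernel a (x - y))"
        by (simp add: ennreal_mult)
      also have "\<dots> \<le> (ennreal A * (1 + (\<integral>\<^sup>+z. ennreal (F z * local_kernel \<epsilon> (y - z)) \<partial>lborel))) * ennreal (local_kernel a (x - y))"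
        by (intro mult_right_mono A) simp
      also have "\<dots> = ennreal A * (ennreal (local_kernel a (x - y))
           + (\<integral>\<^sup>+z. ennreal (F z * local_kernel \<epsilon> (y - z)) \<partial>lborel) * ennreal (local_kernel a (x - y)))"
        by (simp add: distrib_left distrib_right mult.assoc)
      also have "(\<integral>\<^sup>+z. ennreal (F z * local_kernel \<epsilon> (y - z)) \<partial>lborel) * ennreal (local_kernel a (x - y))
           = (\<integral>\<^sup>+z. ennreal (F z * local_kernel \<epsilon> (y - z)) * ennreal (local_kernel a (x - y)) \<partial>lborel)"
        by (subst nn_integral_multc) auto
      also have "\<dots> = (\<integral>\<^sup>+z. ennreal (F z * local_kernel \<epsilon> (y - z) * local_kernel a (x - y)) \<partial>lborel)"
        by (intro nn_integral_cong) (simp add: ennreal_mult F_nonneg)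
      finally show "ennreal (exp (u y) * local_kernel a (x - y)) \<le> ennreal A * (ennreal (local_kernel a (x - y))
           + (\<integral>\<^sup>+z. ennreal (F z * local_kernel \<epsilon> (y - z) * local_kernel a (x - y)) \<partial>lborel))" .
    qed
    also have "\<dots> = ennreal A * (ennreal \<kappa> + (\<integral>\<^sup>+y. \<integral>\<^sup>+z. ennreal (F z * local_kernel \<epsilon> (y - z) * local_kernel a (x - y)) \<partial>lborel \<partial>lborel))"
      using a nn_integral_local_kernel[of a x]
      by (subst nn_integral_cmult) (auto simp: nn_integral_add \<kappa>_def)
    also have "(\<integral>\<^sup>+y. \<integral>\<^sup>+z. ennreal (F z * local_kernel \<epsilon> (y - z) * local_kernel a (x - y)) \<partial>lborel \<partial>lborel)
      = (\<integral>\<^sup>+z. \<integral>\<^sup>+y. ennreal (F z * local_kernel \<epsilon> (y - z) * local_kernel a (x - y)) \<partial>lborel \<partial>lborel)"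
      by (rule lborel_pair.Fubini') measurable
    also have "\<dots> \<le> (\<integral>\<^sup>+z. ennreal (F z) * ennreal (2 * \<kappa>') \<partial>lborel)"
    proof (rule nn_integral_mono)
      fix z
      have "(\<integral>\<^sup>+y. ennreal (F z * local_kernel \<epsilon> (y - z) * local_kernel a (x - y)) \<partial>lborel)
        \<le> (\<integral>\<^sup>+y. ennreal (F z) * (ennreal (local_kernel (a + \<epsilon>) (z - y)) + ennreal (local_kernel (a + \<epsilon>) (x - y))) \<partial>lborel)"
      proof (rule nn_integral_mono)
        fix y
        have "F z * local_kernel \<epsilon> (y - z) * local_kernel a (x - y)
            \<le> F z * (local_kernel (a + \<epsilon>) (z - y) + local_kernel (a + \<epsilon>) (x - y))"
          using mult_left_mono[OF local_kernel_mult_le[of \<epsilon> a "y - z" "x - y"] F_nonneg[of z]] a \<epsilon>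
          by (simp add: local_kernel_commute[of _ y z] add.commute mult.assoc)
        then have "ennreal (F z * local_kernel \<epsilon> (y - z) * local_kernel a (x - y))
           \<le> ennreal (F z * (local_kernel (a + \<epsilon>) (z - y) + local_kernel (a + \<epsilon>) (x - y)))"
          by (rule ennreal_leI)
        then show "ennreal (F z * local_kernel \<epsilon> (y - z) * local_kernel a (x - y))
           \<le> ennreal (F z) * (ennreal (local_kernel (a + \<epsilon>) (z - y)) + ennreal (local_kernel (a + \<epsilon>) (x - y)))"
          using F_nonneg by (simp add: ennreal_mult)
      qed
      also have "\<dots> = ennreal (F z) * (ennreal \<kappa>' + ennreal \<kappa>')"
        using \<epsilon> by (subst nn_integral_cmult) (auto simp: nn_integral_add nn_integral_local_kernel \<kappa>'_def)
      also have "\<dots> = ennreal (F z) * ennreal (2 * \<kappa>')"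
        using \<kappa> by (simp add: ennreal_plus[symmetric] del: ennreal_plus)
      finally show "(\<integral>\<^sup>+y. ennreal (F z * local_kernel \<epsilon> (y - z) * local_kernel a (x - y)) \<partial>lborel)
        \<le> ennreal (F z) * ennreal (2 * \<kappa>')" .
    qed
    also have "\<dots> = ennreal (2 * \<kappa>' * mass)"
      using \<kappa> mass_nonneg by (subst nn_integral_multc) (auto simp: nn_integral_F ennreal_mult[symmetric] mult.commute)
    also have "ennreal A * (ennreal \<kappa> + ennreal (2 * \<kappa>' * mass)) = ennreal (A * (\<kappa> + 2 * \<kappa>' * mass))"
      using A \<kappa> mass_nonneg by (simp add: ennreal_mult)
    finally show ?thesis by (auto simp: mult_left_mono add_left_mono)
  qed
  moreover have "0 \<le> A * (\<kappa> + 2 * \<kappa>' * mass)" using A \<kappa> mass_nonneg by simp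
  ultimately show ?thesis using that by blast
qed

text \<open>Young's inequality with weights \<open>1 - \<alpha> / 8\<close> and
  \<open>\<alpha> / 8\<close>: a convex combination is at most the maximum, and the exponential of a
  maximum is at most the sum. The first term is integrable by hypothesis, the second one at infinity
  because 8 exceeds the dimension.\<close>

lemma riesz_integrand_Young:
  assumes "0 < s"
  shows "exp (u y) * s powr (-\<alpha>) \<le> exp (8 / (8 - \<alpha>) * u y) + s powr (-8)"
proof -
  define v where "v = -8 * ln s"
  define w where "w = 8 / (8 - \<alpha>) * u y"
  have "u y + \<alpha> / 8 * v = (1 - \<alpha> / 8) * w + \<alpha> / 8 * v"
    using \<alpha> by (simp add: w_def field_simps)
  also have "\<dots> \<le> (1 - \<alpha> / 8) * max w v + \<alpha> / 8 * max w v"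
    using \<alpha> by (intro add_mono mult_left_mono) auto
  finally have "u y + \<alpha> / 8 * v \<le> max w v" by (simp add: algebra_simps)
  then have "exp (u y + \<alpha> / 8 * v) \<le> exp (max w v)" by simp
  also have "\<dots> \<le> exp w + exp v" by (simp add: max_def)
  also have "exp v = s powr (-8)" using assms by (simp add: v_def powr_def)
  also have "exp (u y + \<alpha> / 8 * v) = exp (u y) * s powr (-\<alpha>)"
    using assms by (simp add: v_def powr_def exp_add[symmetric])
  finally show ?thesis by (simp add: w_def)
qed

text \<open>The unit ball around \<open>x\<close> is handled by the local potential of
  \<open>exp u\<close>, its complement by Young's inequality. The defining integral thus converges
  at every point, not only almost everywhere.\<close>

lemma V_bounded:
  obtains M where "0 \<le> M" "\<And>x. integrable lborel (\<lambda>y. exp (u y) * norm (x - y) powr (-\<alpha>))" "\<And>x. V x \<le> M"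
proof -
  obtain B where B: "0 \<le> B" "\<And>x. (\<integral>\<^sup>+y. ennreal (exp (u y) * local_kernel \<alpha> (x - y)) \<partial>lborel) \<le> ennreal B"
    using exp_u_local_potential_bounded[of \<alpha>] \<alpha> by auto
  define I where "I = (\<integral>x. exp (8 / (8 - \<alpha>) * u x) \<partial>lborel)"
  define M where "M = B + (I + pi\<^sup>2 / 2)"
  have I: "0 \<le> I" unfolding I_def by (intro Bochner_Integration.integral_nonneg) simp
  have le: "(\<integral>\<^sup>+y. ennreal (exp (u y) * norm (x - y) powr (-\<alpha>)) \<partial>lborel) \<le> ennreal M" for x
  proof -
    have "(\<integral>\<^sup>+y. ennreal (exp (u y) * norm (x - y) powr (-\<alpha>)) \<partial>lborel)
      \<le> (\<integral>\<^sup>+y. ennreal (exp (u y) * local_kernel \<alpha> (x - y))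
           + (ennreal (exp (8 / (8 - \<alpha>) * u y)) + ennreal (norm (x - y) powr (-8) * indicator (- ball x 1) y)) \<partial>lborel)"
    proof (rule nn_integral_mono)
      fix y
      have "exp (u y) * norm (x - y) powr (-\<alpha>) \<le> exp (u y) * local_kernel \<alpha> (x - y)
         + (exp (8 / (8 - \<alpha>) * u y) + norm (x - y) powr (-8) * indicator (- ball x 1) y)"
      proof (cases "y \<in> ball x 1")
        case False
        then have "0 < norm (x - y)" by (auto simp: dist_norm)
        from riesz_integrand_Young[OF this, of y] False show ?thesis
          by (simp add: local_kernel_diff_eq)
      qed (simp add: local_kernel_diff_eq)
      then have "ennreal (exp (u y) * norm (x - y) powr (-\<alpha>)) \<le> ennreal (exp (u y) * local_kernel \<alpha> (x - y)
         + (exp (8 / (8 - \<alpha>) * u y) + norm (x - y) powr (-8) * indicator (- ball x 1) y))"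
        by (rule ennreal_leI)
      then show "ennreal (exp (u y) * norm (x - y) powr (-\<alpha>)) \<le> ennreal (exp (u y) * local_kernel \<alpha> (x - y))
           + (ennreal (exp (8 / (8 - \<alpha>) * u y)) + ennreal (norm (x - y) powr (-8) * indicator (- ball x 1) y))"
        by simp
    qed
    also have "\<dots> = (\<integral>\<^sup>+y. ennreal (exp (u y) * local_kernel \<alpha> (x - y)) \<partial>lborel)
        + ((\<integral>\<^sup>+y. ennreal (exp (8 / (8 - \<alpha>) * u y)) \<partial>lborel)
          + (\<integral>\<^sup>+y. ennreal (norm (x - y) powr (-8) * indicator (- ball x 1) y) \<partial>lborel))"
      by (simp add: nn_integral_add)
    also have "(\<integral>\<^sup>+y. ennreal (exp (8 / (8 - \<alpha>) * u y)) \<partial>lborel) = ennreal I"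
      unfolding I_def using Ep_int by (intro nn_integral_eq_integral) auto
    also have "(\<integral>\<^sup>+y. ennreal (norm (x - y) powr (-8) * indicator (- ball x 1) y) \<partial>lborel) = ennreal (pi\<^sup>2 / 2)"
      using power_kernel_tail[of 8 1 x] by (subst nn_integral_eq_integral) (auto simp: has_bochner_integral_iff)
    also have "(\<integral>\<^sup>+y. ennreal (exp (u y) * local_kernel \<alpha> (x - y)) \<partial>lborel) + (ennreal I + ennreal (pi\<^sup>2 / 2))
        \<le> ennreal B + (ennreal I + ennreal (pi\<^sup>2 / 2))"
      by (intro add_right_mono B)
    also have "\<dots> = ennreal M" using B I by (simp add: M_def)
    finally show ?thesis .
  qed
  have int: "integrable lborel (\<lambda>y. exp (u y) * norm (x - y) powr (-\<alpha>))" for x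
    using le[of x] by (intro integrableI_nonneg) (auto intro: le_less_trans)
  have M: "0 \<le> M" using B I by (simp add: M_def)
  have "V x \<le> M" for x
  proof -
    have "ennreal (V x) \<le> ennreal M"
      unfolding riesz_def using le[of x] int[of x] by (subst nn_integral_eq_integral[symmetric]) auto
    then show ?thesis using M by simp
  qed
  then show ?thesis using that M int by blast
qed

lemma V_integrable: "integrable lborel (\<lambda>y. exp (u y) * norm (x - y) powr (-\<alpha>))"
  using V_bounded by metis

text \<open>A bound on \<open>V\<close> makes \<open>F\<close> at most a multiple of
  \<open>exp u\<close>, whose local potential of exponent 1 is already bounded and dominates the
  logarithmic one.\<close>

lemma u_bounded_above:
  obtains M where "\<And>x. u x \<le> M"
proof -
  obtain B where B: "0 \<le> B" "\<And>x. (\<integral>\<^sup>+y. ennreal (exp (u y) * local_kernel 1 (x - y)) \<partial>lborel) \<le> ennreal B"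
    using exp_u_local_potential_bounded[of 1] by auto
  obtain M where M: "0 \<le> M" "\<And>x. V x \<le> M" using V_bounded by metis
  define h where "h x y = - ln (norm (x - y)) * indicator (ball x 1) y" for x y :: "real^4"
  note h = neg_ln_local_nonneg[folded h_def] neg_ln_local_le[folded h_def]
    neg_ln_local_integrable[folded h_def] u_le_neg_ln_local[folded h_def]
  have "u x \<le> 1 / (8 * pi\<^sup>2) * (M * B) + c0" for x
  proof -
    have "ennreal (\<integral>y. F y * h x y \<partial>lborel) = (\<integral>\<^sup>+y. ennreal (F y * h x y) \<partial>lborel)"
      using h F_nonneg by (intro nn_integral_eq_integral[symmetric]) auto
    also have "\<dots> \<le> (\<integral>\<^sup>+y. ennreal M * ennreal (exp (u y) * local_kernel 1 (x - y)) \<partial>lborel)"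
    proof (rule nn_integral_mono)
      fix y
      have "F y * h x y \<le> (M * exp (u y)) * local_kernel 1 (x - y)"
        unfolding source_def using M h V_nonneg by (intro mult_mono) auto
      then have "ennreal (F y * h x y) \<le> ennreal (M * (exp (u y) * local_kernel 1 (x - y)))"
        by (intro ennreal_leI) (simp add: mult.assoc)
      then show "ennreal (F y * h x y) \<le> ennreal M * ennreal (exp (u y) * local_kernel 1 (x - y))"
        using M by (simp add: ennreal_mult)
    qed
    also have "\<dots> = ennreal M * (\<integral>\<^sup>+y. ennreal (exp (u y) * local_kernel 1 (x - y)) \<partial>lborel)"
      by (rule nn_integral_cmult) measurable
    also have "\<dots> \<le> ennreal M * ennreal B"
      by (intro mult_left_mono B) auto
    also have "\<dots> = ennreal (M * B)" using M B by (simp add: ennreal_mult)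
    finally have "(\<integral>y. F y * h x y \<partial>lborel) \<le> M * B" using M B by simp
    then have "1 / (8 * pi\<^sup>2) * (\<integral>y. F y * h x y \<partial>lborel) \<le> 1 / (8 * pi\<^sup>2) * (M * B)"
      by (intro mult_left_mono) auto
    then show ?thesis using h(4)[of x] by linarith
  qed
  then show ?thesis using that by blast
qed

lemma F_bounded:
  obtains M where "0 < M" "\<And>x. exp (u x) \<le> M" "\<And>x. V x \<le> M" "\<And>x. F x \<le> M"
proof -
  obtain M1 where M1: "\<And>x. u x \<le> M1" by (rule u_bounded_above) blast
  obtain M2 where M2: "0 \<le> M2" "\<And>x. V x \<le> M2" using V_bounded by metis
  define M where "M = exp M1 + M2 + M2 * exp M1"
  have pos: "0 \<le> M2 * exp M1" "0 < exp M1" using M2 by auto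
  have "F x \<le> M2 * exp M1" "exp (u x) \<le> exp M1" for x
    unfolding source_def using M1 M2 V_nonneg by (auto intro!: mult_mono)
  then have "exp (u x) \<le> M \<and> V x \<le> M \<and> F x \<le> M" for x
    unfolding M_def using pos M2(1) M2(2)[of x] by (smt (verit))
  moreover have "0 < M" unfolding M_def using pos M2(1) by linarith
  ultimately show ?thesis using that by blast
qed

end

subsection \<open>Asymptotic bounds\<close>

lemma abs_ln_diff_le:
  fixes p q :: real
  assumes "0 < p" "0 < q"
  shows "\<bar>ln p - ln q\<bar> \<le> \<bar>p - q\<bar> * (p powr (-1) + q powr (-1))"
proof -
  have *: "ln a - ln b \<le> \<bar>a - b\<bar> * (a powr (-1) + b powr (-1))" if "0 < a" "0 < b" for a b :: real
  proof -
    have "ln a - ln b = ln (a / b)" using that by (simp add: ln_div)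
    also have "\<dots> \<le> a / b - 1" using that by (intro ln_le_minus_one) auto
    also have "\<dots> = (a - b) * b powr (-1)" using that by (simp add: powr_minus field_simps)
    also have "\<dots> \<le> \<bar>a - b\<bar> * (a powr (-1) + b powr (-1))" using that by (intro mult_mono) auto
    finally show ?thesis .
  qed
  show ?thesis
    using *[OF assms] *[OF assms(2,1)] by (simp add: abs_le_iff abs_minus_commute add.commute)
qed

lemma ln_norm_diff_le: "ln (norm (x - y)) \<le> ln (1 + norm x) + ln (1 + norm y)"
  for x y :: "'a::real_normed_vector"
proof (cases "x = y")
  case False
  have "norm (x - y) \<le> norm x + norm y" by (rule norm_triangle_ineq4)
  also have "\<dots> \<le> (1 + norm x) * (1 + norm y)" by (simp add: algebra_simps)
  finally have le: "norm (x - y) \<le> (1 + norm x) * (1 + norm y)" .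
  have "0 < (1 + norm x) * (1 + norm y)" by (intro mult_pos_pos add_pos_nonneg) auto
  then have "ln (norm (x - y)) \<le> ln ((1 + norm x) * (1 + norm y))"
    using False le by (subst ln_le_cancel_iff) auto
  also have "\<dots> = ln (1 + norm x) + ln (1 + norm y)"
    by (rule ln_mult_pos) (auto intro: add_pos_nonneg)
  finally show ?thesis .
qed simp

lemma AE_lborel_neq: "AE y in lborel. y \<noteq> (a::'a::euclidean_space)"
  using AE_not_in[of "{a}" lborel] by (simp add: finite_imp_null_set_lborel)

text \<open>The exceptional point \<open>a\<close> is the diagonal of a power kernel, where
  \<open>powr\<close> yields 0.\<close>

lemma integral_lborel_pos:
  fixes f :: "'a::euclidean_space \<Rightarrow> real"
  assumes f: "integrable lborel f" and pos: "\<And>y. y \<noteq> a \<Longrightarrow> 0 < f y" and "0 \<le> f a"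
  shows "0 < (\<integral>y. f y \<partial>lborel)"
proof -
  have nonneg: "0 \<le> f y" for y using assms by (cases "y = a") (auto intro: less_imp_le)
  have "(\<integral>y. f y \<partial>lborel) \<noteq> 0"
  proof
    assume "(\<integral>y. f y \<partial>lborel) = 0"
    then have "AE y in lborel. f y = 0"
      using f nonneg by (subst (asm) integral_nonneg_eq_0_iff_AE) auto
    then have "AE y::'a in lborel. False"
      using AE_lborel_neq[of a] by eventually_elim (use pos in fastforce)
    then show False
      by (subst (asm) AE_iff_measurable[of UNIV]) auto
  qed
  moreover have "0 \<le> (\<integral>y. f y \<partial>lborel)"
    using nonneg by (intro Bochner_Integration.integral_nonneg) auto
  ultimately show ?thesis by linarith
qed

text \<open>The exponent 4 is critical: in polar coordinates the integrand is a multiple of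
  \<open>1 / s\<close>, whose integral up to \<open>exp (real n)\<close> is
  \<open>n\<close>.\<close>

lemma nn_integral_norm_powr_4_infinite:
  "(\<integral>\<^sup>+x. ennreal (norm (x::real^4) powr (-4) * indicator (- ball 0 1) x) \<partial>lborel) = \<infinity>"
proof -
  let ?J = "\<integral>\<^sup>+x. ennreal (norm (x::real^4) powr (-4) * indicator (- ball 0 1) x) \<partial>lborel"
  have J: "?J = (\<integral>\<^sup>+s. ennreal (2 * pi\<^sup>2 * s ^ 3) * indicator {0..} s * ennreal (s powr (-4) * indicator {1..} s) \<partial>lborel)"
  proof -
    have "?J = (\<integral>\<^sup>+y. (\<lambda>s. ennreal (s powr (-4) * indicator {1..} s)) (norm (y::real^4)) \<partial>lborel)"
      by (intro nn_integral_cong) (auto simp: indicator_def)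
    also have "\<dots> = (\<integral>\<^sup>+s. ennreal (2 * pi\<^sup>2 * s ^ 3) * indicator {0..} s * ennreal (s powr (-4) * indicator {1..} s) \<partial>lborel)"
      by (rule nn_integral_radial) measurable
    finally show ?thesis .
  qed
  have "ennreal (real n) \<le> ?J" for n
  proof -
    have "ennreal (real n) = ennreal (ln (exp (real n)) - ln 1)" by simp
    also have "\<dots> = (\<integral>\<^sup>+s. ennreal (1 / s) * indicator {1..exp (real n)} s \<partial>lborel)"
      by (intro nn_integral_FTC_Icc[symmetric] DERIV_ln_divide) auto
    also have "\<dots> \<le> ?J"
      unfolding J
    proof (rule nn_integral_mono)
      fix s :: real
      show "ennreal (1 / s) * indicator {1..exp (real n)} s
        \<le> ennreal (2 * pi\<^sup>2 * s ^ 3) * indicator {0..} s * ennreal (s powr (-4) * indicator {1..} s)"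
      proof (cases "s \<in> {1..exp (real n)}")
        case True
        have "1 \<le> 2 * pi\<^sup>2" using pi_gt3 one_le_power[of pi 2] by linarith
        then have "1 * (1 / s) \<le> 2 * pi\<^sup>2 * (1 / s)"
          using True by (intro mult_right_mono) auto
        also have "\<dots> = 2 * pi\<^sup>2 * s ^ 3 * s powr (-4)"
          using True by (simp add: powr_minus field_simps power3_eq_cube power4_eq_xxxx)
        finally have "ennreal (1 / s) \<le> ennreal (2 * pi\<^sup>2 * s ^ 3 * s powr (-4))"
          by (intro ennreal_leI) simp
        then show ?thesis using True by (simp add: ennreal_mult)
      qed simp
    qed
    finally show ?thesis .
  qed
  then have "of_nat n \<le> ?J" for n by (simp only: ennreal_of_nat_eq_real_of_nat)
  moreover have "J = \<infinity>" if "\<And>n. of_nat n \<le> J" for J :: ennreal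
    using that ennreal_Ex_less_of_nat[of J] by (metis infinity_ennreal_def leD top.not_eq_extremum)
  ultimately show ?thesis by blast
qed

context choquard_solution
begin

text \<open>The coefficient of \<open>- ln (norm x)\<close> in \<open>u\<close> far from the origin,
  where the potential sees \<open>F\<close> as a point mass.\<close>

definition slope :: real where "slope = mass / (8 * pi\<^sup>2)"

text \<open>Up to the constant \<open>8 * pi\<^sup>2\<close>, a majorant of the formal gradient of
  \<open>u\<close>, since \<open>ln (norm (x - y))\<close> has a gradient of length
  \<open>norm (x - y) powr (-1)\<close>.\<close>

definition inverse_potential :: "real^4 \<Rightarrow> real" where
  "inverse_potential x = (\<integral>y. F y * norm (x - y) powr (-1) \<partial>lborel)"

lemma inverse_potential_integrable: "integrable lborel (\<lambda>y. F y * norm (x - y) powr (-1))"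
proof -
  obtain M where M: "\<And>x. F x \<le> M" by (rule F_bounded) blast
  show ?thesis
    by (rule riesz_potential_bound(1)[OF F_int F_nonneg, of x 1 M]) (use M in auto)
qed

lemma inverse_potential_nonneg: "0 \<le> inverse_potential x"
  unfolding inverse_potential_def using F_nonneg
  by (intro Bochner_Integration.integral_nonneg) auto

lemma inverse_potential_bounded:
  obtains B where "\<And>x. inverse_potential x \<le> B"
proof -
  obtain M where M: "\<And>x. F x \<le> M" by (rule F_bounded) blast
  have "inverse_potential x \<le> M * (2 * pi\<^sup>2 / (4 - 1) * 1 powr (4 - 1)) + 1 powr (-1) * (\<integral>y. F y \<partial>lborel)" for x
    unfolding inverse_potential_def
    by (rule riesz_potential_bound(2)[OF F_int F_nonneg]) (use M in auto)
  then show ?thesis using that by blast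
qed

text \<open>Replaces a gradient bound along the segment: a difference of logarithms is controlled by
  the reciprocals at its two ends, hence only the potentials at \<open>x\<close> and
  \<open>x'\<close> appear.\<close>

lemma u_diff_le:
  "\<bar>u x - u x'\<bar> \<le> 1 / (8 * pi\<^sup>2) * norm (x - x') * (inverse_potential x + inverse_potential x')"
proof -
  let ?g = "\<lambda>y. ln (norm (x' - y)) * F y - ln (norm (x - y)) * F y"
  have "u x - u x' = 1 / (8 * pi\<^sup>2) * (\<integral>y. ?g y \<partial>lborel)"
    using lnF_int[of x] lnF_int[of x'] by (simp add: u_eq[of x] u_eq[of x'] right_diff_distrib)
  moreover have "\<bar>\<integral>y. ?g y \<partial>lborel\<bar> \<le> (\<integral>y. norm (x - x') * (F y * norm (x - y) powr (-1) + F y * norm (x' - y) powr (-1)) \<partial>lborel)"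
  proof (rule order_trans[OF integral_abs_bound integral_mono_AE])
    show "AE y in lborel. \<bar>?g y\<bar> \<le> norm (x - x') * (F y * norm (x - y) powr (-1) + F y * norm (x' - y) powr (-1))"
      using AE_lborel_neq[of x] AE_lborel_neq[of x']
    proof eventually_elim
      case (elim y)
      have "\<bar>ln (norm (x' - y)) - ln (norm (x - y))\<bar>
          \<le> \<bar>norm (x' - y) - norm (x - y)\<bar> * (norm (x' - y) powr (-1) + norm (x - y) powr (-1))"
        using elim by (intro abs_ln_diff_le) auto
      also have "\<dots> \<le> norm (x - x') * (norm (x' - y) powr (-1) + norm (x - y) powr (-1))"
        using norm_triangle_ineq3[of "x' - y" "x - y"] by (intro mult_right_mono) (auto simp: norm_minus_commute)
      finally have "\<bar>ln (norm (x' - y)) - ln (norm (x - y))\<bar> * F y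
          \<le> norm (x - x') * (norm (x' - y) powr (-1) + norm (x - y) powr (-1)) * F y"
        using F_nonneg by (intro mult_right_mono)
      moreover have "\<bar>?g y\<bar> = \<bar>ln (norm (x' - y)) - ln (norm (x - y))\<bar> * F y"
        using F_nonneg[of y] by (simp add: abs_mult left_diff_distrib[symmetric])
      ultimately show ?case by (simp add: algebra_simps)
    qed
  qed (use lnF_int[of x] lnF_int[of x'] inverse_potential_integrable[of x] inverse_potential_integrable[of x'] in auto)
  moreover have "(\<integral>y. norm (x - x') * (F y * norm (x - y) powr (-1) + F y * norm (x' - y) powr (-1)) \<partial>lborel)
     = norm (x - x') * (inverse_potential x + inverse_potential x')"
    unfolding inverse_potential_def using inverse_potential_integrable[of x] inverse_potential_integrable[of x'] by simp
  ultimately have "\<bar>u x - u x'\<bar> = 1 / (8 * pi\<^sup>2) * \<bar>\<integral>y. ?g y \<partial>lborel\<bar>"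
    and le: "\<bar>\<integral>y. ?g y \<partial>lborel\<bar> \<le> norm (x - x') * (inverse_potential x + inverse_potential x')"
    by (simp_all only: abs_mult) simp
  from this(1) show ?thesis
    using mult_left_mono[OF le, of "1 / (8 * pi\<^sup>2)"] by (simp add: mult.assoc)
qed

lemma u_continuous: "continuous_on UNIV u"
proof -
  obtain B where B: "\<And>x. inverse_potential x \<le> B" by (rule inverse_potential_bounded) blast
  have "dist (u x) (u x') \<le> 1 / (8 * pi\<^sup>2) * (B + B) * dist x x'" for x x'
  proof -
    have "1 / (8 * pi\<^sup>2) * norm (x - x') * (inverse_potential x + inverse_potential x')
        \<le> 1 / (8 * pi\<^sup>2) * norm (x - x') * (B + B)"
      using B by (intro mult_left_mono add_mono) auto
    then show ?thesis using u_diff_le[of x x'] by (simp add: dist_norm mult_ac)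
  qed
  moreover have "0 \<le> 1 / (8 * pi\<^sup>2) * (B + B)"
    using B[of 0] inverse_potential_nonneg[of 0] by simp
  ultimately have "(1 / (8 * pi\<^sup>2) * (B + B))-lipschitz_on UNIV u"
    by (intro lipschitz_onI) auto
  then show ?thesis by (rule lipschitz_on_continuous_on)
qed

lemma ln_growth_integrable: "integrable lborel (\<lambda>y. ln (1 + norm y) * F y)"
proof (rule Bochner_Integration.integrable_bound)
  show "integrable lborel (\<lambda>y. ln 2 * F y + norm (ln (norm (0 - y)) * F y))"
    using F_int lnF_int[of 0] by (intro Bochner_Integration.integrable_add integrable_norm) auto
  have "ln (1 + norm y) \<le> ln 2 + \<bar>ln (norm y)\<bar>" for y :: "real^4"
  proof (cases "norm y \<le> 1")
    case True
    then have "ln (1 + norm y) \<le> ln 2" by (subst ln_le_cancel_iff) (auto intro: add_pos_nonneg)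
    then show ?thesis by simp
  next
    case False
    then have "ln (1 + norm y) \<le> ln (2 * norm y)" by (subst ln_le_cancel_iff) (auto intro: add_pos_nonneg)
    also have "\<dots> = ln 2 + ln (norm y)" using False by (subst ln_mult_pos) auto
    finally show ?thesis by linarith
  qed
  then have "ln (1 + norm y) * F y \<le> (ln 2 + \<bar>ln (norm y)\<bar>) * F y" for y
    using F_nonneg by (intro mult_right_mono)
  then show "AE y in lborel. norm (ln (1 + norm y) * F y) \<le> norm (ln 2 * F y + norm (ln (norm (0 - y)) * F y))"
    using F_nonneg by (auto simp: abs_mult algebra_simps ln_ge_zero_iff add_pos_nonneg intro!: AE_I2)
qed measurable

lemma u_lower_bound:
  obtains K where "\<And>x. - slope * ln (1 + norm x) - K \<le> u x"
proof -
  define L where "L = (\<integral>y. ln (1 + norm y) * F y \<partial>lborel)"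
  have "- slope * ln (1 + norm x) - (1 / (8 * pi\<^sup>2) * L - c0) \<le> u x" for x
  proof -
    have "(\<integral>y. ln (norm (x - y)) * F y \<partial>lborel) \<le> (\<integral>y. ln (1 + norm x) * F y + ln (1 + norm y) * F y \<partial>lborel)"
      using mult_right_mono[OF ln_norm_diff_le F_nonneg] lnF_int[of x] F_int ln_growth_integrable
      by (intro integral_mono) (auto simp: distrib_right)
    also have "\<dots> = ln (1 + norm x) * mass + L"
      using F_int ln_growth_integrable by (simp add: L_def mass_def)
    finally have "1 / (8 * pi\<^sup>2) * (\<integral>y. ln (norm (x - y)) * F y \<partial>lborel) \<le> 1 / (8 * pi\<^sup>2) * (ln (1 + norm x) * mass + L)"
      by (intro mult_left_mono) auto
    moreover have "1 / (8 * pi\<^sup>2) * (ln (1 + norm x) * mass + L) = slope * ln (1 + norm x) + 1 / (8 * pi\<^sup>2) * L"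
      by (simp add: slope_def field_simps)
    ultimately show ?thesis using u_eq[of x] by linarith
  qed
  then show ?thesis using that by blast
qed

lemma V_pos: "0 < V x"
  unfolding riesz_def by (rule integral_lborel_pos[where a=x, OF V_integrable]) auto

lemma F_pos: "0 < F x"
  unfolding source_def using V_pos by simp

lemma mass_pos: "0 < mass"
  unfolding mass_def by (rule integral_lborel_pos[OF F_int]) (use F_pos less_imp_le in auto)

lemma slope_pos: "0 < slope"
  unfolding slope_def using mass_pos by simp

text \<open>With a smaller slope the lower bound on \<open>u\<close> would make
  \<open>exp (8 / (8 - \<alpha>) * u x)\<close> at least a multiple of
  \<open>norm x powr (-4)\<close> at infinity, which is not integrable.\<close>

lemma slope_gt: "(8 - \<alpha>) / 2 < slope"
proof (rule ccontr)
  assume "\<not> ?thesis"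
  then have s: "8 * slope / (8 - \<alpha>) \<le> 4" using \<alpha> by (simp add: field_simps)
  obtain K where K: "\<And>x. - slope * ln (1 + norm x) - K \<le> u x" by (rule u_lower_bound) blast
  define k where "k = exp (- (8 / (8 - \<alpha>) * K)) * 2 powr (-4)"
  have k: "0 < k" by (simp add: k_def)
  have ptw: "k * (norm x powr (-4) * indicator (- ball 0 1) x) \<le> exp (8 / (8 - \<alpha>) * u x)" for x
  proof (cases "x \<in> ball 0 1")
    case False
    then have x: "1 \<le> norm x" by simp
    have "(2 * norm x) powr (-4) \<le> (1 + norm x) powr (-4)"
      using x by (intro powr_mono2') auto
    also have "\<dots> \<le> (1 + norm x) powr (- (8 * slope / (8 - \<alpha>)))"
      using x s by (intro powr_mono) auto
    finally have "exp (- (8 / (8 - \<alpha>) * K)) * (2 * norm x) powr (-4)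
        \<le> exp (- (8 / (8 - \<alpha>) * K)) * (1 + norm x) powr (- (8 * slope / (8 - \<alpha>)))"
      by (intro mult_left_mono) auto
    also have "\<dots> = exp (8 / (8 - \<alpha>) * (- slope * ln (1 + norm x) - K))"
    proof -
      have "1 + norm x \<noteq> 0" using x by linarith
      then show ?thesis by (simp add: powr_def exp_add[symmetric] right_diff_distrib)
    qed
    also have "\<dots> \<le> exp (8 / (8 - \<alpha>) * u x)"
      using K[of x] \<alpha> by (simp add: mult_left_mono divide_right_mono)
    finally show ?thesis using False x by (simp add: k_def powr_mult mult.assoc)
  qed simp
  have "ennreal k * (\<integral>\<^sup>+x. ennreal (norm (x::real^4) powr (-4) * indicator (- ball 0 1) x) \<partial>lborel)
     = (\<integral>\<^sup>+x. ennreal (k * (norm (x::real^4) powr (-4) * indicator (- ball 0 1) x)) \<partial>lborel)"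
    using k by (subst nn_integral_cmult[symmetric]) (auto simp: ennreal_mult intro!: nn_integral_cong)
  also have "\<dots> \<le> (\<integral>\<^sup>+x. ennreal (exp (8 / (8 - \<alpha>) * u x)) \<partial>lborel)"
    by (intro nn_integral_mono ennreal_leI ptw)
  also have "\<dots> < \<infinity>"
    using Ep_int by (simp add: integrable_iff_bounded)
  finally show False
    using k unfolding nn_integral_norm_powr_4_infinite by (simp add: ennreal_mult_top)
qed

lemma mass_tail_small:
  assumes "0 < \<eta>"
  obtains R where "1 \<le> R" "(\<integral>y. F y * indicator (- ball 0 R) y \<partial>lborel) \<le> \<eta>"
proof -
  have "(\<lambda>n. \<integral>y. F y * indicator (- ball 0 (real n)) y \<partial>lborel) \<longlonglongrightarrow> (\<integral>x. 0 \<partial>(lborel :: (real^4) measure))"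
  proof (rule integral_dominated_convergence[where w = F])
    show "AE y in lborel. (\<lambda>n. F y * indicator (- ball 0 (real n)) y) \<longlonglongrightarrow> 0"
    proof (intro AE_I2)
      fix y :: "real^4"
      obtain N where "norm y < real N" using reals_Archimedean2 by blast
      then have "eventually (\<lambda>n. F y * indicator (- ball 0 (real n)) y = 0) sequentially"
        by (intro eventually_sequentiallyI[of N]) (auto simp: indicator_def)
      then show "(\<lambda>n. F y * indicator (- ball 0 (real n)) y) \<longlonglongrightarrow> 0"
        by (rule tendsto_eventually)
    qed
    show "AE y in lborel. norm (F y * indicator (- ball 0 (real n)) y) \<le> F y" for n
      using F_nonneg by (auto intro!: AE_I2 simp: indicator_def)
  qed (use F_int in auto)
  then have "eventually (\<lambda>n. (\<integral>y. F y * indicator (- ball 0 (real n)) y \<partial>lborel) < \<eta>) sequentially"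
    using assms by (intro order_tendstoD) simp_all
  from eventually_conj[OF this eventually_ge_at_top[of 1]]
  obtain n where "(\<integral>y. F y * indicator (- ball 0 (real n)) y \<partial>lborel) < \<eta>" "1 \<le> n"
    by (auto simp: eventually_sequentially)
  then show ?thesis by (intro that[of "real n"]) auto
qed

text \<open>All but a small amount of the mass lies in a fixed ball and acts like a point mass at
  the origin. The remaining mass costs at most \<open>\<delta> * ln (norm x)\<close>, and the
  logarithmic singularity at \<open>x\<close> is absorbed by the bounded
  \<open>inverse_potential\<close>.\<close>

lemma u_upper_decay:
  assumes \<delta>: "0 < \<delta>"
  obtains K where "\<And>x. 1 \<le> norm x \<Longrightarrow> u x \<le> - (slope - \<delta>) * ln (norm x) + K"
proof -
  define c where "c = 1 / (8 * pi\<^sup>2)"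
  have c: "0 < c" by (simp add: c_def)
  obtain R where R: "1 \<le> R" "(\<integral>y. F y * indicator (- ball 0 R) y \<partial>lborel) \<le> \<delta> / c"
    using mass_tail_small[of "\<delta> / c"] \<delta> c by auto
  obtain B where B: "\<And>x. inverse_potential x \<le> B" by (rule inverse_potential_bounded) blast
  obtain M where M: "\<And>x. u x \<le> M" by (rule u_bounded_above) blast
  \<comment> \<open>The second summand covers the bounded region up to \<open>2 * R\<close>, where
    only the upper bound of \<open>u\<close> is available.\<close>
  define K where "K = \<bar>c * (ln 2 * mass + B) + c0\<bar> + (\<bar>M\<bar> + \<bar>slope - \<delta>\<bar> * ln (2 * R))"
  have tail_int: "integrable lborel (\<lambda>y. F y * indicator (- ball 0 R) y)"
    by (rule Bochner_Integration.integrable_bound[OF F_int]) (auto simp: indicator_def)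
  have far: "u x \<le> - (slope - \<delta>) * ln (norm x) + (c * (ln 2 * mass + B) + c0)" if x: "2 * R \<le> norm x" for x
  proof -
    have nx: "1 \<le> norm x" using x R by linarith
    have "(\<integral>y. ln (norm x) * F y - ln (norm (x - y)) * F y \<partial>lborel)
      \<le> (\<integral>y. ln 2 * F y + ln (norm x) * (F y * indicator (- ball 0 R) y) + F y * norm (x - y) powr (-1) \<partial>lborel)"
    proof (rule integral_mono_AE)
      show "AE y in lborel. ln (norm x) * F y - ln (norm (x - y)) * F y
          \<le> ln 2 * F y + ln (norm x) * (F y * indicator (- ball 0 R) y) + F y * norm (x - y) powr (-1)"
        using AE_lborel_neq[of x]
      proof eventually_elim
        case (elim y)
        \<comment> \<open>If \<open>y\<close> is closer to \<open>x\<close> than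
          \<open>norm x / 2\<close>, it lies outside the ball of radius \<open>R\<close>; the whole
          \<open>ln (norm x)\<close> may then be charged to the tail of the mass.\<close>
        have "ln (norm x) - ln (norm (x - y)) \<le> ln 2 + ln (norm x) * indicator (- ball 0 R) y + norm (x - y) powr (-1)"
        proof (cases "norm x / 2 \<le> norm (x - y)")
          case True
          then have "ln (norm x / 2) \<le> ln (norm (x - y))"
            using nx elim by (subst ln_le_cancel_iff) auto
          then have "ln (norm x) - ln (norm (x - y)) \<le> ln 2" using nx by (subst (asm) ln_divide_pos) auto
          moreover have "0 \<le> ln (norm x) * indicator (- ball 0 R) y" using nx by simp
          ultimately show ?thesis by (simp add: add_increasing2)
        next
          case False
          have "norm x \<le> norm y + norm (x - y)" using norm_triangle_ineq[of y "x - y"] by simp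
          then have "R < norm y" using x False by linarith
          then have ind: "indicator (- ball 0 R) y = (1::real)" by simp
          have "- ln (norm (x - y)) \<le> norm (x - y) powr (-1)" by (rule neg_ln_le_inverse) simp
          moreover have "0 \<le> ln (2::real)" by simp
          ultimately show ?thesis unfolding ind by linarith
        qed
        from mult_right_mono[OF this F_nonneg[of y]] show ?case
          by (simp add: algebra_simps)
      qed
    qed (use F_int lnF_int[of x] tail_int inverse_potential_integrable[of x] in auto)
    also have "\<dots> = ln 2 * mass + ln (norm x) * (\<integral>y. F y * indicator (- ball 0 R) y \<partial>lborel) + inverse_potential x"
      using F_int tail_int inverse_potential_integrable[of x] by (simp add: mass_def inverse_potential_def)
    also have "\<dots> \<le> ln 2 * mass + ln (norm x) * (\<delta> / c) + B"
      using nx R B by (intro add_mono mult_left_mono) auto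
    finally have "c * (ln (norm x) * mass - (\<integral>y. ln (norm (x - y)) * F y \<partial>lborel)) \<le> c * (ln 2 * mass + ln (norm x) * (\<delta> / c) + B)"
      using c F_int lnF_int[of x] by (intro mult_left_mono) (auto simp: mass_def)
    moreover have "u x = - c * (\<integral>y. ln (norm (x - y)) * F y \<partial>lborel) + c0"
      using u_eq[of x] by (simp add: c_def)
    moreover have "c * mass = slope" by (simp add: c_def slope_def)
    then have "c * (ln (norm x) * mass) = slope * ln (norm x)" by (metis mult.assoc mult.commute)
    moreover have "c * (ln (norm x) * (\<delta> / c)) = \<delta> * ln (norm x)" using c by simp
    ultimately show ?thesis
      by (simp only: distrib_left right_diff_distrib left_diff_distrib minus_diff_eq)
  qed
  have "u x \<le> - (slope - \<delta>) * ln (norm x) + K" if x: "1 \<le> norm x" for x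
  proof (cases "2 * R \<le> norm x")
    case True
    have "0 \<le> \<bar>M\<bar> + \<bar>slope - \<delta>\<bar> * ln (2 * R)" using R by simp
    then show ?thesis using far[OF True] by (simp add: K_def)
  next
    case False
    have "ln (norm x) \<le> ln (2 * R)"
      using False x R(1) by (subst ln_le_cancel_iff; linarith)
    then have "\<bar>slope - \<delta>\<bar> * ln (norm x) \<le> \<bar>slope - \<delta>\<bar> * ln (2 * R)"
      by (intro mult_left_mono) auto
    moreover have "(slope - \<delta>) * ln (norm x) \<le> \<bar>slope - \<delta>\<bar> * ln (norm x)"
      using x by (intro mult_right_mono) auto
    moreover have "- (slope - \<delta>) * ln (norm x) = - ((slope - \<delta>) * ln (norm x))" by (rule mult_minus_left)
    moreover have "M \<le> \<bar>M\<bar>" "0 \<le> \<bar>c * (ln 2 * mass + B) + c0\<bar>" by auto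
    ultimately show ?thesis using M[of x] unfolding K_def by linarith
  qed
  then show ?thesis using that by blast
qed

lemma exp_u_decay:
  assumes "\<gamma> < slope"
  obtains K where "0 < K" "\<And>x. 1 \<le> norm x \<Longrightarrow> exp (u x) \<le> K * norm x powr (-\<gamma>)"
proof -
  obtain K where K: "\<And>x. 1 \<le> norm x \<Longrightarrow> u x \<le> - (slope - (slope - \<gamma>)) * ln (norm x) + K"
    using u_upper_decay[of "slope - \<gamma>"] assms by auto
  have "exp (u x) \<le> exp K * norm x powr (-\<gamma>)" if "1 \<le> norm x" for x
  proof -
    have "x \<noteq> 0" using that by auto
    have "exp (u x) \<le> exp (- \<gamma> * ln (norm x) + K)" using K[OF that] by simp
    also have "\<dots> = exp K * norm x powr (-\<gamma>)"
      using \<open>x \<noteq> 0\<close> by (simp add: powr_def exp_add[symmetric])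
    finally show ?thesis .
  qed
  then show ?thesis using that[of "exp K"] by simp
qed

end

subsection \<open>The Pohozaev identity\<close>

lemma powr_minus_divide_scale:
  fixes n s a :: real
  assumes "0 \<le> n" "0 < s"
  shows "(n / s) powr (-a) = s powr a * n powr (-a)"
  using assms by (simp add: powr_divide powr_minus field_simps)

lemma ln_one_plus_mult_le:
  fixes t n :: real
  assumes "0 < t" "0 \<le> n"
  shows "ln (1 + t * n) \<le> ln (1 + t) + ln (1 + n)"
proof -
  have "1 + t * n \<le> (1 + t) * (1 + n)" using assms by (simp add: algebra_simps)
  moreover have "0 < 1 + t * n" using assms by (simp add: add_pos_nonneg)
  ultimately have "ln (1 + t * n) \<le> ln ((1 + t) * (1 + n))" by simp
  also have "\<dots> = ln (1 + t) + ln (1 + n)"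
    using assms by (intro ln_mult_pos) auto
  finally show ?thesis .
qed

context choquard_solution
begin

text \<open>The integral is split at half the distance to the origin. Nearby, the rate
  \<open>\<kappa>\<close> of \<open>exp u\<close> and the kernel mass of order
  \<open>r powr (4 - \<alpha>)\<close> combine to \<open>r powr (-\<alpha> / 2)\<close>; a rescaled
  Young inequality gives the far part the same rate.\<close>

lemma V_decay:
  obtains K where "0 < K" "\<And>x. 2 \<le> norm x \<Longrightarrow> V x \<le> K * norm x powr (-\<alpha> / 2)"
proof -
  define \<kappa> where "\<kappa> = (8 - \<alpha>) / 2"
  obtain K where K: "0 < K" "\<And>x. 1 \<le> norm x \<Longrightarrow> exp (u x) \<le> K * norm x powr (-\<kappa>)"
    using exp_u_decay[OF slope_gt] unfolding \<kappa>_def by metis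
  define I where "I = (\<integral>x. exp (8 / (8 - \<alpha>) * u x) \<partial>lborel)"
  define C where "C = K * 2 powr \<kappa> * (2 * pi\<^sup>2 / (4 - \<alpha>)) * 2 powr (\<alpha> - 4) + (I + 8 * pi\<^sup>2)"
  have I: "0 \<le> I" unfolding I_def by (intro Bochner_Integration.integral_nonneg) simp
  have "V x \<le> C * norm x powr (-\<alpha> / 2)" if x: "2 \<le> norm x" for x
  proof -
    define r where "r = norm x / 2"
    have r: "1 \<le> r" "norm x = 2 * r" using x by (auto simp: r_def)
    define m where "m = norm x powr (-\<alpha> / 2)"
    have near: "has_bochner_integral lborel (\<lambda>y. norm (x - y) powr (-\<alpha>) * indicator (ball x r) y) (2 * pi\<^sup>2 / (4 - \<alpha>) * r powr (4 - \<alpha>))"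
      using \<alpha> r by (intro power_kernel_ball) auto
    have far: "has_bochner_integral lborel (\<lambda>y. norm (x - y) powr (-8) * indicator (- ball x r) y) (2 * pi\<^sup>2 / (8 - 4) * r powr (4 - 8))"
      using r by (intro power_kernel_tail) auto
    have Ep: "has_bochner_integral lborel (\<lambda>y. exp (8 / (8 - \<alpha>) * u y)) I"
      unfolding I_def by (rule has_bochner_integral_integrable[OF Ep_int])
    let ?g = "\<lambda>y. K * r powr (-\<kappa>) * (norm (x - y) powr (-\<alpha>) * indicator (ball x r) y)
      + m * (exp (8 / (8 - \<alpha>) * u y) + norm x ^ 4 * (norm (x - y) powr (-8) * indicator (- ball x r) y))"
    have g: "has_bochner_integral lborel ?g (K * r powr (-\<kappa>) * (2 * pi\<^sup>2 / (4 - \<alpha>) * r powr (4 - \<alpha>))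
      + m * (I + norm x ^ 4 * (2 * pi\<^sup>2 / (8 - 4) * r powr (4 - 8))))"
      using near far Ep by (intro has_bochner_integral_add has_bochner_integral_mult_right) auto
    have ptw: "exp (u y) * norm (x - y) powr (-\<alpha>) \<le> ?g y" for y
    proof (cases "y \<in> ball x r")
      case True
      have "norm x \<le> norm y + norm (x - y)" using norm_triangle_ineq[of y "x - y"] by simp
      then have y: "r \<le> norm y" using True r by (simp add: dist_norm)
      then have "exp (u y) \<le> K * norm y powr (-\<kappa>)" using r by (intro K) auto
      also have "\<dots> \<le> K * r powr (-\<kappa>)"
        using K(1) y r \<alpha> by (intro mult_left_mono powr_mono2') (auto simp: \<kappa>_def)
      finally have "exp (u y) * norm (x - y) powr (-\<alpha>) \<le> K * r powr (-\<kappa>) * norm (x - y) powr (-\<alpha>)"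
        by (intro mult_right_mono) auto
      then show ?thesis using True by (simp add: m_def add_increasing2)
    next
      case False
      then have s: "0 < norm (x - y)" using r by (auto simp: dist_norm)
      have nx: "0 < norm x" using r by simp
      \<comment> \<open>Measuring lengths in units of \<open>sqrt (norm x)\<close> produces the
        factor \<open>norm x powr (\<alpha> / 2)\<close> on the left, while the second term acquires
        \<open>norm x ^ 4\<close>, just compensated by the tail integral of order
        \<open>r powr (-4)\<close>.\<close>
      have "exp (u y) * (norm (x - y) / sqrt (norm x)) powr (-\<alpha>)
          \<le> exp (8 / (8 - \<alpha>) * u y) + (norm (x - y) / sqrt (norm x)) powr (-8)"
        using s nx by (intro riesz_integrand_Young) auto
      moreover have "(norm (x - y) / sqrt (norm x)) powr (-\<alpha>) = norm (x - y) powr (-\<alpha>) * norm x powr (\<alpha> / 2)"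
        using s nx by (simp add: powr_divide powr_minus powr_half_sqrt[symmetric] powr_powr field_simps)
      moreover have "(norm (x - y) / sqrt (norm x)) powr (-8) = norm (x - y) powr (-8) * norm x ^ 4"
        using s nx by (simp add: powr_divide powr_minus powr_half_sqrt[symmetric] powr_powr field_simps)
      ultimately have "m * (exp (u y) * (norm (x - y) powr (-\<alpha>) * norm x powr (\<alpha> / 2)))
          \<le> m * (exp (8 / (8 - \<alpha>) * u y) + norm (x - y) powr (-8) * norm x ^ 4)"
        by (intro mult_left_mono) (auto simp: m_def)
      moreover have "m * norm x powr (\<alpha> / 2) = 1"
        using nx by (simp add: m_def powr_add[symmetric])
      then have "m * (exp (u y) * (norm (x - y) powr (-\<alpha>) * norm x powr (\<alpha> / 2))) = exp (u y) * norm (x - y) powr (-\<alpha>)"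
        by (simp add: algebra_simps)
      ultimately show ?thesis using False by (simp add: mult.commute)
    qed
    have "V x \<le> (\<integral>y. ?g y \<partial>lborel)"
      unfolding riesz_def by (rule integral_mono[OF V_integrable integrable.intros[OF g] ptw])
    also have "\<dots> = K * r powr (-\<kappa>) * (2 * pi\<^sup>2 / (4 - \<alpha>) * r powr (4 - \<alpha>))
      + m * (I + norm x ^ 4 * (2 * pi\<^sup>2 / (8 - 4) * r powr (4 - 8)))"
      by (rule has_bochner_integral_integral_eq[OF g])
    also have "norm x ^ 4 * (2 * pi\<^sup>2 / (8 - 4) * r powr (4 - 8)) = 8 * pi\<^sup>2"
      using r by (simp add: powr_minus field_simps)
    also have "K * r powr (-\<kappa>) * (2 * pi\<^sup>2 / (4 - \<alpha>) * r powr (4 - \<alpha>))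
        = m * (K * 2 powr \<kappa> * (2 * pi\<^sup>2 / (4 - \<alpha>)) * 2 powr (\<alpha> - 4))"
    proof -
      have "r powr (-\<kappa>) * r powr (4 - \<alpha>) = r powr (-\<alpha> / 2)"
        using r by (simp add: powr_add[symmetric] \<kappa>_def field_simps)
      also have "\<dots> = m * 2 powr (\<alpha> / 2)"
        using r by (simp add: m_def powr_mult powr_minus field_simps)
      also have "2 powr (\<alpha> / 2) = 2 powr \<kappa> * 2 powr (\<alpha> - 4)"
        by (simp add: powr_add[symmetric] \<kappa>_def field_simps)
      finally have "r powr (-\<kappa>) * r powr (4 - \<alpha>) = m * (2 powr \<kappa> * 2 powr (\<alpha> - 4))" .
      then have "(K * (2 * pi\<^sup>2 / (4 - \<alpha>))) * (r powr (-\<kappa>) * r powr (4 - \<alpha>))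
         = (K * (2 * pi\<^sup>2 / (4 - \<alpha>))) * (m * (2 powr \<kappa> * 2 powr (\<alpha> - 4)))"
        by simp
      then show ?thesis by (simp only: mult_ac)
    qed
    finally show ?thesis by (simp add: C_def m_def algebra_simps)
  qed
  moreover have "0 < C"
    unfolding C_def using K I \<alpha> by (intro add_nonneg_pos add_pos_pos) auto
  ultimately show ?thesis using that by blast
qed

text \<open>The rates \<open>\<alpha> / 2\<close> of \<open>V\<close> and
  \<open>(8 - \<alpha>) / 2\<close> of \<open>exp u\<close> add up to 4. In a ball around
  \<open>x\<close> of radius \<open>r = norm x / 2\<close> the source is thus of order
  \<open>r powr (-4)\<close>, and both terms of \<open>riesz_potential_bound\<close> become of order
  \<open>1 / r\<close>. Formally, \<open>x\<close> times the gradient of \<open>u\<close> is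
  bounded.\<close>

lemma norm_mult_inverse_potential_bounded:
  obtains B where "0 \<le> B" "\<And>x. norm x * inverse_potential x \<le> B"
proof -
  define \<kappa> where "\<kappa> = (8 - \<alpha>) / 2"
  obtain K where K: "0 < K" "\<And>x. 1 \<le> norm x \<Longrightarrow> exp (u x) \<le> K * norm x powr (-\<kappa>)"
    using exp_u_decay[OF slope_gt] unfolding \<kappa>_def by metis
  obtain K' where K': "0 < K'" "\<And>x. 2 \<le> norm x \<Longrightarrow> V x \<le> K' * norm x powr (-\<alpha> / 2)"
    using V_decay by metis
  obtain B where B: "\<And>x. inverse_potential x \<le> B" by (rule inverse_potential_bounded) blast
  have B0: "0 \<le> B" using B[of 0] inverse_potential_nonneg[of 0] by simp
  define C where "C = K * K'"
  have C: "0 < C" using K K' by (simp add: C_def)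
  have F4: "F x \<le> C * norm x powr (-4)" if x: "2 \<le> norm x" for x
  proof -
    have "F x \<le> (K' * norm x powr (-\<alpha> / 2)) * (K * norm x powr (-\<kappa>))"
      unfolding source_def using K K' x V_nonneg by (intro mult_mono) auto
    also have "\<dots> = C * (norm x powr (-\<alpha> / 2) * norm x powr (-\<kappa>))"
      by (simp add: C_def)
    also have "norm x powr (-\<alpha> / 2) * norm x powr (-\<kappa>) = norm x powr (-4)"
      unfolding powr_add[symmetric] by (rule arg_cong[where f="\<lambda>a. norm x powr a"]) (simp add: \<kappa>_def field_simps)
    finally show ?thesis .
  qed
  define B' where "B' = 4 * B + 2 * (C * (2 * pi\<^sup>2 / 3) + mass)"
  have B': "4 * B \<le> B'" "2 * (C * (2 * pi\<^sup>2 / 3) + mass) \<le> B'"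
    using B0 C mass_nonneg by (auto simp: B'_def)
  have "norm x * inverse_potential x \<le> B'" for x
  proof (cases "norm x \<le> 4")
    case True
    then have "norm x * inverse_potential x \<le> 4 * B"
      using B inverse_potential_nonneg by (intro mult_mono) auto
    then show ?thesis using B' by linarith
  next
    case False
    define r where "r = norm x / 2"
    have r: "2 < r" "norm x = 2 * r" using False by (auto simp: r_def)
    have "F y \<le> C * r powr (-4)" if "norm (x - y) < r" for y
    proof -
      have "norm x \<le> norm y + norm (x - y)" using norm_triangle_ineq[of y "x - y"] by simp
      then have y: "r \<le> norm y" using that r by linarith
      then have "F y \<le> C * norm y powr (-4)" using r by (intro F4) auto
      also have "\<dots> \<le> C * r powr (-4)"
        using C y r by (intro mult_left_mono powr_mono2') auto
      finally show ?thesis .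
    qed
    then have "inverse_potential x \<le> C * r powr (-4) * (2 * pi\<^sup>2 / (4 - 1) * r powr (4 - 1)) + r powr (-1) * mass"
      unfolding inverse_potential_def mass_def using r
      by (intro riesz_potential_bound(2)[OF F_int F_nonneg]) auto
    also have "\<dots> = (C * (2 * pi\<^sup>2 / 3) + mass) / r"
      using r by (simp add: powr_minus field_simps power3_eq_cube power4_eq_xxxx)
    finally have "norm x * inverse_potential x \<le> norm x * ((C * (2 * pi\<^sup>2 / 3) + mass) / r)"
      by (intro mult_left_mono) auto
    also have "\<dots> = 2 * (C * (2 * pi\<^sup>2 / 3) + mass)" using r by simp
    finally show ?thesis using B' by linarith
  qed
  moreover have "0 \<le> B'" using B0 C mass_nonneg by (simp add: B'_def)
  ultimately show ?thesis using that by blast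
qed

text \<open>The increment has length \<open>\<bar>t - 1\<bar> * norm x\<close>, and its factor
  \<open>norm x\<close> is absorbed by the preceding bound. The condition on \<open>t\<close> allows
  the bound at \<open>t *\<^sub>R x\<close> to be used with \<open>norm x\<close> at the price of a
  factor 2.\<close>

lemma u_dilation_diff:
  obtains B where "0 \<le> B" "\<And>t x. 1 / 2 \<le> t \<Longrightarrow> \<bar>u (t *\<^sub>R x) - u x\<bar> \<le> B * \<bar>t - 1\<bar>"
proof -
  obtain B where B: "0 \<le> B" "\<And>x. norm x * inverse_potential x \<le> B"
    using norm_mult_inverse_potential_bounded by metis
  have "\<bar>u (t *\<^sub>R x) - u x\<bar> \<le> (1 / (8 * pi\<^sup>2) * (3 * B)) * \<bar>t - 1\<bar>" if t: "1 / 2 \<le> t" for t x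
  proof -
    have "t *\<^sub>R x - x = (t - 1) *\<^sub>R x" by (simp add: scaleR_diff_left)
    then have n: "norm (t *\<^sub>R x - x) = \<bar>t - 1\<bar> * norm x" by simp
    have "t * (norm x * inverse_potential (t *\<^sub>R x)) \<le> B"
      using B(2)[of "t *\<^sub>R x"] t by simp
    moreover have "1 / 2 * (norm x * inverse_potential (t *\<^sub>R x)) \<le> t * (norm x * inverse_potential (t *\<^sub>R x))"
      using t inverse_potential_nonneg by (intro mult_right_mono) auto
    ultimately have "norm x * inverse_potential (t *\<^sub>R x) \<le> 2 * B" by linarith
    then have "norm x * (inverse_potential (t *\<^sub>R x) + inverse_potential x) \<le> 3 * B"
      using B(2)[of x] by (simp add: distrib_left)
    then have "1 / (8 * pi\<^sup>2) * \<bar>t - 1\<bar> * (norm x * (inverse_potential (t *\<^sub>R x) + inverse_potential x))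
       \<le> 1 / (8 * pi\<^sup>2) * \<bar>t - 1\<bar> * (3 * B)"
      by (intro mult_left_mono) auto
    moreover have "1 / (8 * pi\<^sup>2) * norm (t *\<^sub>R x - x) * (inverse_potential (t *\<^sub>R x) + inverse_potential x)
       = 1 / (8 * pi\<^sup>2) * \<bar>t - 1\<bar> * (norm x * (inverse_potential (t *\<^sub>R x) + inverse_potential x))"
      by (simp only: n mult_ac)
    ultimately show ?thesis using u_diff_le[of "t *\<^sub>R x" x] by (simp only: mult_ac)
  qed
  moreover have "0 \<le> 1 / (8 * pi\<^sup>2) * (3 * B)" using B by simp
  ultimately show ?thesis using that by blast
qed

text \<open>Two integral forms of the Pohozaev identity, for dilations instead of the vector field
  generating them: both follow from the symmetry of the kernels, without derivatives of \<open>u\<close>.\<close>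

lemma dilation_identity_riesz:
  assumes t: "0 < t"
  shows "(\<integral>\<^sup>+x. ennreal (V x * exp (u (t *\<^sub>R x))) \<partial>lborel)
     = ennreal (t powr (\<alpha> - 8)) * (\<integral>\<^sup>+x. ennreal (V x * exp (u ((1 / t) *\<^sub>R x))) \<partial>lborel)"
proof -
  define D where "D s = (\<integral>\<^sup>+x. \<integral>\<^sup>+y. ennreal (exp (u x) * exp (u y) * norm (x - s *\<^sub>R y) powr (-\<alpha>)) \<partial>lborel \<partial>lborel)" for s
  have V: "ennreal (V x) = (\<integral>\<^sup>+y. ennreal (exp (u y) * norm (x - y) powr (-\<alpha>)) \<partial>lborel)" for x
    unfolding riesz_def by (rule nn_integral_eq_integral[symmetric, OF V_integrable]) auto
  have A: "(\<integral>\<^sup>+x. ennreal (V x * exp (u (s *\<^sub>R x))) \<partial>lborel) = ennreal (s powr (\<alpha> - 4)) * D s" if s: "0 < s" for s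
  proof -
    have "(\<integral>\<^sup>+x. ennreal (V x * exp (u (s *\<^sub>R x))) \<partial>lborel)
       = ennreal (\<bar>1 / s\<bar> ^ DIM(real^4)) * (\<integral>\<^sup>+x. ennreal (V (0 + (1 / s) *\<^sub>R x) * exp (u (s *\<^sub>R (0 + (1 / s) *\<^sub>R x)))) \<partial>lborel)"
      using s by (intro nn_integral_dilation) auto
    also have "(\<integral>\<^sup>+x. ennreal (V (0 + (1 / s) *\<^sub>R x) * exp (u (s *\<^sub>R (0 + (1 / s) *\<^sub>R x)))) \<partial>lborel)
       = (\<integral>\<^sup>+x. ennreal (s powr \<alpha>) * (\<integral>\<^sup>+y. ennreal (exp (u x) * exp (u y) * norm (x - s *\<^sub>R y) powr (-\<alpha>)) \<partial>lborel) \<partial>lborel)"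
    proof (rule nn_integral_cong)
      fix x
      have "ennreal (V (0 + (1 / s) *\<^sub>R x) * exp (u (s *\<^sub>R (0 + (1 / s) *\<^sub>R x))))
          = ennreal (exp (u x)) * ennreal (V ((1 / s) *\<^sub>R x))"
        using s V_nonneg by (simp add: ennreal_mult mult.commute)
      also have "\<dots> = (\<integral>\<^sup>+y. ennreal (exp (u x)) * ennreal (exp (u y) * norm ((1 / s) *\<^sub>R x - y) powr (-\<alpha>)) \<partial>lborel)"
        unfolding V by (rule nn_integral_cmult[symmetric]) measurable
      also have "\<dots> = (\<integral>\<^sup>+y. ennreal (s powr \<alpha>) * ennreal (exp (u x) * exp (u y) * norm (x - s *\<^sub>R y) powr (-\<alpha>)) \<partial>lborel)"
      proof (rule nn_integral_cong)
        fix y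
        have "(1 / s) *\<^sub>R x - y = (1 / s) *\<^sub>R (x - s *\<^sub>R y)" using s by (simp add: scaleR_diff_right)
        then have n: "norm ((1 / s) *\<^sub>R x - y) = norm (x - s *\<^sub>R y) / s" using s by simp
        have "norm ((1 / s) *\<^sub>R x - y) powr (-\<alpha>) = s powr \<alpha> * norm (x - s *\<^sub>R y) powr (-\<alpha>)"
          unfolding n using s by (intro powr_minus_divide_scale) auto
        then show "ennreal (exp (u x)) * ennreal (exp (u y) * norm ((1 / s) *\<^sub>R x - y) powr (-\<alpha>))
           = ennreal (s powr \<alpha>) * ennreal (exp (u x) * exp (u y) * norm (x - s *\<^sub>R y) powr (-\<alpha>))"
          by (simp add: ennreal_mult[symmetric] mult_ac)
      qed
      also have "\<dots> = ennreal (s powr \<alpha>) * (\<integral>\<^sup>+y. ennreal (exp (u x) * exp (u y) * norm (x - s *\<^sub>R y) powr (-\<alpha>)) \<partial>lborel)"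
        by (rule nn_integral_cmult) measurable
      finally show "ennreal (V (0 + (1 / s) *\<^sub>R x) * exp (u (s *\<^sub>R (0 + (1 / s) *\<^sub>R x)))) = \<dots>" .
    qed
    also have "\<dots> = ennreal (s powr \<alpha>) * D s"
      unfolding D_def by (rule nn_integral_cmult) measurable
    also have "ennreal (\<bar>1 / s\<bar> ^ DIM(real^4)) * (ennreal (s powr \<alpha>) * D s) = ennreal (\<bar>1 / s\<bar> ^ DIM(real^4) * s powr \<alpha>) * D s"
      by (simp add: ennreal_mult mult.assoc)
    also have "\<bar>1 / s\<bar> ^ DIM(real^4) * s powr \<alpha> = s powr (\<alpha> - 4)"
      using s by (simp add: powr_diff field_simps power4_eq_xxxx)
    finally show ?thesis .
  qed
  \<comment> \<open>Pulling \<open>1 / t\<close> out of \<open>x - (1 / t) *\<^sub>R y\<close>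
    leaves \<open>t *\<^sub>R x - y\<close>; exchanging the names of the two variables restores
    \<open>D t\<close>.\<close>
  have D: "D (1 / t) = ennreal (t powr \<alpha>) * D t"
  proof -
    have "D (1 / t) = (\<integral>\<^sup>+x. \<integral>\<^sup>+y. ennreal (t powr \<alpha>) * ennreal (exp (u x) * exp (u y) * norm (t *\<^sub>R x - y) powr (-\<alpha>)) \<partial>lborel \<partial>lborel)"
      unfolding D_def
    proof (intro nn_integral_cong)
      fix x y :: "real^4"
      have "x - (1 / t) *\<^sub>R y = (1 / t) *\<^sub>R (t *\<^sub>R x - y)" using t by (simp add: scaleR_diff_right)
      then have n: "norm (x - (1 / t) *\<^sub>R y) = norm (t *\<^sub>R x - y) / t" using t by simp
      have "norm (x - (1 / t) *\<^sub>R y) powr (-\<alpha>) = t powr \<alpha> * norm (t *\<^sub>R x - y) powr (-\<alpha>)"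
        unfolding n using t by (intro powr_minus_divide_scale) auto
      then show "ennreal (exp (u x) * exp (u y) * norm (x - (1 / t) *\<^sub>R y) powr (-\<alpha>))
          = ennreal (t powr \<alpha>) * ennreal (exp (u x) * exp (u y) * norm (t *\<^sub>R x - y) powr (-\<alpha>))"
        by (simp add: ennreal_mult[symmetric] mult_ac)
    qed
    also have "\<dots> = ennreal (t powr \<alpha>) * (\<integral>\<^sup>+x. \<integral>\<^sup>+y. ennreal (exp (u x) * exp (u y) * norm (t *\<^sub>R x - y) powr (-\<alpha>)) \<partial>lborel \<partial>lborel)"
      by (simp add: nn_integral_cmult)
    also have "(\<integral>\<^sup>+x. \<integral>\<^sup>+y. ennreal (exp (u x) * exp (u y) * norm (t *\<^sub>R x - y) powr (-\<alpha>)) \<partial>lborel \<partial>lborel)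
      = (\<integral>\<^sup>+y. \<integral>\<^sup>+x. ennreal (exp (u x) * exp (u y) * norm (t *\<^sub>R x - y) powr (-\<alpha>)) \<partial>lborel \<partial>lborel)"
      by (rule lborel_pair.Fubini'[symmetric]) measurable
    also have "\<dots> = D t"
      unfolding D_def by (simp add: norm_minus_commute mult_ac)
    finally show ?thesis .
  qed
  have "(\<integral>\<^sup>+x. ennreal (V x * exp (u (t *\<^sub>R x))) \<partial>lborel) = ennreal (t powr (\<alpha> - 4)) * D t"
    by (rule A[OF t])
  also have "\<dots> = ennreal (t powr (\<alpha> - 8) * ((1 / t) powr (\<alpha> - 4) * t powr \<alpha>)) * D t"
  proof -
    have "(1 / t) powr (\<alpha> - 4) = t powr (4 - \<alpha>)" using t by (simp add: powr_divide powr_diff field_simps)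
    then have "t powr (\<alpha> - 8) * ((1 / t) powr (\<alpha> - 4) * t powr \<alpha>) = t powr (\<alpha> - 4)"
      by (simp add: powr_add[symmetric])
    then show ?thesis by simp
  qed
  also have "\<dots> = ennreal (t powr (\<alpha> - 8)) * (ennreal ((1 / t) powr (\<alpha> - 4)) * D (1 / t))"
    by (simp add: D ennreal_mult mult.assoc)
  also have "\<dots> = ennreal (t powr (\<alpha> - 8)) * (\<integral>\<^sup>+x. ennreal (V x * exp (u ((1 / t) *\<^sub>R x))) \<partial>lborel)"
    using t A[of "1 / t"] by simp
  finally show ?thesis .
qed

text \<open>Absolute values are needed here to justify Fubini's theorem for the logarithmic kernel,
  whose sign changes.\<close>

lemma ln_potential_growth:
  obtains K where "0 \<le> K" "\<And>x. (\<integral>y. \<bar>ln (norm (x - y)) * F y\<bar> \<partial>lborel) \<le> K + mass * ln (1 + norm x)"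
proof -
  obtain B where B: "\<And>x. inverse_potential x \<le> B" by (rule inverse_potential_bounded) blast
  have B0: "0 \<le> B" using B[of 0] inverse_potential_nonneg[of 0] by simp
  define L where "L = (\<integral>y. ln (1 + norm y) * F y \<partial>lborel)"
  have L0: "0 \<le> L" unfolding L_def using F_nonneg
    by (intro Bochner_Integration.integral_nonneg) (auto simp: ln_ge_zero_iff add_pos_nonneg)
  have "(\<integral>y. \<bar>ln (norm (x - y)) * F y\<bar> \<partial>lborel) \<le> (B + L) + mass * ln (1 + norm x)" for x
  proof -
    have "(\<integral>y. \<bar>ln (norm (x - y)) * F y\<bar> \<partial>lborel)
       \<le> (\<integral>y. ln (1 + norm x) * F y + ln (1 + norm y) * F y + F y * norm (x - y) powr (-1) \<partial>lborel)"
    proof (rule integral_mono)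
      fix y :: "real^4"
      have "0 \<le> ln (1 + norm x)" "0 \<le> ln (1 + norm y)" by (auto simp: ln_ge_zero_iff add_pos_nonneg)
      moreover have "0 \<le> norm (x - y) powr (-1)" by simp
      ultimately have "\<bar>ln (norm (x - y))\<bar> \<le> ln (1 + norm x) + ln (1 + norm y) + norm (x - y) powr (-1)"
        using neg_ln_le_inverse[of "norm (x - y)"] ln_norm_diff_le[of x y] norm_ge_zero[of "x - y"] by linarith
      from mult_right_mono[OF this F_nonneg[of y]]
      show "\<bar>ln (norm (x - y)) * F y\<bar> \<le> ln (1 + norm x) * F y + ln (1 + norm y) * F y + F y * norm (x - y) powr (-1)"
        using F_nonneg[of y] by (simp add: abs_mult algebra_simps)
    qed (use lnF_int[of x] F_int ln_growth_integrable inverse_potential_integrable[of x] in auto)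
    also have "\<dots> = ln (1 + norm x) * mass + L + inverse_potential x"
      using F_int ln_growth_integrable inverse_potential_integrable[of x]
      by (simp add: mass_def L_def inverse_potential_def)
    finally show ?thesis using B[of x] by (simp add: mult.commute)
  qed
  moreover have "0 \<le> B + L" using B0 L0 by simp
  ultimately show ?thesis using that by blast
qed

lemma F_u_dilation_integrable:
  assumes "0 < t"
  shows "integrable lborel (\<lambda>x. F x * u (t *\<^sub>R x))"
proof -
  obtain K where K: "\<And>x. - slope * ln (1 + norm x) - K \<le> u x" by (rule u_lower_bound) blast
  obtain M where M: "\<And>x. u x \<le> M" by (rule u_bounded_above) blast
  define K' where "K' = \<bar>K\<bar> + \<bar>M\<bar> + slope * ln (1 + t)"
  show ?thesis
  proof (rule Bochner_Integration.integrable_bound)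
    show "integrable lborel (\<lambda>x. K' * F x + slope * (ln (1 + norm x) * F x))"
      using F_int ln_growth_integrable by auto
    have "\<bar>u (t *\<^sub>R x)\<bar> \<le> K' + slope * ln (1 + norm x)" for x
    proof -
      have "ln (1 + t * norm x) \<le> ln (1 + t) + ln (1 + norm x)"
        using assms by (intro ln_one_plus_mult_le) auto
      then have "slope * ln (1 + norm (t *\<^sub>R x)) \<le> slope * (ln (1 + t) + ln (1 + norm x))"
        using assms slope_pos by (intro mult_left_mono) auto
      moreover have "0 \<le> slope * ln (1 + t)" "0 \<le> slope * ln (1 + norm x)"
        using assms slope_pos by (auto intro!: mult_nonneg_nonneg simp: ln_ge_zero_iff add_pos_nonneg)
      ultimately show ?thesis
        using K[of "t *\<^sub>R x"] M[of "t *\<^sub>R x"] unfolding K'_def by (simp add: distrib_left)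
    qed
    then have "F x * \<bar>u (t *\<^sub>R x)\<bar> \<le> F x * (K' + slope * ln (1 + norm x))" for x
      using F_nonneg by (intro mult_left_mono)
    then have "\<bar>F x * u (t *\<^sub>R x)\<bar> \<le> K' * F x + slope * (ln (1 + norm x) * F x)" for x
      using F_nonneg[of x] by (simp add: abs_mult algebra_simps)
    then show "AE x in lborel. norm (F x * u (t *\<^sub>R x)) \<le> norm (K' * F x + slope * (ln (1 + norm x) * F x))"
      by (auto intro!: AE_I2 order_trans[OF _ abs_ge_self])
  qed measurable
qed

lemma dilation_identity_ln:
  assumes t: "0 < t"
  shows "(\<integral>x. F x * u (t *\<^sub>R x) \<partial>lborel) - (\<integral>x. F x * u ((1 / t) *\<^sub>R x) \<partial>lborel) = - slope * mass * ln t"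
proof -
  define c where "c = 1 / (8 * pi\<^sup>2)"
  define G where "G s x y = F x * F y * ln (norm (s *\<^sub>R x - y))" for s x y
  have Gint: "integrable lborel (G s x)" for s x
    unfolding G_def using lnF_int[of "s *\<^sub>R x", THEN integrable_mult_right, of "F x"] by (simp add: mult_ac)
  have Fu: "F x * u (s *\<^sub>R x) = - c * (\<integral>y. G s x y \<partial>lborel) + c0 * F x" for s x
  proof -
    define I where "I = (\<integral>y. ln (norm (s *\<^sub>R x - y)) * F y \<partial>lborel)"
    have "(\<integral>y. G s x y \<partial>lborel) = (\<integral>y. F x * (ln (norm (s *\<^sub>R x - y)) * F y) \<partial>lborel)"
      unfolding G_def by (simp add: mult_ac)
    also have "\<dots> = F x * I"
      unfolding I_def by (rule integral_mult_right_zero)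
    finally have G: "(\<integral>y. G s x y \<partial>lborel) = F x * I" .
    have u: "u (s *\<^sub>R x) = - c * I + c0" unfolding I_def c_def by (rule u_eq)
    show ?thesis unfolding G u by (simp add: algebra_simps)
  qed
  have c: "c \<noteq> 0" by (simp add: c_def)
  have inner: "integrable lborel (\<lambda>x. \<integral>y. G s x y \<partial>lborel)" if "0 < s" for s
  proof -
    have "(\<lambda>x. \<integral>y. G s x y \<partial>lborel) = (\<lambda>x. (c0 / c) * F x - (1 / c) * (F x * u (s *\<^sub>R x)))"
    proof
      fix x
      have "z = (c0 / c) * f - (1 / c) * w" if "w = - c * z + c0 * f" for z f w :: real
        using that c by (simp add: field_simps)
      from this[OF Fu] show "(\<integral>y. G s x y \<partial>lborel) = (c0 / c) * F x - (1 / c) * (F x * u (s *\<^sub>R x))" .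
    qed
    then show ?thesis using F_int F_u_dilation_integrable[OF that] by simp
  qed
  have I: "(\<integral>x. F x * u (s *\<^sub>R x) \<partial>lborel) = - c * (\<integral>x. \<integral>y. G s x y \<partial>lborel \<partial>lborel) + c0 * mass" if "0 < s" for s
  proof -
    have "(\<integral>x. F x * u (s *\<^sub>R x) \<partial>lborel) = (\<integral>x. - c * (\<integral>y. G s x y \<partial>lborel) + c0 * F x \<partial>lborel)"
      by (simp only: Fu)
    also have "\<dots> = (\<integral>x. - c * (\<integral>y. G s x y \<partial>lborel) \<partial>lborel) + (\<integral>x. c0 * F x \<partial>lborel)"
      using inner[OF that] F_int by (intro Bochner_Integration.integral_add integrable_mult_right)
    also have "\<dots> = - c * (\<integral>x. \<integral>y. G s x y \<partial>lborel \<partial>lborel) + c0 * mass"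
      unfolding mass_def by (simp only: integral_mult_right_zero)
    finally show ?thesis .
  qed
  have pair: "integrable (lborel \<Otimes>\<^sub>M lborel) (case_prod (G t))"
  proof (rule lborel_pair.Fubini_integrable)
    show "case_prod (G t) \<in> borel_measurable (lborel \<Otimes>\<^sub>M lborel)"
      unfolding G_def[abs_def] by measurable
    obtain K where K: "0 \<le> K" "\<And>x. (\<integral>y. \<bar>ln (norm (x - y)) * F y\<bar> \<partial>lborel) \<le> K + mass * ln (1 + norm x)"
      by (rule ln_potential_growth) blast
    have eq: "(\<integral>y. norm (G t x y) \<partial>lborel) = F x * (\<integral>y. \<bar>ln (norm (t *\<^sub>R x - y)) * F y\<bar> \<partial>lborel)" for x
    proof -
      have "(\<integral>y. norm (G t x y) \<partial>lborel) = (\<integral>y. F x * \<bar>ln (norm (t *\<^sub>R x - y)) * F y\<bar> \<partial>lborel)"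
        by (simp add: G_def abs_mult F_nonneg mult_ac)
      also have "\<dots> = F x * (\<integral>y. \<bar>ln (norm (t *\<^sub>R x - y)) * F y\<bar> \<partial>lborel)"
        by (rule integral_mult_right_zero)
      finally show ?thesis .
    qed
    define K' where "K' = K + mass * ln (1 + t)"
    have bnd: "F x * (\<integral>y. \<bar>ln (norm (t *\<^sub>R x - y)) * F y\<bar> \<partial>lborel) \<le> K' * F x + mass * (ln (1 + norm x) * F x)" for x
    proof -
      have "ln (1 + t * norm x) \<le> ln (1 + t) + ln (1 + norm x)"
        using t by (intro ln_one_plus_mult_le) auto
      then have "mass * ln (1 + norm (t *\<^sub>R x)) \<le> mass * (ln (1 + t) + ln (1 + norm x))"
        using t mass_nonneg by (intro mult_left_mono) auto
      then have "(\<integral>y. \<bar>ln (norm (t *\<^sub>R x - y)) * F y\<bar> \<partial>lborel) \<le> K' + mass * ln (1 + norm x)"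
        using K(2)[of "t *\<^sub>R x"] by (simp add: K'_def distrib_left)
      from mult_left_mono[OF this F_nonneg[of x]] show ?thesis by (simp add: algebra_simps)
    qed
    have "integrable lborel (\<lambda>x. \<integral>y. norm (G t x y) \<partial>lborel)"
      unfolding eq
    proof (rule Bochner_Integration.integrable_bound)
      show "integrable lborel (\<lambda>x. K' * F x + mass * (ln (1 + norm x) * F x))"
        using F_int ln_growth_integrable by auto
      show "AE x in lborel. norm (F x * (\<integral>y. \<bar>ln (norm (t *\<^sub>R x - y)) * F y\<bar> \<partial>lborel))
         \<le> norm (K' * F x + mass * (ln (1 + norm x) * F x))"
        using bnd F_nonneg by (auto intro!: AE_I2 order_trans[OF _ abs_ge_self] simp: abs_mult)
    qed measurable
    then show "integrable lborel (\<lambda>x. \<integral>y. norm (case_prod (G t) (x, y)) \<partial>lborel)"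
      by simp
    show "AE x in lborel. integrable lborel (\<lambda>y. case_prod (G t) (x, y))"
      using Gint by simp
  qed
  \<comment> \<open>The same symmetry as for the Riesz kernel, except that the factor
    \<open>1 / t\<close> now splits off additively as \<open>- ln t\<close>. Weighted with
    \<open>F x * F y\<close> this integrates to \<open>ln t\<close> times the square of the mass.
    The point where both norms vanish is excluded, since \<open>ln 0 = 0\<close> breaks the identity
    there.\<close>
  have "(\<integral>x. \<integral>y. G (1 / t) x y \<partial>lborel \<partial>lborel) = (\<integral>x. (\<integral>y. G t y x \<partial>lborel) - ln t * mass * F x \<partial>lborel)"
  proof (rule Bochner_Integration.integral_cong)
    fix x
    have "AE y in lborel. G (1 / t) x y = G t y x - ln t * F x * F y"
      using AE_lborel_neq[of "(1 / t) *\<^sub>R x"]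
    proof eventually_elim
      case (elim y)
      have "(1 / t) *\<^sub>R x - y = (- 1 / t) *\<^sub>R (t *\<^sub>R y - x)" using t by (simp add: scaleR_diff_right)
      then have n: "norm ((1 / t) *\<^sub>R x - y) = norm (t *\<^sub>R y - x) / t" using t by simp
      moreover have "0 < norm ((1 / t) *\<^sub>R x - y)" using elim by auto
      ultimately have ln: "ln (norm ((1 / t) *\<^sub>R x - y)) = ln (norm (t *\<^sub>R y - x)) - ln t"
        using t by (subst n, subst ln_divide_pos) (auto simp: zero_less_divide_iff)
      show ?case unfolding G_def ln by (simp add: algebra_simps)
    qed
    then have AE: "AE y in lborel. G t y x = G (1 / t) x y + ln t * F x * F y"
      by eventually_elim simp
    have "(\<integral>y. G t y x \<partial>lborel) = (\<integral>y. G (1 / t) x y + ln t * F x * F y \<partial>lborel)"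
      by (rule integral_cong_AE) (use AE in \<open>auto simp: G_def\<close>)
    also have "\<dots> = (\<integral>y. G (1 / t) x y \<partial>lborel) + ln t * F x * mass"
      using Gint[of "1 / t" x] F_int by (simp add: mass_def)
    finally show "(\<integral>y. G (1 / t) x y \<partial>lborel) = (\<integral>y. G t y x \<partial>lborel) - ln t * mass * F x"
      by (simp add: mult_ac)
  qed simp
  also have "\<dots> = (\<integral>x. \<integral>y. G t y x \<partial>lborel \<partial>lborel) - ln t * mass * mass"
    using lborel_pair.integrable_snd[OF pair] F_int by (simp add: mass_def)
  also have "(\<integral>x. \<integral>y. G t y x \<partial>lborel \<partial>lborel) = (\<integral>x. \<integral>y. G t x y \<partial>lborel \<partial>lborel)"
    by (rule lborel_pair.Fubini_integral[OF pair])
  finally have J: "(\<integral>x. \<integral>y. G (1 / t) x y \<partial>lborel \<partial>lborel)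
      = (\<integral>x. \<integral>y. G t x y \<partial>lborel \<partial>lborel) - ln t * mass * mass" .
  have "0 < 1 / t" using t by simp
  then show ?thesis
    unfolding I[OF t] I[OF \<open>0 < 1 / t\<close>] J by (simp add: slope_def c_def algebra_simps)
qed

lemma abs_exp_remainder_le:
  fixes x :: real
  assumes "\<bar>x\<bar> \<le> 1"
  shows "\<bar>exp x - 1 - x\<bar> \<le> x\<^sup>2"
proof -
  have "1 + x \<le> exp x" by (rule exp_ge_add_one_self)
  moreover have "exp x \<le> 1 + x + x\<^sup>2"
  proof (cases "0 \<le> x")
    case True
    then show ?thesis using assms by (intro exp_bound) auto
  next
    case False
    have pos: "0 < 1 - x + x\<^sup>2 / 2" using False by (intro add_pos_nonneg) auto
    have "exp x \<le> 1 / (1 - x + x\<^sup>2 / 2)"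
    proof -
      have "1 - x + x\<^sup>2 / 2 \<le> exp (- x)"
        using exp_lower_Taylor_quadratic[of "- x"] False by simp
      then have "1 / exp (- x) \<le> 1 / (1 - x + x\<^sup>2 / 2)"
        using pos by (intro divide_left_mono) auto
      then show ?thesis by (simp add: exp_minus inverse_eq_divide)
    qed
    also have "\<dots> \<le> 1 + x + x\<^sup>2"
    proof -
      have "(1 + x + x\<^sup>2) * (1 - x + x\<^sup>2 / 2) = 1 + x\<^sup>2 / 2 + (- x) ^ 3 / 2 + x ^ 4 / 2"
        by (simp add: field_simps power2_eq_square power3_eq_cube power4_eq_xxxx)
      moreover have "0 \<le> (- x) ^ 3" "0 \<le> x\<^sup>2" "0 \<le> x ^ 4"
        using False by (auto intro: zero_le_power)
      ultimately have "1 \<le> (1 + x + x\<^sup>2) * (1 - x + x\<^sup>2 / 2)" by linarith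
      then show ?thesis using pos by (simp add: divide_le_eq)
    qed
    finally show ?thesis .
  qed
  moreover have "0 \<le> x\<^sup>2" by simp
  ultimately show ?thesis unfolding abs_le_iff by (intro conjI; linarith)
qed

lemma F_mult_bounded_integrable:
  assumes [measurable]: "Z \<in> borel_measurable borel" and Z: "\<And>x. \<bar>Z x\<bar> \<le> k"
  shows "integrable lborel (\<lambda>x. F x * Z x)"
proof (rule Bochner_Integration.integrable_bound)
  show "integrable lborel (\<lambda>x. k * F x)" using F_int by simp
  have "\<bar>F x * Z x\<bar> \<le> \<bar>k * F x\<bar>" for x
  proof -
    have "\<bar>F x * Z x\<bar> = \<bar>Z x\<bar> * F x" using F_nonneg[of x] by (simp add: abs_mult)
    also have "\<dots> \<le> k * F x" by (intro mult_right_mono Z F_nonneg)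
    finally show ?thesis by linarith
  qed
  then show "AE x in lborel. norm (F x * Z x) \<le> norm (k * F x)" by simp
qed measurable

text \<open>The two dilation identities are compared to first order in \<open>s = ln t\<close>. The
  Riesz identity says that \<open>F * exp X\<close> and \<open>F * exp Y\<close> have equal
  integrals; the logarithmic one says that the integrals of \<open>F * X\<close> and
  \<open>F * Y\<close> differ by \<open>(2 * \<kappa> - slope) * s * mass\<close>. As
  \<open>X\<close> and \<open>Y\<close> are uniformly of order \<open>s\<close>, linearising the
  exponentials costs only order \<open>s\<^sup>2\<close>, and the coefficient must vanish.\<close>

theorem slope_eq: "slope = 8 - \<alpha>"
proof (rule ccontr)
  assume ne: "slope \<noteq> 8 - \<alpha>"
  define \<kappa> where "\<kappa> = (8 - \<alpha>) / 2"
  obtain B where B: "0 \<le> B" "\<And>t x. 1 / 2 \<le> t \<Longrightarrow> \<bar>u (t *\<^sub>R x) - u x\<bar> \<le> B * \<bar>t - 1\<bar>"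
    using u_dilation_diff by metis
  define C where "C = \<kappa> + 2 * B"
  have C: "0 < C" using B \<alpha> by (auto simp: C_def \<kappa>_def intro: add_pos_nonneg)
  have main: "\<bar>2 * \<kappa> - slope\<bar> \<le> 2 * C\<^sup>2 * s" if s: "0 < s" "s \<le> 1 / 2" "C * s \<le> 1" for s
  proof -
    define t where "t = exp s"
    have t: "1 < t" "1 / t = exp (- s)" "ln t = s"
      using s unfolding t_def by (simp_all add: exp_minus inverse_eq_divide)
    have t1: "\<bar>t - 1\<bar> \<le> 2 * s"
    proof -
      have "exp s \<le> 1 + s + s\<^sup>2" using s by (intro exp_bound) auto
      moreover have "s\<^sup>2 \<le> s" using s power_decreasing[of 1 2 s] by simp
      ultimately show ?thesis using t(1) unfolding t_def by linarith
    qed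
    have "1 - s \<le> exp (- s)" "exp (- s) \<le> 1"
      using exp_ge_add_one_self[of "-s"] s by simp_all
    then have t2: "\<bar>1 / t - 1\<bar> \<le> 2 * s" "1 / 2 \<le> 1 / t"
      using s unfolding t(2) by linarith+
    \<comment> \<open>The shifts by \<open>\<kappa> * s\<close> and \<open>- \<kappa> * s\<close>
      share the factor \<open>t powr (\<alpha> - 8) = exp (- 2 * \<kappa> * s)\<close> of the Riesz
      identity evenly between the two dilations.\<close>
    define X where "X x = \<kappa> * s + (u (t *\<^sub>R x) - u x)" for x
    define Y where "Y x = - \<kappa> * s + (u ((1 / t) *\<^sub>R x) - u x)" for x
    have \<kappa>: "0 < \<kappa>" using \<alpha> by (simp add: \<kappa>_def)
    have X: "\<bar>X x\<bar> \<le> C * s" for x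
    proof -
      have "B * \<bar>t - 1\<bar> \<le> B * (2 * s)" using B t1 by (intro mult_left_mono)
      then have "\<bar>u (t *\<^sub>R x) - u x\<bar> \<le> 2 * B * s" using B(2)[of t x] t(1) by linarith
      moreover have "0 < \<kappa> * s" using \<kappa> s by simp
      ultimately show ?thesis unfolding X_def C_def by (simp add: distrib_right)
    qed
    have Y: "\<bar>Y x\<bar> \<le> C * s" for x
    proof -
      have "B * \<bar>1 / t - 1\<bar> \<le> B * (2 * s)" using B t2 by (intro mult_left_mono)
      then have "\<bar>u ((1 / t) *\<^sub>R x) - u x\<bar> \<le> 2 * B * s" using B(2)[OF t2(2), of x] by linarith
      moreover have "0 < \<kappa> * s" using \<kappa> s by simp
      ultimately show ?thesis unfolding Y_def C_def by (simp add: distrib_right)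
    qed
    have [measurable]: "X \<in> borel_measurable borel" "Y \<in> borel_measurable borel"
      unfolding X_def[abs_def] Y_def[abs_def] by measurable
    have FX: "integrable lborel (\<lambda>x. F x * X x)" "integrable lborel (\<lambda>x. F x * Y x)"
      using X Y by (auto intro!: F_mult_bounded_integrable)
    have "exp z \<le> exp 1" if "\<bar>z\<bar> \<le> C * s" for z using that s by simp
    then have "\<bar>exp (X x)\<bar> \<le> exp 1" "\<bar>exp (Y x)\<bar> \<le> exp 1" for x
      using X[of x] Y[of x] by auto
    then have FeX: "integrable lborel (\<lambda>x. F x * exp (X x))" "integrable lborel (\<lambda>x. F x * exp (Y x))"
      by - (rule F_mult_bounded_integrable[where k = "exp 1"]; measurable)+
    have eq: "(\<integral>x. F x * exp (X x) \<partial>lborel) = (\<integral>x. F x * exp (Y x) \<partial>lborel)"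
    proof -
      have "ennreal (\<integral>x. F x * exp (X x) \<partial>lborel) = (\<integral>\<^sup>+x. ennreal (F x * exp (X x)) \<partial>lborel)"
        using FeX F_nonneg by (intro nn_integral_eq_integral[symmetric]) auto
      also have "\<dots> = (\<integral>\<^sup>+x. ennreal (exp (\<kappa> * s)) * ennreal (V x * exp (u (t *\<^sub>R x))) \<partial>lborel)"
        by (intro nn_integral_cong) (simp add: ennreal_mult[symmetric] V_nonneg source_def X_def exp_add exp_diff)
      also have "\<dots> = ennreal (exp (\<kappa> * s)) * (\<integral>\<^sup>+x. ennreal (V x * exp (u (t *\<^sub>R x))) \<partial>lborel)"
        by (rule nn_integral_cmult) measurable
      also have "\<dots> = ennreal (exp (\<kappa> * s)) * (ennreal (t powr (\<alpha> - 8)) * (\<integral>\<^sup>+x. ennreal (V x * exp (u ((1 / t) *\<^sub>R x))) \<partial>lborel))"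
        using t by (subst dilation_identity_riesz) auto
      also have "\<dots> = ennreal (exp (\<kappa> * s) * t powr (\<alpha> - 8)) * (\<integral>\<^sup>+x. ennreal (V x * exp (u ((1 / t) *\<^sub>R x))) \<partial>lborel)"
        by (simp add: ennreal_mult mult.assoc)
      also have "exp (\<kappa> * s) * t powr (\<alpha> - 8) = exp (- \<kappa> * s)"
        using t by (simp add: powr_def exp_add[symmetric] \<kappa>_def field_simps)
      also have "ennreal (exp (- \<kappa> * s)) * (\<integral>\<^sup>+x. ennreal (V x * exp (u ((1 / t) *\<^sub>R x))) \<partial>lborel)
         = (\<integral>\<^sup>+x. ennreal (exp (- \<kappa> * s)) * ennreal (V x * exp (u ((1 / t) *\<^sub>R x))) \<partial>lborel)"
        by (rule nn_integral_cmult[symmetric]) measurable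
      also have "\<dots> = (\<integral>\<^sup>+x. ennreal (F x * exp (Y x)) \<partial>lborel)"
        by (intro nn_integral_cong) (simp add: ennreal_mult[symmetric] V_nonneg source_def Y_def exp_add exp_diff exp_minus inverse_eq_divide)
      also have "\<dots> = ennreal (\<integral>x. F x * exp (Y x) \<partial>lborel)"
        using FeX F_nonneg by (intro nn_integral_eq_integral) auto
      finally show ?thesis
        using F_nonneg by (subst (asm) ennreal_inj) (auto intro!: Bochner_Integration.integral_nonneg)
    qed
    have "(\<integral>x. F x * X x \<partial>lborel) - (\<integral>x. F x * Y x \<partial>lborel)
       = (\<integral>x. 2 * \<kappa> * s * F x + (F x * u (t *\<^sub>R x) - F x * u ((1 / t) *\<^sub>R x)) \<partial>lborel)"
      using FX by (subst Bochner_Integration.integral_diff[symmetric]) (auto simp: X_def Y_def algebra_simps)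
    also have "\<dots> = 2 * \<kappa> * s * mass + - slope * mass * ln t"
      using F_int F_u_dilation_integrable[of t] F_u_dilation_integrable[of "1 / t"] t dilation_identity_ln[of t]
      by (simp add: mass_def)
    also have "\<dots> = (2 * \<kappa> - slope) * (s * mass)" using t by (simp add: algebra_simps)
    finally have lin: "(\<integral>x. F x * X x \<partial>lborel) - (\<integral>x. F x * Y x \<partial>lborel) = (2 * \<kappa> - slope) * (s * mass)" .
    have rem: "\<bar>F x * X x - F x * Y x - (F x * exp (X x) - F x * exp (Y x))\<bar> \<le> 2 * (C * s)\<^sup>2 * F x" for x
    proof -
      have sq: "(X x)\<^sup>2 \<le> (C * s)\<^sup>2" "(Y x)\<^sup>2 \<le> (C * s)\<^sup>2"
        using X[of x] Y[of x] by (metis abs_ge_zero power2_abs power_mono)+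
      have "\<bar>exp (X x) - 1 - X x\<bar> \<le> (X x)\<^sup>2" "\<bar>exp (Y x) - 1 - Y x\<bar> \<le> (Y x)\<^sup>2"
        using X[of x] Y[of x] s by (auto intro!: abs_exp_remainder_le)
      then have "\<bar>(exp (Y x) - 1 - Y x) - (exp (X x) - 1 - X x)\<bar> \<le> 2 * (C * s)\<^sup>2"
        using sq by linarith
      from mult_left_mono[OF this F_nonneg[of x]]
      have "F x * \<bar>(exp (Y x) - 1 - Y x) - (exp (X x) - 1 - X x)\<bar> \<le> 2 * (C * s)\<^sup>2 * F x"
        by (simp only: mult.commute)
      moreover have "F x * X x - F x * Y x - (F x * exp (X x) - F x * exp (Y x))
          = F x * ((exp (Y x) - 1 - Y x) - (exp (X x) - 1 - X x))"
        by (simp add: algebra_simps)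
      ultimately show ?thesis using F_nonneg[of x] by (simp only: abs_mult abs_of_nonneg)
    qed
    have "\<bar>(2 * \<kappa> - slope) * (s * mass)\<bar>
       = \<bar>\<integral>x. F x * X x - F x * Y x - (F x * exp (X x) - F x * exp (Y x)) \<partial>lborel\<bar>"
      using FX FeX eq lin by simp
    also have "\<dots> \<le> (\<integral>x. 2 * (C * s)\<^sup>2 * F x \<partial>lborel)"
      using FX FeX F_int rem by (intro order_trans[OF integral_abs_bound integral_mono]) auto
    also have "\<dots> = 2 * (C * s)\<^sup>2 * mass" by (simp add: mass_def)
    finally have "\<bar>2 * \<kappa> - slope\<bar> * (s * mass) \<le> (2 * C\<^sup>2 * s) * (s * mass)"
      using s mass_pos by (simp add: abs_mult power2_eq_square mult_ac)
    then show ?thesis using s mass_pos by simp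
  qed
  define d where "d = \<bar>2 * \<kappa> - slope\<bar>"
  have d: "0 < d" using ne by (auto simp: d_def \<kappa>_def)
  \<comment> \<open>The last entry makes the bound \<open>2 * C\<^sup>2 * s\<close> at most
    \<open>d / 2\<close>; the others meet the conditions of \<open>main\<close>.\<close>
  define s where "s = min (min (1 / 2) (1 / C)) (d / (4 * C\<^sup>2))"
  have "0 < s" "s \<le> 1 / 2" "s \<le> 1 / C" "s \<le> d / (4 * C\<^sup>2)" using d C by (auto simp: s_def)
  then have "d \<le> 2 * C\<^sup>2 * s" using C unfolding d_def by (intro main) (auto simp: field_simps)
  also have "\<dots> \<le> 2 * C\<^sup>2 * (d / (4 * C\<^sup>2))"
    using \<open>s \<le> d / (4 * C\<^sup>2)\<close> by (intro mult_left_mono) auto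
  also have "\<dots> = d / 2" using C by simp
  finally show False using d by simp
qed

end

subsection \<open>Kelvin transform\<close>

lemma AE_lborel_norm_neq: "0 < r \<Longrightarrow> AE y in lborel. norm (y :: real^4) \<noteq> r"
proof -
  have "sphere (0::real^4) r \<in> null_sets lborel"
    using negligible_sphere[of "0::real^4" r] by (auto simp: null_sets_completion_iff negligible_iff_null_sets)
  then have "AE y in lborel. y \<notin> sphere (0::real^4) r" by (rule AE_not_in)
  then show ?thesis by eventually_elim auto
qed

lemma
  fixes f :: "real^4 \<Rightarrow> real"
  assumes l: "0 < l" and f: "integrable lborel f"
  shows integrable_ball_part: "integrable lborel (\<lambda>y. indicator (ball 0 l) y * f y)"
    and integrable_inverted_part: "integrable lborel (\<lambda>y. indicator (ball 0 l) y * ((l / norm y) ^ 8 * f (inversion l y)))"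
    and integral_split_inversion: "(\<integral>y. f y \<partial>lborel) = (\<integral>y. indicator (ball 0 l) y * f y \<partial>lborel)
      + (\<integral>y. indicator (ball 0 l) y * ((l / norm y) ^ 8 * f (inversion l y)) \<partial>lborel)"
proof -
  have [measurable]: "f \<in> borel_measurable borel" using f by auto
  let ?B = "ball 0 l :: (real^4) set"
  define g where "g y = indicator (- ?B) y * f y" for y
  have [measurable]: "g \<in> borel_measurable borel" unfolding g_def[abs_def] by measurable
  show i1: "integrable lborel (\<lambda>y. indicator ?B y * f y)"
    by (rule Bochner_Integration.integrable_bound[OF f]) (auto simp: indicator_def)
  have i2: "integrable lborel g"
    unfolding g_def by (rule Bochner_Integration.integrable_bound[OF f]) (auto simp: indicator_def)
  have AE: "AE y in lborel. (l / norm y) ^ 8 * g (inversion l y)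
      = indicator ?B y * ((l / norm y) ^ 8 * f (inversion l y))"
    using AE_lborel_norm_neq[OF l]
  proof eventually_elim
    case (elim y)
    \<comment> \<open>The origin is the odd case, being fixed by \<open>inversion\<close>. It is
      harmless because the weight \<open>(l / norm y) ^ 8\<close> is 0 there.\<close>
    have "inversion l y \<in> ?B \<longleftrightarrow> norm y > l \<or> y = 0"
      using l by (cases "y = 0") (auto simp: norm_inversion power2_eq_square field_simps)
    then show ?case using elim by (auto simp: g_def indicator_def)
  qed
  have i3: "integrable lborel (\<lambda>y. (l / norm y) ^ 8 * g (inversion l y))"
    using i2 by (subst (asm) integrable_inversion_iff[OF l]) auto
  then show "integrable lborel (\<lambda>y. indicator ?B y * ((l / norm y) ^ 8 * f (inversion l y)))"
    by (rule integrable_cong_AE_imp) (use AE in auto)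
  have "(\<integral>y. f y \<partial>lborel) = (\<integral>y. indicator ?B y * f y + g y \<partial>lborel)"
    by (intro Bochner_Integration.integral_cong) (auto simp: g_def indicator_def)
  also have "\<dots> = (\<integral>y. indicator ?B y * f y \<partial>lborel) + (\<integral>y. g y \<partial>lborel)"
    by (rule Bochner_Integration.integral_add[OF i1 i2])
  also have "(\<integral>y. g y \<partial>lborel) = (\<integral>y. (l / norm y) ^ 8 * g (inversion l y) \<partial>lborel)"
    by (rule integral_inversion[OF l]) measurable
  also have "\<dots> = (\<integral>y. indicator ?B y * ((l / norm y) ^ 8 * f (inversion l y)) \<partial>lborel)"
    by (rule integral_cong_AE) (use AE in auto)
  finally show "(\<integral>y. f y \<partial>lborel) = (\<integral>y. indicator ?B y * f y \<partial>lborel)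
      + (\<integral>y. indicator ?B y * ((l / norm y) ^ 8 * f (inversion l y)) \<partial>lborel)" .
qed

text \<open>For distinct points of the ball with \<open>y \<noteq> 0\<close> this is the logarithm
  of \<open>norm y / l * norm (x - inversion l y) / norm (x - y)\<close>; for a disc in the plane
  this is the shape of the Dirichlet Green function. Writing it with the gap makes it symmetric,
  meaningful at \<open>y = 0\<close> and visibly positive.\<close>

definition log_green :: "real \<Rightarrow> real^4 \<Rightarrow> real^4 \<Rightarrow> real" where
  "log_green l x y = ln (1 + reflection_gap l x y / (norm (x - y))\<^sup>2) / 2"

text \<open>The Riesz analogue: the kernel minus its image under reflection of \<open>y\<close>, the
  latter weighted by \<open>(l / norm y) powr \<alpha>\<close>.\<close>

definition riesz_green :: "real \<Rightarrow> real \<Rightarrow> real^4 \<Rightarrow> real^4 \<Rightarrow> real" where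
  "riesz_green \<alpha> l x y = norm (x - y) powr (-\<alpha>) - ((norm (x - y))\<^sup>2 + reflection_gap l x y) powr (-\<alpha> / 2)"

lemma reflection_gap_measurable [measurable]: "reflection_gap l (x::real^4) \<in> borel_measurable borel"
  unfolding reflection_gap_def[abs_def] by measurable

lemma log_green_measurable [measurable]: "log_green l x \<in> borel_measurable borel"
  unfolding log_green_def[abs_def] by measurable

lemma riesz_green_measurable [measurable]: "riesz_green \<alpha> l x \<in> borel_measurable borel"
  unfolding riesz_green_def[abs_def] by measurable

lemma log_green_pos:
  assumes "norm x < l" "norm y < l" "x \<noteq> y"
  shows "0 < log_green l x y"
proof -
  have "0 < reflection_gap l x y / (norm (x - y))\<^sup>2"
    using assms by (intro divide_pos_pos reflection_gap_pos) auto
  then show ?thesis by (simp add: log_green_def)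
qed

lemma log_green_nonneg: "norm x < l \<Longrightarrow> norm y < l \<Longrightarrow> 0 \<le> log_green l x y"
  using log_green_pos[of x l y] by (cases "x = y") (auto simp: log_green_def)

lemma reflection_gap_le:
  assumes "norm x < l" "norm y < l"
  shows "reflection_gap l x y \<le> l\<^sup>2"
proof -
  have l: "0 < l" using assms(1) norm_ge_zero[of x] by linarith
  have "(norm x)\<^sup>2 \<le> l\<^sup>2" "(norm y)\<^sup>2 \<le> l\<^sup>2" using assms by (auto intro!: power_mono)
  then have "(l\<^sup>2 - (norm x)\<^sup>2) * (l\<^sup>2 - (norm y)\<^sup>2) \<le> l\<^sup>2 * l\<^sup>2"
    by (intro mult_mono) auto
  then show ?thesis using l by (simp add: reflection_gap_def divide_le_eq)
qed

text \<open>The gap is at most \<open>l\<^sup>2\<close>, and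
  \<open>1 + s\<^sup>2 \<le> (1 + s)\<^sup>2\<close> with \<open>s = l / norm (x - y)\<close> halves
  the logarithm. The constant depends on \<open>x\<close> and \<open>y\<close> only through the
  kernel.\<close>

lemma log_green_le:
  assumes "norm x < l" "norm y < l"
  shows "log_green l x y \<le> l * norm (x - y) powr (-1)"
proof (cases "x = y")
  case False
  define s where "s = l / norm (x - y)"
  have l: "0 < l" using assms(1) norm_ge_zero[of x] by linarith
  have s: "0 < s" using False l by (simp add: s_def)
  have "reflection_gap l x y / (norm (x - y))\<^sup>2 \<le> l\<^sup>2 / (norm (x - y))\<^sup>2"
    using reflection_gap_le[OF assms] by (intro divide_right_mono) auto
  also have "\<dots> = s\<^sup>2" by (simp add: s_def power_divide)
  finally have "reflection_gap l x y / (norm (x - y))\<^sup>2 \<le> s\<^sup>2" .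
  moreover have "(1 + s)\<^sup>2 = 1 + 2 * s + s\<^sup>2" by (simp add: power2_sum)
  ultimately have "1 + reflection_gap l x y / (norm (x - y))\<^sup>2 \<le> (1 + s)\<^sup>2"
    using s by linarith
  moreover have "0 \<le> reflection_gap l x y / (norm (x - y))\<^sup>2"
    using reflection_gap_pos[OF assms] by (intro divide_nonneg_nonneg) auto
  then have "0 < 1 + reflection_gap l x y / (norm (x - y))\<^sup>2" by linarith
  ultimately have "ln (1 + reflection_gap l x y / (norm (x - y))\<^sup>2) \<le> ln ((1 + s)\<^sup>2)"
    by (intro ln_mono)
  also have "\<dots> = 2 * ln (1 + s)" using s by (simp add: ln_realpow)
  finally have "log_green l x y \<le> s"
    using s ln_add_one_self_le_self[of s] by (simp add: log_green_def)
  also have "s = l * norm (x - y) powr (-1)" by (simp add: s_def)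
  finally show ?thesis .
qed (simp add: log_green_def)

lemma riesz_green_le: "riesz_green \<alpha> l x y \<le> norm (x - y) powr (-\<alpha>)"
  by (simp add: riesz_green_def)

lemma norm_powr_eq: "(norm z)\<^sup>2 powr (a / 2) = norm z powr a"
proof (cases "z = 0")
  case False
  then have "(norm z)\<^sup>2 = norm z powr 2" by simp
  then show ?thesis using False by (simp only: powr_powr) simp
qed simp

lemma riesz_green_nonneg:
  assumes "norm x < l" "norm y < l" "x \<noteq> y" "0 \<le> \<alpha>"
  shows "0 \<le> riesz_green \<alpha> l x y"
proof -
  have "((norm (x - y))\<^sup>2 + reflection_gap l x y) powr (-\<alpha> / 2) \<le> (norm (x - y))\<^sup>2 powr (-\<alpha> / 2)"
    using assms reflection_gap_pos[OF assms(1,2)] by (intro powr_mono2') auto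
  then show ?thesis using norm_powr_eq[of "x - y" "-\<alpha>"] by (simp add: riesz_green_def)
qed

lemma sqrt_gap_eq:
  assumes "x \<noteq> (y::real^4)" "norm x < l" "norm y < l"
  shows "ln (sqrt ((norm (x - y))\<^sup>2 + reflection_gap l x y)) = ln (norm (x - y)) + log_green l x y"
proof -
  define n where "n = norm (x - y)"
  have n: "0 < n" using assms by (simp add: n_def)
  have g: "0 < reflection_gap l x y" by (rule reflection_gap_pos[OF assms(2,3)])
  have "n\<^sup>2 + reflection_gap l x y = n\<^sup>2 * (1 + reflection_gap l x y / n\<^sup>2)"
    using n by (simp add: distrib_left)
  then have "ln (n\<^sup>2 + reflection_gap l x y) = ln (n\<^sup>2) + ln (1 + reflection_gap l x y / n\<^sup>2)"
    using n g by (simp only:) (intro ln_mult_pos; simp add: add_pos_nonneg)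
  moreover have "ln (n\<^sup>2) = 2 * ln n" using n by (simp add: ln_realpow)
  ultimately show ?thesis using n g unfolding n_def[symmetric] log_green_def
    by (simp add: ln_sqrt add_pos_pos)
qed

text \<open>Both differences contain the same term \<open>ln (l / norm x)\<close>, while the Green
  term changes sign across the sphere. Integrated against \<open>F\<close>, the common term yields
  the mass times \<open>ln (l / norm x)\<close>, which becomes the weight of the Kelvin
  transform.\<close>

lemma ln_green_identities:
  fixes x y :: "real^4"
  assumes "x \<noteq> y" "x \<noteq> 0" "y \<noteq> 0" "norm x < l" "norm y < l"
  shows "ln (norm (inversion l x - y)) - ln (norm (x - y)) = ln (l / norm x) + log_green l x y"
    and "ln (norm (inversion l x - inversion l y)) - ln (norm (x - inversion l y)) = ln (l / norm x) - log_green l x y"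
proof -
  have l: "0 < l" using assms(4) norm_ge_zero[of x] by linarith
  let ?s = "sqrt ((norm (x - y))\<^sup>2 + reflection_gap l x y)"
  have s: "0 < ?s" using reflection_gap_pos[OF assms(4,5)] by (simp add: add_nonneg_pos)
  have pos: "0 < norm x" "0 < norm y" "0 < norm (x - y)" using assms by auto
  have "norm (inversion l x - y) = l / norm x * ?s"
    using norm_diff_inversion[of x l y] assms l
    by (simp add: norm_minus_commute reflection_gap_commute[of l y x])
  then have "ln (norm (inversion l x - y)) = ln (l / norm x) + ln ?s"
    using pos l s by (simp only:) (intro ln_mult_pos; simp)
  then show "ln (norm (inversion l x - y)) - ln (norm (x - y)) = ln (l / norm x) + log_green l x y"
    using sqrt_gap_eq[OF assms(1,4,5)] by simp
  have "ln (norm (x - inversion l y)) = ln (l / norm y) + ln ?s"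
    unfolding norm_diff_inversion[OF assms(3) l] using pos l s by (intro ln_mult_pos; simp)
  moreover have "norm (inversion l x - inversion l y) = (l / norm x) * ((l / norm y) * norm (x - y))"
    using norm_inversion_diff[OF assms(2,3), of l] by (simp add: power2_eq_square)
  then have "ln (norm (inversion l x - inversion l y)) = ln (l / norm x) + (ln (l / norm y) + ln (norm (x - y)))"
    using pos l by (simp only: ln_mult_pos mult_pos_pos divide_pos_pos)
  ultimately show "ln (norm (inversion l x - inversion l y)) - ln (norm (x - inversion l y)) = ln (l / norm x) - log_green l x y"
    using sqrt_gap_eq[OF assms(1,4,5)] by simp
qed

text \<open>With the conformal weights \<open>\<alpha>\<close> attached to \<open>x\<close> and
  \<open>y\<close>, reflecting both points restores the kernel and reflecting one of them gives the
  gap term. Hence the antisymmetry across the sphere.\<close>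

lemma riesz_green_identities:
  fixes x y :: "real^4"
  assumes "x \<noteq> 0" "y \<noteq> 0" "norm x < l" "norm y < l"
  shows "norm (x - y) powr (-\<alpha>) - (l / norm x) powr \<alpha> * norm (inversion l x - y) powr (-\<alpha>) = riesz_green \<alpha> l x y"
    and "(l / norm y) powr \<alpha> * (norm (x - inversion l y) powr (-\<alpha>) - (l / norm x) powr \<alpha> * norm (inversion l x - inversion l y) powr (-\<alpha>))
       = - riesz_green \<alpha> l x y"
proof -
  have l: "0 < l" using assms(3) norm_ge_zero[of x] by linarith
  let ?g = "(norm (x - y))\<^sup>2 + reflection_gap l x y"
  have g: "0 < ?g" using reflection_gap_pos[OF assms(3,4)] by (simp add: add_nonneg_pos)
  have pos: "0 < l / norm x" "0 < l / norm y" using assms l by auto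
  have sg: "sqrt ?g powr (-\<alpha>) = ?g powr (-\<alpha> / 2)"
    using g by (simp add: powr_half_sqrt[symmetric] powr_powr)
  have cancel: "c powr \<alpha> * (c * s) powr (-\<alpha>) = s powr (-\<alpha>)" if "0 < c" "0 \<le> s" for c s :: real
    using that by (simp add: powr_mult powr_minus)
  have "norm (inversion l x - y) = l / norm x * sqrt ?g"
    using norm_diff_inversion[of x l y] assms l
    by (simp add: norm_minus_commute reflection_gap_commute[of l y x])
  then have "(l / norm x) powr \<alpha> * norm (inversion l x - y) powr (-\<alpha>) = ?g powr (-\<alpha> / 2)"
    using cancel[OF pos(1), of "sqrt ?g"] g sg by simp
  then show "norm (x - y) powr (-\<alpha>) - (l / norm x) powr \<alpha> * norm (inversion l x - y) powr (-\<alpha>) = riesz_green \<alpha> l x y"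
    by (simp add: riesz_green_def)
  have 1: "(l / norm y) powr \<alpha> * norm (x - inversion l y) powr (-\<alpha>) = ?g powr (-\<alpha> / 2)"
    using cancel[OF pos(2), of "sqrt ?g"] g sg by (simp add: norm_diff_inversion[OF assms(2) l])
  have "norm (inversion l x - inversion l y) = (l / norm x) * ((l / norm y) * norm (x - y))"
    using norm_inversion_diff[OF assms(1,2), of l] by (simp add: power2_eq_square)
  then have "(l / norm y) powr \<alpha> * ((l / norm x) powr \<alpha> * norm (inversion l x - inversion l y) powr (-\<alpha>)) = norm (x - y) powr (-\<alpha>)"
    using cancel[OF pos(1), of "(l / norm y) * norm (x - y)"] cancel[OF pos(2), of "norm (x - y)"] l by (simp only:) simp
  with 1 show "(l / norm y) powr \<alpha> * (norm (x - inversion l y) powr (-\<alpha>) - (l / norm x) powr \<alpha> * norm (inversion l x - inversion l y) powr (-\<alpha>))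
       = - riesz_green \<alpha> l x y"
    by (simp add: riesz_green_def right_diff_distrib)
qed

context choquard_solution
begin

text \<open>By \<open>slope_eq\<close> the term \<open>(8 - \<alpha>) * ln (real n)\<close> turns
  the kernel into \<open>ln (real n) - ln (norm (real n *\<^sub>R e - y))\<close>, which tends to 0
  for fixed \<open>y\<close>. Away from \<open>real n *\<^sub>R e\<close> it has the integrable
  majorant \<open>(ln 2 + ln (1 + norm y)) * F y\<close>; near that point, where no such majorant is
  at hand, the decay of \<open>F\<close> takes over.\<close>

lemma u_asymptotic:
  assumes e: "norm e = 1"
  shows "(\<lambda>n. u (real n *\<^sub>R e) + (8 - \<alpha>) * ln (real n)) \<longlonglongrightarrow> c0"
proof -
  define c where "c = 1 / (8 * pi\<^sup>2)"
  define D where "D n y = (ln (real n) - ln (norm (real n *\<^sub>R e - y))) * F y" for n y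
  define A where "A n y = (if 0 < n \<and> real n / 2 \<le> norm (real n *\<^sub>R e - y) then D n y else 0)" for n y
  define B where "B n y = (if 0 < n \<and> real n / 2 \<le> norm (real n *\<^sub>R e - y) then 0 else D n y)" for n y
  have [measurable]: "D n \<in> borel_measurable borel" "A n \<in> borel_measurable borel" "B n \<in> borel_measurable borel" for n
    unfolding D_def[abs_def] A_def[abs_def] B_def[abs_def] by measurable
  have D_int: "integrable lborel (D n)" for n
    unfolding D_def[abs_def] left_diff_distrib using F_int lnF_int[of "real n *\<^sub>R e"] by simp
  have A_int: "integrable lborel (A n)" for n
    by (rule Bochner_Integration.integrable_bound[OF D_int[of n]]) (auto simp: A_def)
  have B_int: "integrable lborel (B n)" for n
    by (rule Bochner_Integration.integrable_bound[OF D_int[of n]]) (auto simp: B_def)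
  have u: "u (real n *\<^sub>R e) + (8 - \<alpha>) * ln (real n) = c * ((\<integral>y. A n y \<partial>lborel) + (\<integral>y. B n y \<partial>lborel)) + c0" for n
  proof -
    have "(\<integral>y. A n y \<partial>lborel) + (\<integral>y. B n y \<partial>lborel) = (\<integral>y. A n y + B n y \<partial>lborel)"
      using A_int B_int by simp
    also have "\<dots> = (\<integral>y. D n y \<partial>lborel)"
      by (intro Bochner_Integration.integral_cong) (auto simp: A_def B_def)
    also have "\<dots> = (\<integral>y. ln (real n) * F y - ln (norm (real n *\<^sub>R e - y)) * F y \<partial>lborel)"
      by (simp add: D_def left_diff_distrib)
    also have "\<dots> = ln (real n) * mass - (\<integral>y. ln (norm (real n *\<^sub>R e - y)) * F y \<partial>lborel)"
      using F_int lnF_int[of "real n *\<^sub>R e"] by (simp add: mass_def)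
    finally have "c * ((\<integral>y. A n y \<partial>lborel) + (\<integral>y. B n y \<partial>lborel))
       = c * mass * ln (real n) - c * (\<integral>y. ln (norm (real n *\<^sub>R e - y)) * F y \<partial>lborel)"
      by (simp add: right_diff_distrib)
    moreover have "c * mass = 8 - \<alpha>" using slope_eq by (simp add: slope_def c_def)
    moreover have "u (real n *\<^sub>R e) = - c * (\<integral>y. ln (norm (real n *\<^sub>R e - y)) * F y \<partial>lborel) + c0"
      unfolding c_def by (rule u_eq)
    ultimately show ?thesis by simp
  qed
  have limA: "(\<lambda>n. \<integral>y. A n y \<partial>lborel) \<longlonglongrightarrow> (\<integral>y. 0 \<partial>(lborel::(real^4) measure))"
  proof (rule integral_dominated_convergence[where w = "\<lambda>y. ln 2 * F y + ln (1 + norm y) * F y"])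
    show "integrable lborel (\<lambda>y. ln 2 * F y + ln (1 + norm y) * F y)"
      using F_int ln_growth_integrable by simp
    show "AE y in lborel. (\<lambda>n. A n y) \<longlonglongrightarrow> 0"
    proof (intro AE_I2)
      fix y :: "real^4"
      have 1: "(\<lambda>n. norm (e - (1 / real n) *\<^sub>R y)) \<longlonglongrightarrow> norm (e - 0 *\<^sub>R y)"
        by (intro tendsto_intros lim_1_over_n)
      then have "(\<lambda>n. - ln (norm (e - (1 / real n) *\<^sub>R y)) * F y) \<longlonglongrightarrow> - ln (norm (e - 0 *\<^sub>R y)) * F y"
        using e by (intro tendsto_intros) auto
      then have 2: "(\<lambda>n. - ln (norm (e - (1 / real n) *\<^sub>R y)) * F y) \<longlonglongrightarrow> 0" using e by simp
      have "eventually (\<lambda>n. 1 / 2 < norm (e - (1 / real n) *\<^sub>R y)) sequentially"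
        using 1 e by (intro order_tendstoD(1)[OF 1]) simp
      then have "eventually (\<lambda>n. - ln (norm (e - (1 / real n) *\<^sub>R y)) * F y = A n y) sequentially"
        using eventually_gt_at_top[of 0]
      proof eventually_elim
        case (elim n)
        have "real n *\<^sub>R e - y = real n *\<^sub>R (e - (1 / real n) *\<^sub>R y)" using elim by (simp add: scaleR_diff_right)
        then have n: "norm (real n *\<^sub>R e - y) = real n * norm (e - (1 / real n) *\<^sub>R y)" by simp
        have pos: "0 < norm (e - (1 / real n) *\<^sub>R y)" using elim by linarith
        have "ln (real n * norm (e - (1 / real n) *\<^sub>R y)) = ln (real n) + ln (norm (e - (1 / real n) *\<^sub>R y))"
          using elim pos by (intro ln_mult_pos) auto
        moreover have "real n / 2 \<le> norm (real n *\<^sub>R e - y)" unfolding n using elim by simp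
        ultimately show ?case using elim by (simp add: A_def D_def n)
      qed
      with 2 show "(\<lambda>n. A n y) \<longlonglongrightarrow> 0" by (rule Lim_transform_eventually)
    qed
    show "AE y in lborel. norm (A n y) \<le> ln 2 * F y + ln (1 + norm y) * F y" for n
    proof (intro AE_I2)
      fix y :: "real^4"
      have nn: "0 \<le> ln 2 + ln (1 + norm y)" by (auto intro!: add_nonneg_nonneg simp: ln_ge_zero_iff add_pos_nonneg)
      show "norm (A n y) \<le> ln 2 * F y + ln (1 + norm y) * F y"
      proof (cases "0 < n \<and> real n / 2 \<le> norm (real n *\<^sub>R e - y)")
        case True
        then have n: "1 \<le> real n" "real n / 2 \<le> norm (real n *\<^sub>R e - y)" by auto
        have "ln (real n / 2) \<le> ln (norm (real n *\<^sub>R e - y))"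
          using n by (subst ln_le_cancel_iff; linarith)
        then have a: "ln (real n) - ln (norm (real n *\<^sub>R e - y)) \<le> ln 2"
          using n by (subst (asm) ln_divide_pos) auto
        have "norm (real n *\<^sub>R e - y) \<le> real n + norm y"
          using norm_triangle_ineq4[of "real n *\<^sub>R e" y] e by simp
        also have "\<dots> \<le> real n * (1 + norm y)"
          using n mult_right_mono[of 1 "real n" "norm y"] by (simp add: distrib_left)
        finally have "norm (real n *\<^sub>R e - y) \<le> real n * (1 + norm y)" .
        moreover have "0 < norm (real n *\<^sub>R e - y)" using n by linarith
        ultimately have "ln (norm (real n *\<^sub>R e - y)) \<le> ln (real n * (1 + norm y))"
          by (intro ln_mono) auto
        also have "\<dots> = ln (real n) + ln (1 + norm y)"
          using n by (intro ln_mult_pos) (auto intro: add_pos_nonneg)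
        finally have b: "ln (norm (real n *\<^sub>R e - y)) - ln (real n) \<le> ln (1 + norm y)" by simp
        have "0 \<le> ln (1 + norm y)" "0 \<le> ln (2::real)" by (auto simp: ln_ge_zero_iff add_pos_nonneg)
        then have "\<bar>ln (real n) - ln (norm (real n *\<^sub>R e - y))\<bar> \<le> ln 2 + ln (1 + norm y)"
          using a b by linarith
        from mult_right_mono[OF this F_nonneg[of y]] show ?thesis
          using True F_nonneg[of y] by (simp add: A_def D_def abs_mult distrib_right)
      next
        case False
        then have "A n y = 0" by (auto simp: A_def)
        then show ?thesis using mult_right_mono[OF nn F_nonneg[of y]] by (simp add: distrib_right)
      qed
    qed
  qed auto
  \<comment> \<open>Strictly between 4 and \<open>slope = 8 - \<alpha>\<close>, a gap that exists
    because \<open>\<alpha> < 4\<close>: below the slope \<open>exp u\<close> decays at this rate,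
    above 4 the remainder \<open>r powr (4 - \<gamma>)\<close> vanishes.\<close>
  define \<gamma> where "\<gamma> = (4 + slope) / 2"
  have \<gamma>: "4 < \<gamma>" "\<gamma> < slope" using \<alpha> by (auto simp: \<gamma>_def slope_eq)
  obtain K where K: "0 < K" "\<And>x. 1 \<le> norm x \<Longrightarrow> exp (u x) \<le> K * norm x powr (-\<gamma>)"
    using exp_u_decay[OF \<gamma>(2)] by blast
  obtain M where M: "0 < M" "\<And>x. V x \<le> M" by (rule F_bounded) blast
  define C where "C = 2 * (M * K) * (2 * pi\<^sup>2 / 3)"
  have B_bound: "norm (\<integral>y. B n y \<partial>lborel) \<le> C * (real n / 2) powr (4 - \<gamma>)" if n: "2 \<le> n" for n
  proof -
    define z where "z = real n *\<^sub>R e"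
    define r where "r = real n / 2"
    have r: "1 \<le> r" "norm z = 2 * r" using n e by (auto simp: r_def z_def)
    have k: "has_bochner_integral lborel (\<lambda>y. norm (z - y) powr (-1) * indicator (ball z r) y) (2 * pi\<^sup>2 / (4 - 1) * r powr (4 - 1))"
      using r by (intro power_kernel_ball) auto
    have k': "has_bochner_integral lborel (\<lambda>y. (2 * r * (M * (K * r powr (-\<gamma>)))) * (norm (z - y) powr (-1) * indicator (ball z r) y))
        ((2 * r * (M * (K * r powr (-\<gamma>)))) * (2 * pi\<^sup>2 / (4 - 1) * r powr (4 - 1)))"
      by (rule has_bochner_integral_mult_right) (rule k)
    have "\<bar>\<integral>y. B n y \<partial>lborel\<bar> \<le> (\<integral>y. (2 * r * (M * (K * r powr (-\<gamma>)))) * (norm (z - y) powr (-1) * indicator (ball z r) y) \<partial>lborel)"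
    proof (rule order_trans[OF integral_abs_bound integral_mono_AE])
      show "AE y in lborel. \<bar>B n y\<bar> \<le> (2 * r * (M * (K * r powr (-\<gamma>)))) * (norm (z - y) powr (-1) * indicator (ball z r) y)"
        using AE_lborel_neq[of z]
      proof eventually_elim
        case (elim y)
        show ?case
        proof (cases "norm (z - y) < r")
          case True
          have p: "0 < norm (z - y)" using elim by simp
          have "norm z \<le> norm y + norm (z - y)" using norm_triangle_ineq[of y "z - y"] by simp
          then have y: "r \<le> norm y" using True r by linarith
          have "exp (u y) \<le> K * norm y powr (-\<gamma>)" using y r by (intro K) auto
          also have "\<dots> \<le> K * r powr (-\<gamma>)" using K y r \<gamma> by (intro mult_left_mono powr_mono2') auto
          finally have F: "F y \<le> M * (K * r powr (-\<gamma>))"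
            unfolding source_def using M V_nonneg by (intro mult_mono) auto
          have "real n = 2 * r" by (simp add: r_def)
          then have "ln (real n) - ln (norm (z - y)) = ln (2 * r / norm (z - y))"
            using p r by (simp add: ln_divide_pos)
          moreover have "\<dots> \<le> 2 * r / norm (z - y)"
            using p r ln_le_minus_one[of "2 * r / norm (z - y)"] by simp
          moreover have "0 \<le> ln (2 * r / norm (z - y))"
            using p r True by (intro ln_ge_zero) (simp add: le_divide_eq)
          ultimately have "\<bar>(ln (real n) - ln (norm (z - y))) * F y\<bar> \<le> 2 * r / norm (z - y) * (M * (K * r powr (-\<gamma>)))"
            using F F_nonneg[of y] p r unfolding abs_mult by (intro mult_mono) auto
          then show ?thesis using True p n by (simp add: B_def D_def z_def[symmetric] r_def[symmetric] powr_minus field_simps dist_norm)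
        next
          case False
          then show ?thesis using n by (simp add: B_def z_def r_def not_less dist_norm)
        qed
      qed
    qed (use B_int k' in \<open>auto simp: has_bochner_integral_iff\<close>)
    also have "\<dots> = (2 * r * (M * (K * r powr (-\<gamma>)))) * (2 * pi\<^sup>2 / (4 - 1) * r powr (4 - 1))"
      by (rule has_bochner_integral_integral_eq[OF k'])
    also have "\<dots> = C * (r * r powr (-\<gamma>) * r powr 3)"
      by (simp add: C_def)
    also have "r * r powr (-\<gamma>) * r powr 3 = r powr (4 - \<gamma>)"
    proof -
      have "r powr (4 - \<gamma>) = r powr 1 * r powr (-\<gamma>) * r powr 3"
        unfolding powr_add[symmetric] by simp
      then show ?thesis using r by simp
    qed
    finally show ?thesis by (simp add: r_def)
  qed
  have limB: "(\<lambda>n. \<integral>y. B n y \<partial>lborel) \<longlonglongrightarrow> 0"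
  proof (rule Lim_null_comparison)
    show "eventually (\<lambda>n. norm (\<integral>y. B n y \<partial>lborel) \<le> C * (real n / 2) powr (4 - \<gamma>)) sequentially"
      using eventually_ge_at_top[of 2] by eventually_elim (rule B_bound)
    have "filterlim (\<lambda>n. real n / 2) at_top sequentially"
      using filterlim_tendsto_pos_mult_at_top[OF tendsto_const, of "1/2" real] filterlim_real_sequentially by simp
    then have "(\<lambda>n. (real n / 2) powr (4 - \<gamma>)) \<longlonglongrightarrow> 0"
      using \<gamma> by (intro tendsto_neg_powr) auto
    from tendsto_mult_right_zero[OF this, of C]
    show "(\<lambda>n. C * (real n / 2) powr (4 - \<gamma>)) \<longlonglongrightarrow> 0" .
  qed
  have "(\<lambda>n. c * ((\<integral>y. A n y \<partial>lborel) + (\<integral>y. B n y \<partial>lborel)) + c0) \<longlonglongrightarrow> c * (0 + 0) + c0"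
    using limA limB by (intro tendsto_intros) simp_all
  then show ?thesis unfolding u by simp
qed

definition kelvin :: "real \<Rightarrow> real^4 \<Rightarrow> real" where
  "kelvin l x = u (inversion l x) + (8 - \<alpha>) * ln (l / norm x)"

definition kelvin_V :: "real \<Rightarrow> real^4 \<Rightarrow> real" where
  "kelvin_V l x = (l / norm x) powr \<alpha> * V (inversion l x)"

lemma kelvin_measurable [measurable]: "kelvin l \<in> borel_measurable borel"
  unfolding kelvin_def[abs_def] by measurable

lemma exp_kelvin:
  "0 < l \<Longrightarrow> x \<noteq> 0 \<Longrightarrow> exp (kelvin l x) = (l / norm x) powr (8 - \<alpha>) * exp (u (inversion l x))"
  by (simp add: kelvin_def exp_add powr_def)

text \<open>The weights \<open>\<alpha>\<close> of \<open>V\<close> and \<open>8 - \<alpha>\<close>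
  of \<open>exp u\<close> add up to the exponent of the Jacobian, so the source is transported as a
  measure.\<close>

lemma kelvin_F:
  assumes "0 < l" "x \<noteq> 0"
  shows "(l / norm x) ^ 8 * F (inversion l x) = kelvin_V l x * exp (kelvin l x)"
proof -
  have p: "0 < l / norm x" using assms by simp
  have "(l / norm x) ^ 8 = (l / norm x) powr \<alpha> * (l / norm x) powr (8 - \<alpha>)"
    unfolding powr_add[symmetric] using p by simp
  then show ?thesis
    by (simp add: kelvin_V_def exp_kelvin[OF assms] source_def)
qed

text \<open>Subtracting \<open>ln (l / norm x) * F y\<close> before folding leaves only Green terms
  of opposite sign. The integral of the subtracted part is \<open>ln (l / norm x) * mass\<close>,
  which equals the weight in \<open>kelvin\<close> only because the slope is
  \<open>8 - \<alpha>\<close>.\<close>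

lemma
  fixes x :: "real^4"
  assumes x: "x \<noteq> 0" "norm x < l"
  defines "B \<equiv> indicator (ball (0::real^4) l) :: real^4 \<Rightarrow> real"
  shows log_green_F_integrable: "integrable lborel (\<lambda>y. B y * (log_green l x y * F y))"
    and log_green_kelvin_F_integrable: "integrable lborel (\<lambda>y. B y * (log_green l x y * ((l / norm y) ^ 8 * F (inversion l y))))"
    and u_minus_kelvin: "u x - kelvin l x = 1 / (8 * pi\<^sup>2) *
       ((\<integral>y. B y * (log_green l x y * F y) \<partial>lborel)
        - (\<integral>y. B y * (log_green l x y * ((l / norm y) ^ 8 * F (inversion l y))) \<partial>lborel))"
proof -
  define c where "c = 1 / (8 * pi\<^sup>2)"
  have l: "0 < l" using x(2) norm_ge_zero[of x] by linarith
  define h where "h y = ln (norm (inversion l x - y)) * F y - ln (norm (x - y)) * F y - ln (l / norm x) * F y" for y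
  have h: "integrable lborel h"
    unfolding h_def[abs_def] using lnF_int[of x] lnF_int[of "inversion l x"] F_int by simp
  have AE1: "AE y in lborel. B y * h y = B y * (log_green l x y * F y)"
    using AE_lborel_neq[of x] AE_lborel_neq[of 0]
  proof eventually_elim
    case (elim y)
    show ?case
    proof (cases "y \<in> ball 0 l")
      case True
      have "ln (norm (inversion l x - y)) - ln (norm (x - y)) - ln (l / norm x) = log_green l x y"
        using ln_green_identities(1)[of x y l] True elim x by simp
      then have "h y = log_green l x y * F y" unfolding h_def left_diff_distrib[symmetric] by simp
      then show ?thesis by simp
    qed (simp add: B_def)
  qed
  have AE2: "AE y in lborel. B y * ((l / norm y) ^ 8 * h (inversion l y))
      = - (B y * (log_green l x y * ((l / norm y) ^ 8 * F (inversion l y))))"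
    using AE_lborel_neq[of x] AE_lborel_neq[of 0]
  proof eventually_elim
    case (elim y)
    show ?case
    proof (cases "y \<in> ball 0 l")
      case True
      have "ln (norm (inversion l x - inversion l y)) - ln (norm (x - inversion l y)) - ln (l / norm x) = - log_green l x y"
        using ln_green_identities(2)[of x y l] True elim x by simp
      then have "h (inversion l y) = - log_green l x y * F (inversion l y)"
        unfolding h_def left_diff_distrib[symmetric] by simp
      then show ?thesis by simp
    qed (simp add: B_def)
  qed
  have [measurable]: "h \<in> borel_measurable borel" "B \<in> borel_measurable borel"
    unfolding h_def[abs_def] B_def by measurable
  note split = integrable_ball_part[OF l h, folded B_def] integrable_inverted_part[OF l h, folded B_def]
    integral_split_inversion[OF l h, folded B_def]
  show i1: "integrable lborel (\<lambda>y. B y * (log_green l x y * F y))"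
    by (rule integrable_cong_AE_imp[OF split(1)]) (use AE1 in auto)
  have i2: "integrable lborel (\<lambda>y. - (B y * (log_green l x y * ((l / norm y) ^ 8 * F (inversion l y)))))"
    by (rule integrable_cong_AE_imp[OF split(2)]) (use AE2 in auto)
  then show "integrable lborel (\<lambda>y. B y * (log_green l x y * ((l / norm y) ^ 8 * F (inversion l y))))"
    by simp
  have "(\<integral>y. h y \<partial>lborel) = (\<integral>y. B y * (log_green l x y * F y) \<partial>lborel)
      + (\<integral>y. - (B y * (log_green l x y * ((l / norm y) ^ 8 * F (inversion l y)))) \<partial>lborel)"
    unfolding split(3)
    by (intro arg_cong2[where f="(+)"] integral_cong_AE) (use AE1 AE2 in auto)
  moreover have "(\<integral>y. h y \<partial>lborel) = (\<integral>y. ln (norm (inversion l x - y)) * F y \<partial>lborel)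
      - (\<integral>y. ln (norm (x - y)) * F y \<partial>lborel) - ln (l / norm x) * mass"
    unfolding h_def using lnF_int[of x] lnF_int[of "inversion l x"] F_int by (simp add: mass_def)
  ultimately have h_eq: "(\<integral>y. ln (norm (inversion l x - y)) * F y \<partial>lborel)
      - (\<integral>y. ln (norm (x - y)) * F y \<partial>lborel) - ln (l / norm x) * mass
      = (\<integral>y. B y * (log_green l x y * F y) \<partial>lborel)
        - (\<integral>y. B y * (log_green l x y * ((l / norm y) ^ 8 * F (inversion l y))) \<partial>lborel)"
    by simp
  have "c * mass = 8 - \<alpha>" using slope_eq by (simp add: slope_def c_def)
  then have "(8 - \<alpha>) * ln (l / norm x) = c * (ln (l / norm x) * mass)" by (metis mult.assoc mult.commute)
  then have "u x - kelvin l x = c * ((\<integral>y. ln (norm (inversion l x - y)) * F y \<partial>lborel)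
      - (\<integral>y. ln (norm (x - y)) * F y \<partial>lborel) - ln (l / norm x) * mass)"
    unfolding kelvin_def u_eq[of x] u_eq[of "inversion l x"] c_def[symmetric] by (simp add: right_diff_distrib)
  then show "u x - kelvin l x = 1 / (8 * pi\<^sup>2) *
       ((\<integral>y. B y * (log_green l x y * F y) \<partial>lborel)
        - (\<integral>y. B y * (log_green l x y * ((l / norm y) ^ 8 * F (inversion l y))) \<partial>lborel))"
    unfolding h_eq c_def .
qed

text \<open>When the exterior is folded in, the Jacobian exponent 8 splits into
  \<open>8 - \<alpha>\<close>, which turns \<open>exp (u (inversion l y))\<close> into
  \<open>exp (kelvin l y)\<close>, and \<open>\<alpha>\<close>, which completes the reflected
  kernel.\<close>

lemma
  fixes x :: "real^4"
  assumes x: "x \<noteq> 0" "norm x < l"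
  defines "B \<equiv> indicator (ball (0::real^4) l) :: real^4 \<Rightarrow> real"
  shows riesz_green_integrable: "integrable lborel (\<lambda>y. B y * (riesz_green \<alpha> l x y * exp (u y)))"
    and riesz_green_kelvin_integrable: "integrable lborel (\<lambda>y. B y * (riesz_green \<alpha> l x y * exp (kelvin l y)))"
    and V_minus_kelvin: "V x - kelvin_V l x =
       (\<integral>y. B y * (riesz_green \<alpha> l x y * exp (u y)) \<partial>lborel)
        - (\<integral>y. B y * (riesz_green \<alpha> l x y * exp (kelvin l y)) \<partial>lborel)"
proof -
  have l: "0 < l" using x(2) norm_ge_zero[of x] by linarith
  define k where "k = (l / norm x) powr \<alpha>"
  define h where "h y = exp (u y) * norm (x - y) powr (-\<alpha>) - k * (exp (u y) * norm (inversion l x - y) powr (-\<alpha>))" for y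
  have h: "integrable lborel h"
    unfolding h_def[abs_def] using V_integrable[of x] V_integrable[of "inversion l x"] by simp
  have AE1: "AE y in lborel. B y * h y = B y * (riesz_green \<alpha> l x y * exp (u y))"
    using AE_lborel_neq[of 0]
  proof eventually_elim
    case (elim y)
    show ?case
    proof (cases "y \<in> ball 0 l")
      case True
      have "h y = exp (u y) * (norm (x - y) powr (-\<alpha>) - (l / norm x) powr \<alpha> * norm (inversion l x - y) powr (-\<alpha>))"
        by (simp add: h_def k_def right_diff_distrib)
      also have "\<dots> = exp (u y) * riesz_green \<alpha> l x y"
        using riesz_green_identities(1)[of x y l \<alpha>] True elim x by simp
      finally show ?thesis by simp
    qed (simp add: B_def)
  qed
  have AE2: "AE y in lborel. B y * ((l / norm y) ^ 8 * h (inversion l y))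
      = - (B y * (riesz_green \<alpha> l x y * exp (kelvin l y)))"
    using AE_lborel_neq[of 0]
  proof eventually_elim
    case (elim y)
    show ?case
    proof (cases "y \<in> ball 0 l")
      case True
      have p: "0 < l / norm y" using l elim by simp
      have "(l / norm y) ^ 8 = (l / norm y) powr (8 - \<alpha>) * (l / norm y) powr \<alpha>"
        unfolding powr_add[symmetric] using p by simp
      moreover have "P * Q * (E * a - c * (E * b)) = P * E * (Q * (a - c * b))" for P Q E a b c :: real
        by (simp add: algebra_simps)
      ultimately have "(l / norm y) ^ 8 * h (inversion l y) = (l / norm y) powr (8 - \<alpha>) * exp (u (inversion l y)) *
         ((l / norm y) powr \<alpha> * (norm (x - inversion l y) powr (-\<alpha>) - (l / norm x) powr \<alpha> * norm (inversion l x - inversion l y) powr (-\<alpha>)))"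
        unfolding h_def k_def by (simp only:)
      also have "\<dots> = exp (kelvin l y) * (- riesz_green \<alpha> l x y)"
        using riesz_green_identities(2)[of x y l \<alpha>] True elim x by (simp only: exp_kelvin[OF l elim]) simp
      finally show ?thesis by simp
    qed (simp add: B_def)
  qed
  have [measurable]: "h \<in> borel_measurable borel" "B \<in> borel_measurable borel"
    unfolding h_def[abs_def] B_def by measurable
  note split = integrable_ball_part[OF l h, folded B_def] integrable_inverted_part[OF l h, folded B_def]
    integral_split_inversion[OF l h, folded B_def]
  show "integrable lborel (\<lambda>y. B y * (riesz_green \<alpha> l x y * exp (u y)))"
    by (rule integrable_cong_AE_imp[OF split(1)]) (use AE1 in auto)
  have i2: "integrable lborel (\<lambda>y. - (B y * (riesz_green \<alpha> l x y * exp (kelvin l y))))"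
    by (rule integrable_cong_AE_imp[OF split(2)]) (use AE2 in auto)
  then show "integrable lborel (\<lambda>y. B y * (riesz_green \<alpha> l x y * exp (kelvin l y)))"
    by simp
  have "(\<integral>y. h y \<partial>lborel) = (\<integral>y. B y * (riesz_green \<alpha> l x y * exp (u y)) \<partial>lborel)
      + (\<integral>y. - (B y * (riesz_green \<alpha> l x y * exp (kelvin l y))) \<partial>lborel)"
    unfolding split(3)
    by (intro arg_cong2[where f="(+)"] integral_cong_AE) (use AE1 AE2 in auto)
  moreover have "(\<integral>y. h y \<partial>lborel) = V x - kelvin_V l x"
    unfolding h_def kelvin_V_def k_def[symmetric] riesz_def
    using V_integrable[of x] V_integrable[of "inversion l x"] by simp
  ultimately show "V x - kelvin_V l x =
       (\<integral>y. B y * (riesz_green \<alpha> l x y * exp (u y)) \<partial>lborel)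
        - (\<integral>y. B y * (riesz_green \<alpha> l x y * exp (kelvin l y)) \<partial>lborel)"
    by simp
qed

end

subsection \<open>Moving spheres\<close>

lemma measure_ball_4:
  "0 < r \<Longrightarrow> measure lborel (ball (x::real^4) r) = pi\<^sup>2 / 2 * r ^ 4"
  using content_ball[of r x] by (simp add: unit_ball_vol_numeral fact_numeral)

lemma integrable_indicator_ball [simp]:
  "integrable lborel (indicator (ball (x::'a::euclidean_space) r) :: _ \<Rightarrow> real)"
  using emeasure_lborel_ball_finite[of x r] by (simp add: integrable_indicator_iff)

text \<open>The threshold depends on neither the shape nor the position of \<open>S\<close>: first
  \<open>r\<close> makes the part near \<open>x\<close> at most \<open>\<delta> / 2\<close>, then
  the measure of \<open>S\<close> makes the rest at most \<open>\<delta> / 2\<close>.\<close>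

lemma riesz_potential_small_set:
  fixes \<delta> a :: real
  assumes a: "0 \<le> a" "a < 4" and \<delta>: "0 < \<delta>"
  obtains \<epsilon> where "0 < \<epsilon>"
    "\<And>S x. \<lbrakk>integrable lborel (indicator S :: real^4 \<Rightarrow> real); measure lborel S < \<epsilon>\<rbrakk> \<Longrightarrow>
        (\<integral>y. indicator S y * norm (x - y) powr (-a) \<partial>lborel) \<le> \<delta>"
proof -
  define \<kappa> where "\<kappa> = 2 * pi\<^sup>2 / (4 - a)"
  have \<kappa>: "0 < \<kappa>" using a by (simp add: \<kappa>_def)
  define r where "r = (\<delta> / (2 * \<kappa>)) powr (1 / (4 - a))"
  have r: "0 < r" using \<delta> \<kappa> by (simp add: r_def)
  have r': "\<kappa> * r powr (4 - a) = \<delta> / 2"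
    using a \<delta> \<kappa> by (simp add: r_def powr_powr)
  define \<epsilon> where "\<epsilon> = \<delta> / 2 * r powr a"
  have \<epsilon>: "0 < \<epsilon>" using \<delta> r by (simp add: \<epsilon>_def)
  have "(\<integral>y. indicator S y * norm (x - y) powr (-a) \<partial>lborel) \<le> \<delta>"
    if S: "integrable lborel (indicator S :: real^4 \<Rightarrow> real)" "measure lborel S < \<epsilon>" for S x
  proof -
    have "(\<integral>y. indicator S y * norm (x - y) powr (-a) \<partial>lborel)
       \<le> 1 * (2 * pi\<^sup>2 / (4 - a) * r powr (4 - a)) + r powr (-a) * (\<integral>y. indicator S y \<partial>lborel)"
      using a r by (intro riesz_potential_bound(2)[OF S(1)]) (auto simp: indicator_def)
    also have "\<dots> = \<delta> / 2 + r powr (-a) * measure lborel S"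
      using r' by (simp add: \<kappa>_def)
    also have "\<dots> \<le> \<delta> / 2 + r powr (-a) * \<epsilon>"
      using S(2) by (intro add_left_mono mult_left_mono) auto
    also have "r powr (-a) * \<epsilon> = \<delta> / 2"
      using r by (simp add: \<epsilon>_def powr_minus)
    finally show ?thesis by simp
  qed
  then show ?thesis using that[OF \<epsilon>] by blast
qed

lemma integral_lborel_pos_on_open:
  fixes f :: "'a::euclidean_space \<Rightarrow> real"
  assumes f: "integrable lborel f" and nonneg: "AE y in lborel. 0 \<le> f y"
    and U: "open U" "U \<noteq> {}" "\<And>y. y \<in> U \<Longrightarrow> 0 < f y"
  shows "0 < (\<integral>y. f y \<partial>lborel)"
proof -
  have "(\<integral>y. f y \<partial>lborel) \<noteq> 0"
  proof
    assume "(\<integral>y. f y \<partial>lborel) = 0"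
    then have "AE y in lborel. f y = 0"
      using f nonneg by (subst (asm) integral_nonneg_eq_0_iff_AE) auto
    then have "AE y in lborel. y \<notin> U"
      by eventually_elim (use U(3) in fastforce)
    then have "emeasure lborel U = 0"
      using U(1) by (subst (asm) AE_iff_measurable[of U]) auto
    then have "U \<in> null_sets lborel" using U(1) by auto
    then show False
      using open_not_negligible[OF U(1,2)] by (auto simp: negligible_iff_null_sets dest: null_sets_completionI)
  qed
  moreover have "0 \<le> (\<integral>y. f y \<partial>lborel)"
    by (rule integral_nonneg_AE[OF nonneg])
  ultimately show ?thesis by linarith
qed

context choquard_solution
begin

definition bad_set :: "real \<Rightarrow> (real^4) set" where
  "bad_set l = {x. x \<noteq> 0 \<and> norm x < l \<and> kelvin l x < u x}"

lemma bad_set_measurable [measurable]: "bad_set l \<in> sets borel"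
  unfolding bad_set_def by measurable

lemma bad_set_subset: "bad_set l \<subseteq> ball 0 l"
  by (auto simp: bad_set_def)

lemma integrable_indicator_bad_set: "integrable lborel (indicator (bad_set l) :: _ \<Rightarrow> real)"
  by (rule Bochner_Integration.integrable_bound[OF integrable_indicator_ball[of 0 l]])
     (auto simp: indicator_def bad_set_def)

text \<open>Near the origin the inverted point runs to infinity, and the decay of \<open>u\<close>
  there is compensated by \<open>(8 - \<alpha>) * ln (l / norm x)\<close>, the slope being
  \<open>8 - \<alpha>\<close>. This makes the supremum in the comparison step finite.\<close>

lemma u_minus_kelvin_bounded:
  assumes l: "0 < l"
  obtains K where "\<And>x. x \<noteq> 0 \<Longrightarrow> norm x < l \<Longrightarrow> u x - kelvin l x \<le> K"
proof -
  obtain M where M: "\<And>x. u x \<le> M" by (rule u_bounded_above) blast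
  obtain K where K: "\<And>x. - slope * ln (1 + norm x) - K \<le> u x" by (rule u_lower_bound) blast
  have "u x - kelvin l x \<le> M + K + (8 - \<alpha>) * ln (1 + l)" if x: "x \<noteq> 0" "norm x < l" for x
  proof -
    have nx: "0 < norm x" using x by simp
    have "1 + norm (inversion l x) = (norm x + l\<^sup>2) / norm x"
      using nx by (simp add: norm_inversion add_divide_distrib)
    also have "\<dots> \<le> (l + l\<^sup>2) / norm x"
      using x nx by (intro divide_right_mono) auto
    also have "\<dots> = (l / norm x) * (1 + l)" by (simp add: power2_eq_square algebra_simps)
    finally have "ln (1 + norm (inversion l x)) \<le> ln ((l / norm x) * (1 + l))"
      by (intro ln_mono) (auto intro: add_pos_nonneg)
    also have "\<dots> = ln (l / norm x) + ln (1 + l)"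
      using l nx by (intro ln_mult_pos) auto
    finally have "(8 - \<alpha>) * ln (1 + norm (inversion l x)) \<le> (8 - \<alpha>) * (ln (l / norm x) + ln (1 + l))"
      using \<alpha> by (intro mult_left_mono) auto
    then show ?thesis
      using M[of x] K[of "inversion l x"] by (simp add: kelvin_def slope_eq algebra_simps)
  qed
  then show ?thesis using that by blast
qed

lemma kelvin_V_nonneg: "0 \<le> kelvin_V l x"
  using V_nonneg by (simp add: kelvin_V_def)

text \<open>Comparison step of the method of moving spheres, phrased inside the ball so that only local
  bounds on \<open>u\<close> and \<open>V\<close> enter: on the bad set the supremum of \<open>u - kelvin l\<close> is contracted
  by a factor that tends to zero with the measure of that set.\<close>

lemma bad_set_empty_if_small:
  assumes L: "0 < L"
  obtains \<epsilon> where "0 < \<epsilon>"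
    "\<And>l. \<lbrakk>0 < l; l \<le> L; measure lborel (bad_set l) < \<epsilon>\<rbrakk> \<Longrightarrow> bad_set l = {}"
proof -
  define c where "c = 1 / (8 * pi\<^sup>2)"
  have c: "0 < c" by (simp add: c_def)
  obtain M where M: "0 < M" "\<And>x. exp (u x) \<le> M" "\<And>x. V x \<le> M" "\<And>x. F x \<le> M"
    by (rule F_bounded) blast
  define N where "N = 2 * pi\<^sup>2 / 3 + pi\<^sup>2 / 2 * L ^ 4"
  have N: "0 < N" using L by (auto simp: N_def intro!: add_pos_nonneg)
  \<comment> \<open>Chosen so that the final estimate reads
    \<open>\<phi> x \<le> (k * \<delta>) * S\<close>; with \<open>\<delta> = 1 / (2 * k)\<close> the
    contraction factor is one half.\<close>
  define k where "k = c * L * (M + M\<^sup>2 * N)"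
  have k: "0 < k" unfolding k_def using c L M N by (intro mult_pos_pos add_pos_nonneg) auto
  define \<delta> where "\<delta> = 1 / (2 * k)"
  have \<delta>: "0 < \<delta>" "k * \<delta> = 1 / 2" using k by (auto simp: \<delta>_def)
  obtain \<epsilon>1 where \<epsilon>1: "0 < \<epsilon>1" "\<And>S x. \<lbrakk>integrable lborel (indicator S :: real^4 \<Rightarrow> real); measure lborel S < \<epsilon>1\<rbrakk> \<Longrightarrow>
        (\<integral>y. indicator S y * norm (x - y) powr (-1) \<partial>lborel) \<le> \<delta>"
    using riesz_potential_small_set[of 1 \<delta>] \<delta> by auto
  obtain \<epsilon>2 where \<epsilon>2: "0 < \<epsilon>2" "\<And>S x. \<lbrakk>integrable lborel (indicator S :: real^4 \<Rightarrow> real); measure lborel S < \<epsilon>2\<rbrakk> \<Longrightarrow>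
        (\<integral>y. indicator S y * norm (x - y) powr (-\<alpha>) \<partial>lborel) \<le> \<delta>"
    using riesz_potential_small_set[of \<alpha> \<delta>] \<delta> \<alpha> by auto
  have main: "bad_set l = {}" if l: "0 < l" "l \<le> L" and small: "measure lborel (bad_set l) < min \<epsilon>1 \<epsilon>2" for l
  proof (rule ccontr)
    assume ne: "bad_set l \<noteq> {}"
    define \<phi> where "\<phi> x = u x - kelvin l x" for x
    define S where "S = (SUP x\<in>bad_set l. \<phi> x)"
    let ?b = "indicator (bad_set l) :: real^4 \<Rightarrow> real"
    let ?B = "indicator (ball 0 l) :: real^4 \<Rightarrow> real"
    obtain K where K: "\<And>x. x \<noteq> 0 \<Longrightarrow> norm x < l \<Longrightarrow> u x - kelvin l x \<le> K"
      using u_minus_kelvin_bounded[OF l(1)] by blast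
    have bdd: "bdd_above (\<phi> ` bad_set l)"
      by (rule bdd_aboveI[of _ K]) (auto simp: \<phi>_def bad_set_def intro: K)
    have \<phi>S: "\<phi> x \<le> S" if "x \<in> bad_set l" for x
      unfolding S_def by (rule cSUP_upper[OF that bdd])
    obtain x0 where x0: "x0 \<in> bad_set l" using ne by blast
    then have S: "0 < S" using \<phi>S[OF x0] by (auto simp: \<phi>_def bad_set_def)
    have bint: "integrable lborel (\<lambda>y. ?b y * norm (x - y) powr (-a))" if "0 \<le> a" "a < 4" for a x
      by (rule riesz_potential_bound(1)[OF integrable_indicator_bad_set, where x=x and r=1 and M=1]) (use that in \<open>auto simp: indicator_def\<close>)
    have Bint: "integrable lborel (\<lambda>y. ?B y * norm (x - y) powr (-1))" for x
      by (rule riesz_potential_bound(1)[OF integrable_indicator_ball, where x=x and r=1 and M=1]) (auto simp: indicator_def)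
    have BN: "(\<integral>y. ?B y * norm (x - y) powr (-1) \<partial>lborel) \<le> N" for x
    proof -
      have "(\<integral>y. ?B y * norm (x - y) powr (-1) \<partial>lborel)
        \<le> 1 * (2 * pi\<^sup>2 / (4 - 1) * 1 powr (4 - 1)) + 1 powr (-1) * (\<integral>y. ?B y \<partial>lborel)"
        by (rule riesz_potential_bound(2)[OF integrable_indicator_ball]) (auto simp: indicator_def)
      also have "\<dots> = 2 * pi\<^sup>2 / 3 + pi\<^sup>2 / 2 * l ^ 4"
        using l by (simp add: measure_ball_4)
      also have "\<dots> \<le> N"
        unfolding N_def using l by (intro add_left_mono mult_left_mono power_mono) auto
      finally show ?thesis .
    qed
    \<comment> \<open>The tangent inequality \<open>1 - \<phi> z \<le> exp (- \<phi> z)\<close>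
      bounds the difference by \<open>exp (u z) * \<phi> z\<close>.\<close>
    have E_diff: "exp (u z) - exp (kelvin l z) \<le> M * S" if "z \<in> bad_set l" for z
    proof -
      have "1 - \<phi> z \<le> exp (- \<phi> z)" using exp_ge_add_one_self[of "- \<phi> z"] by simp
      then have "exp (u z) * (1 - exp (- \<phi> z)) \<le> exp (u z) * \<phi> z" by (intro mult_left_mono) auto
      also have "\<dots> \<le> M * S"
        using M(1,2) \<phi>S[OF that] that by (intro mult_mono) (auto simp: \<phi>_def bad_set_def)
      finally show ?thesis by (simp add: \<phi>_def right_diff_distrib exp_add[symmetric])
    qed
    \<comment> \<open>The kernel being nonnegative, only the bad set contributes positively; its
      potential is at most \<open>\<delta>\<close>.\<close>
    have A: "V y - kelvin_V l y \<le> M * S * \<delta>" if y: "y \<noteq> 0" "norm y < l" for y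
    proof -
      have "V y - kelvin_V l y = (\<integral>z. ?B z * (riesz_green \<alpha> l y z * exp (u z)) - ?B z * (riesz_green \<alpha> l y z * exp (kelvin l z)) \<partial>lborel)"
        using V_minus_kelvin[OF y] riesz_green_integrable[OF y] riesz_green_kelvin_integrable[OF y] by simp
      also have "\<dots> \<le> (\<integral>z. M * S * (?b z * norm (y - z) powr (-\<alpha>)) \<partial>lborel)"
      proof (rule integral_mono_AE)
        show "AE z in lborel. ?B z * (riesz_green \<alpha> l y z * exp (u z)) - ?B z * (riesz_green \<alpha> l y z * exp (kelvin l z))
            \<le> M * S * (?b z * norm (y - z) powr (-\<alpha>))"
          using AE_lborel_neq[of 0] AE_lborel_neq[of y]
        proof eventually_elim
          case (elim z)
          show ?case
          proof (cases "norm z < l")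
            case True
            have Q: "0 \<le> riesz_green \<alpha> l y z" using y True elim \<alpha> by (intro riesz_green_nonneg) auto
            show ?thesis
            proof (cases "z \<in> bad_set l")
              case True
              have "riesz_green \<alpha> l y z * (exp (u z) - exp (kelvin l z)) \<le> norm (y - z) powr (-\<alpha>) * (M * S)"
                using True Q E_diff[OF True] by (intro mult_mono riesz_green_le) (auto simp: bad_set_def)
              then show ?thesis using True \<open>norm z < l\<close> by (simp add: algebra_simps)
            next
              case False
              then have "exp (u z) \<le> exp (kelvin l z)" using elim True by (auto simp: bad_set_def)
              then have "riesz_green \<alpha> l y z * exp (u z) \<le> riesz_green \<alpha> l y z * exp (kelvin l z)"
                using Q by (intro mult_left_mono)
              then show ?thesis using False True by simp
            qed
          next
            case False
            then show ?thesis by (simp add: bad_set_def)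
          qed
        qed
      qed (use riesz_green_integrable[OF y] riesz_green_kelvin_integrable[OF y] bint[of \<alpha> y] \<alpha> in auto)
      also have "\<dots> = M * S * (\<integral>z. ?b z * norm (y - z) powr (-\<alpha>) \<partial>lborel)"
        by (rule integral_mult_right_zero)
      also have "\<dots> \<le> M * S * \<delta>"
        using M(1) S small by (intro mult_left_mono \<epsilon>2(2)[OF integrable_indicator_bad_set]) auto
      finally show ?thesis .
    qed
    \<comment> \<open>Off the bad set \<open>exp (kelvin l y)\<close> may be lowered to
      \<open>exp (u y)\<close>, so only the difference of \<open>V\<close> survives. On it the
      difference of the exponentials is added, which is why the first term carries the
      indicator.\<close>
    have B: "F y - (l / norm y) ^ 8 * F (inversion l y) \<le> M * S * ?b y + M * (M * S * \<delta>)"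
      if y: "y \<noteq> 0" "norm y < l" for y
    proof -
      have Fk: "(l / norm y) ^ 8 * F (inversion l y) = kelvin_V l y * exp (kelvin l y)"
        by (rule kelvin_F[OF l(1) y(1)])
      have MS: "0 \<le> M * S * \<delta>" using M(1) S \<delta> by simp
      show ?thesis
      proof (cases "y \<in> bad_set l")
        case True
        have "V y * (exp (u y) - exp (kelvin l y)) \<le> V y * (exp (u y) * S)"
        proof (intro mult_left_mono V_nonneg)
          have "1 - \<phi> y \<le> exp (- \<phi> y)" using exp_ge_add_one_self[of "- \<phi> y"] by simp
          then have "exp (u y) * (1 - exp (- \<phi> y)) \<le> exp (u y) * \<phi> y" by (intro mult_left_mono) auto
          also have "\<dots> \<le> exp (u y) * S" using \<phi>S[OF True] by simp
          finally show "exp (u y) - exp (kelvin l y) \<le> exp (u y) * S"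
            by (simp add: \<phi>_def right_diff_distrib exp_add[symmetric])
        qed
        also have "\<dots> = F y * S" by (simp add: source_def)
        also have "\<dots> \<le> M * S" using M(4) S by (intro mult_right_mono) auto
        finally have 1: "V y * (exp (u y) - exp (kelvin l y)) \<le> M * S" .
        have "exp (kelvin l y) \<le> exp (u y)" using True by (simp add: bad_set_def)
        then have Ek: "exp (kelvin l y) \<le> M" using M(2)[of y] by linarith
        have "(V y - kelvin_V l y) * exp (kelvin l y) \<le> (M * S * \<delta>) * exp (kelvin l y)"
          using A[OF y] by (intro mult_right_mono) auto
        also have "\<dots> \<le> (M * S * \<delta>) * M" using MS Ek by (intro mult_left_mono)
        finally have 2: "(V y - kelvin_V l y) * exp (kelvin l y) \<le> M * (M * S * \<delta>)" by (simp only: mult.commute)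
        have "F y - kelvin_V l y * exp (kelvin l y) = V y * (exp (u y) - exp (kelvin l y)) + (V y - kelvin_V l y) * exp (kelvin l y)"
          by (simp add: source_def algebra_simps)
        then show ?thesis unfolding Fk using 1 2 True by simp
      next
        case False
        then have "exp (u y) \<le> exp (kelvin l y)" using y by (auto simp: bad_set_def)
        then have "kelvin_V l y * exp (u y) \<le> kelvin_V l y * exp (kelvin l y)"
          using kelvin_V_nonneg by (intro mult_left_mono)
        then have "F y - kelvin_V l y * exp (kelvin l y) \<le> (V y - kelvin_V l y) * exp (u y)"
          by (simp add: source_def left_diff_distrib)
        also have "\<dots> \<le> (M * S * \<delta>) * exp (u y)" using A[OF y] by (intro mult_right_mono) auto
        also have "\<dots> \<le> (M * S * \<delta>) * M" using MS M(2) by (intro mult_left_mono)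
        finally show ?thesis unfolding Fk using False by (simp add: mult.commute)
      qed
    qed
    have "\<phi> x \<le> S / 2" if "x \<in> bad_set l" for x
    proof -
      have x: "x \<noteq> 0" "norm x < l" using that by (auto simp: bad_set_def)
      \<comment> \<open>The \<open>k1\<close> term is not small but is integrated over the small bad
        set; the \<open>k2\<close> term already contains \<open>\<delta>\<close> and may be
        integrated over the whole ball, at cost \<open>N\<close>.\<close>
      define k1 where "k1 = L * (M * S)"
      define k2 where "k2 = L * (M * (M * S * \<delta>))"
      have k12: "0 \<le> k1" "0 \<le> k2" using L M(1) S \<delta> by (auto simp: k1_def k2_def)
      have rhs: "integrable lborel (\<lambda>y. k1 * (?b y * norm (x - y) powr (-1)) + k2 * (?B y * norm (x - y) powr (-1)))"
        by (intro Bochner_Integration.integrable_add integrable_mult_right bint Bint) auto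
      have "\<phi> x = c * (\<integral>y. ?B y * (log_green l x y * F y) - ?B y * (log_green l x y * ((l / norm y) ^ 8 * F (inversion l y))) \<partial>lborel)"
        using u_minus_kelvin[OF x] log_green_F_integrable[OF x] log_green_kelvin_F_integrable[OF x]
        by (simp add: \<phi>_def c_def)
      also have "\<dots> \<le> c * (\<integral>y. k1 * (?b y * norm (x - y) powr (-1)) + k2 * (?B y * norm (x - y) powr (-1)) \<partial>lborel)"
      proof (intro mult_left_mono integral_mono_AE)
        show "AE y in lborel. ?B y * (log_green l x y * F y) - ?B y * (log_green l x y * ((l / norm y) ^ 8 * F (inversion l y)))
            \<le> k1 * (?b y * norm (x - y) powr (-1)) + k2 * (?B y * norm (x - y) powr (-1))"
          using AE_lborel_neq[of 0]
        proof eventually_elim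
          case (elim y)
          show ?case
          proof (cases "norm y < l")
            case True
            define n where "n = norm (x - y) powr (-1)"
            have n: "0 \<le> n" by (simp add: n_def)
            define R where "R = M * S * ?b y + M * (M * S * \<delta>)"
            have R: "0 \<le> R" using M(1) S \<delta> by (simp add: R_def)
            have "log_green l x y \<le> l * n" unfolding n_def by (rule log_green_le[OF x(2) True])
            also have "\<dots> \<le> L * n" using l n by (intro mult_right_mono)
            finally have G: "log_green l x y \<le> L * n" .
            have "log_green l x y * (F y - (l / norm y) ^ 8 * F (inversion l y)) \<le> log_green l x y * R"
              unfolding R_def using B[OF elim True] log_green_nonneg[OF x(2) True] by (intro mult_left_mono)
            also have "\<dots> \<le> (L * n) * R" using G R by (intro mult_right_mono)
            also have "\<dots> = k1 * (?b y * n) + k2 * n"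
              by (simp add: R_def k1_def k2_def algebra_simps)
            finally have "log_green l x y * (F y - (l / norm y) ^ 8 * F (inversion l y)) \<le> k1 * (?b y * n) + k2 * n" .
            moreover have "?B y = 1" using True by simp
            ultimately show ?thesis unfolding n_def by (simp only: mult_1 right_diff_distrib)
          next
            case False
            then have "?B y = 0" "?b y = 0" by (auto simp: bad_set_def)
            then show ?thesis by simp
          qed
        qed
      qed (use c log_green_F_integrable[OF x] log_green_kelvin_F_integrable[OF x] rhs in auto)
      also have "(\<integral>y. k1 * (?b y * norm (x - y) powr (-1)) + k2 * (?B y * norm (x - y) powr (-1)) \<partial>lborel)
         = k1 * (\<integral>y. ?b y * norm (x - y) powr (-1) \<partial>lborel) + k2 * (\<integral>y. ?B y * norm (x - y) powr (-1) \<partial>lborel)"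
        unfolding integral_mult_right_zero[symmetric]
        by (intro Bochner_Integration.integral_add integrable_mult_right bint Bint) auto
      also have "c * \<dots> \<le> c * (k1 * \<delta> + k2 * N)"
        using c k12 BN small by (intro mult_left_mono add_mono \<epsilon>1(2)[OF integrable_indicator_bad_set]) auto
      also have "\<dots> = (k * \<delta>) * S"
        by (simp add: k_def k1_def k2_def power2_eq_square algebra_simps)
      also have "\<dots> = S / 2" unfolding \<delta>(2) by simp
      finally show ?thesis .
    qed
    then have "S \<le> S / 2" unfolding S_def using ne by (intro cSUP_least) auto
    then show False using S by simp
  qed
  show ?thesis
    by (rule that[of "min \<epsilon>1 \<epsilon>2"]) (use \<epsilon>1(1) \<epsilon>2(1) main in auto)
qed

section \<open>Starting, stopping and identifying the critical sphere\<close>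

lemma kelvin_continuous:
  "continuous_on ({0<..} \<times> - {0}) (\<lambda>p. kelvin (fst p) (snd p))"
  unfolding kelvin_def inversion_def
  by (intro continuous_intros continuous_on_compose2[OF u_continuous]) auto

lemma kelvin_continuous_snd: "0 < l \<Longrightarrow> continuous_on (- {0}) (kelvin l)"
  by (rule continuous_on_compose2[OF kelvin_continuous, of _ "\<lambda>x. (l, x)", simplified])
     (auto intro!: continuous_intros)

lemma kelvin_continuous_fst: "x \<noteq> 0 \<Longrightarrow> continuous_on {0<..} (\<lambda>l. kelvin l x)"
  by (rule continuous_on_compose2[OF kelvin_continuous, of _ "\<lambda>l. (l, x)", simplified])
     (auto intro!: continuous_intros)

lemma measure_bad_set_le: "0 < l \<Longrightarrow> measure lborel (bad_set l) \<le> pi\<^sup>2 / 2 * l ^ 4"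
  using measure_mono_fmeasurable[OF bad_set_subset[of l], of lborel] emeasure_lborel_ball_finite[of "0::real^4" l]
  by (simp add: measure_ball_4 fmeasurable_def)

text \<open>The start is free: a small ball bounds the measure of its bad set below the threshold,
  which is uniform for all \<open>l \<le> 1\<close>.\<close>

lemma bad_set_empty_exists: "\<exists>l>0. bad_set l = {}"
proof -
  obtain \<epsilon> where \<epsilon>: "0 < \<epsilon>" "\<And>l. \<lbrakk>0 < l; l \<le> 1; measure lborel (bad_set l) < \<epsilon>\<rbrakk> \<Longrightarrow> bad_set l = {}"
    using bad_set_empty_if_small[of 1] by auto
  define l where "l = min 1 (\<epsilon> / pi\<^sup>2)"
  have l: "0 < l" "l \<le> 1" "l \<le> \<epsilon> / pi\<^sup>2" using \<epsilon> by (auto simp: l_def)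
  have "pi\<^sup>2 / 2 * l ^ 4 \<le> pi\<^sup>2 / 2 * l"
    using l power_decreasing[of 1 4 l] by (intro mult_left_mono) auto
  also have "\<dots> \<le> pi\<^sup>2 / 2 * (\<epsilon> / pi\<^sup>2)" using l by (intro mult_left_mono) auto
  also have "\<dots> < \<epsilon>" using \<epsilon> by simp
  finally have "measure lborel (bad_set l) < \<epsilon>" using measure_bad_set_le[OF l(1)] by linarith
  then show ?thesis using \<epsilon> l by blast
qed

lemma u_inversion_ray_tendsto: "(\<lambda>n. u (inversion l (real n *\<^sub>R e))) \<longlonglongrightarrow> u 0"
proof (cases "e = 0")
  case False
  have "(\<lambda>n. ((l\<^sup>2 / (norm e)\<^sup>2) * (1 / real n)) *\<^sub>R e) \<longlonglongrightarrow> ((l\<^sup>2 / (norm e)\<^sup>2) * 0) *\<^sub>R e"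
    by (intro tendsto_intros lim_1_over_n)
  moreover have "inversion l (real n *\<^sub>R e) = ((l\<^sup>2 / (norm e)\<^sup>2) * (1 / real n)) *\<^sub>R e" for n
    by (cases "n = 0") (simp_all add: inversion_def power2_eq_square field_simps)
  ultimately have "(\<lambda>n. inversion l (real n *\<^sub>R e)) \<longlonglongrightarrow> 0" by simp
  moreover have "isCont u 0"
    using u_continuous by (simp add: continuous_on_eq_continuous_at)
  ultimately show ?thesis by (rule isCont_tendsto_compose[rotated])
qed simp

text \<open>The comparison is read at the inverses of \<open>real n *\<^sub>R e\<close>, which tend
  to the origin. In the limit it relates \<open>u 0\<close> to the finite asymptotic constant
  \<open>c0\<close> and so bounds the admissible radii.\<close>

lemma bad_set_empty_radius_bound:
  assumes l: "0 < l" and empty: "bad_set l = {}"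
  shows "u 0 + (8 - \<alpha>) * ln l \<le> c0"
proof -
  obtain e :: "real^4" where e: "norm e = 1" using vector_choose_size[of 1] by auto
  have "(\<lambda>n. u (inversion l (real n *\<^sub>R e)) + (8 - \<alpha>) * ln l) \<longlonglongrightarrow> u 0 + (8 - \<alpha>) * ln l"
    by (intro tendsto_intros u_inversion_ray_tendsto)
  moreover have "(\<lambda>n. u (real n *\<^sub>R e) + (8 - \<alpha>) * ln (real n)) \<longlonglongrightarrow> c0"
    by (rule u_asymptotic[OF e])
  moreover obtain N where N: "l < real N" using reals_Archimedean2 by blast
  have "u (inversion l (real n *\<^sub>R e)) + (8 - \<alpha>) * ln l \<le> u (real n *\<^sub>R e) + (8 - \<alpha>) * ln (real n)" if "N \<le> n" for n
  proof -
    have n: "l < real n" using N that by linarith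
    let ?x = "inversion l (real n *\<^sub>R e)"
    have nx: "norm ?x = l\<^sup>2 / real n" using e by (simp add: norm_inversion)
    have "?x \<noteq> 0" using l n e by auto
    moreover have "norm ?x < l" unfolding nx using l n by (simp add: power2_eq_square divide_less_eq)
    ultimately have "u ?x \<le> kelvin l ?x" using empty by (auto simp: bad_set_def not_less)
    also have "\<dots> = u (real n *\<^sub>R e) + (8 - \<alpha>) * ln (real n / l)"
      unfolding kelvin_def nx using l by (simp add: power2_eq_square)
    also have "ln (real n / l) = ln (real n) - ln l" using l n by (intro ln_divide_pos) auto
    finally show ?thesis by (simp add: right_diff_distrib)
  qed
  then have "\<exists>N. \<forall>n\<ge>N. u (inversion l (real n *\<^sub>R e)) + (8 - \<alpha>) * ln l \<le> u (real n *\<^sub>R e) + (8 - \<alpha>) * ln (real n)"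
    by blast
  ultimately show ?thesis by (rule LIMSEQ_le)
qed

text \<open>A strong maximum principle from the integral representation. Strict inequality at one
  point extends to a neighbourhood by continuity; there the reflected source is strictly larger, and
  the positive Green function carries this to every point.\<close>

lemma kelvin_strict:
  assumes l: "0 < l" and empty: "bad_set l = {}"
    and x1: "x1 \<noteq> 0" "norm x1 < l" "u x1 \<noteq> kelvin l x1"
    and x: "x \<noteq> 0" "norm x < l"
  shows "u x < kelvin l x"
proof -
  let ?B = "indicator (ball 0 l) :: real^4 \<Rightarrow> real"
  have le: "u y \<le> kelvin l y" if "y \<noteq> 0" "norm y < l" for y
    using that empty by (auto simp: bad_set_def not_less)
  have V: "V y \<le> kelvin_V l y" if y: "y \<noteq> 0" "norm y < l" for y
  proof -
    have "(\<integral>z. ?B z * (riesz_green \<alpha> l y z * exp (u z)) \<partial>lborel) \<le> (\<integral>z. ?B z * (riesz_green \<alpha> l y z * exp (kelvin l z)) \<partial>lborel)"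
    proof (rule integral_mono_AE)
      show "AE z in lborel. ?B z * (riesz_green \<alpha> l y z * exp (u z)) \<le> ?B z * (riesz_green \<alpha> l y z * exp (kelvin l z))"
        using AE_lborel_neq[of 0] AE_lborel_neq[of y]
      proof eventually_elim
        case (elim z)
        show ?case
        proof (cases "norm z < l")
          case True
          have "0 \<le> riesz_green \<alpha> l y z" using y True elim \<alpha> by (intro riesz_green_nonneg) auto
          then show ?thesis using le[OF elim(1) True] by (intro mult_left_mono) auto
        qed simp
      qed
    qed (use riesz_green_integrable[OF y] riesz_green_kelvin_integrable[OF y] in auto)
    then show ?thesis using V_minus_kelvin[OF y] by simp
  qed
  have F: "F y \<le> (l / norm y) ^ 8 * F (inversion l y)"
    and F_strict: "u y < kelvin l y \<Longrightarrow> F y < (l / norm y) ^ 8 * F (inversion l y)"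
    if y: "y \<noteq> 0" "norm y < l" for y
  proof -
    show "F y \<le> (l / norm y) ^ 8 * F (inversion l y)"
      unfolding kelvin_F[OF l y(1)] unfolding source_def using V[OF y] le[OF y] V_nonneg kelvin_V_nonneg
      by (intro mult_mono) auto
    assume "u y < kelvin l y"
    then have "V y * exp (u y) < V y * exp (kelvin l y)" using V_pos by simp
    also have "\<dots> \<le> kelvin_V l y * exp (kelvin l y)" using V[OF y] by (intro mult_right_mono) auto
    finally show "F y < (l / norm y) ^ 8 * F (inversion l y)"
      unfolding kelvin_F[OF l y(1)] unfolding source_def .
  qed
  define f where "f y = ?B y * (log_green l x y * ((l / norm y) ^ 8 * F (inversion l y))) - ?B y * (log_green l x y * F y)" for y
  have f: "integrable lborel f"
    unfolding f_def using log_green_F_integrable[OF x] log_green_kelvin_F_integrable[OF x] by simp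
  define W where "W = {y \<in> ball 0 l - {0}. kelvin l y - u y \<in> {0<..}}"
  have "open W"
    unfolding W_def
  proof (rule continuous_open_preimage[unfolded vimage_def Int_def, simplified])
    show "continuous_on (ball 0 l - {0}) (\<lambda>y. kelvin l y - u y)"
      using l by (intro continuous_intros continuous_on_subset[OF kelvin_continuous_snd] continuous_on_subset[OF u_continuous]) auto
  qed auto
  moreover have "x1 \<in> W" using x1 le[OF x1(1,2)] by (simp add: W_def)
  \<comment> \<open>The point \<open>x\<close> must go because \<open>log_green\<close> vanishes on
    the diagonal; the set stays nonempty as no singleton is open.\<close>
  ultimately have W: "open (W - {x})" "W - {x} \<noteq> {}"
    using not_open_singleton[of x] by (auto simp: subset_singleton_iff intro: open_delete)
  have "0 < (\<integral>y. f y \<partial>lborel)"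
  proof (rule integral_lborel_pos_on_open[OF f _ W])
    show "AE y in lborel. 0 \<le> f y"
      using AE_lborel_neq[of 0]
    proof eventually_elim
      case (elim y)
      show ?case
      proof (cases "norm y < l")
        case True
        have "log_green l x y * F y \<le> log_green l x y * ((l / norm y) ^ 8 * F (inversion l y))"
          using F[OF elim True] log_green_nonneg[OF x(2) True] by (intro mult_left_mono)
        then show ?thesis using True by (simp add: f_def)
      qed (simp add: f_def)
    qed
    show "0 < f y" if "y \<in> W - {x}" for y
    proof -
      have y: "y \<noteq> 0" "norm y < l" "u y < kelvin l y" "x \<noteq> y" using that by (auto simp: W_def)
      have "log_green l x y * F y < log_green l x y * ((l / norm y) ^ 8 * F (inversion l y))"
        using F_strict[OF y(1,2,3)] log_green_pos[OF x(2) y(2,4)] by (intro mult_strict_left_mono)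
      then show ?thesis using y by (simp add: f_def)
    qed
  qed
  also have "(\<integral>y. f y \<partial>lborel) = 8 * pi\<^sup>2 * (kelvin l x - u x)"
    unfolding f_def using u_minus_kelvin[OF x] log_green_F_integrable[OF x] log_green_kelvin_F_integrable[OF x]
    by (simp add: field_simps)
  finally show ?thesis by (simp add: zero_less_mult_iff)
qed

theorem moving_spheres:
  obtains l where "0 < l" "\<And>x. x \<noteq> 0 \<Longrightarrow> u x = kelvin l x"
proof -
  define A where "A = {l. 0 < l \<and> bad_set l = {}}"
  define m where "m = Sup A"
  have ne: "A \<noteq> {}" using bad_set_empty_exists by (auto simp: A_def)
  have bdd: "bdd_above A"
  proof (rule bdd_aboveI)
    fix l assume "l \<in> A"
    then have l: "0 < l" "bad_set l = {}" by (auto simp: A_def)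
    have "ln l \<le> (c0 - u 0) / (8 - \<alpha>)"
      using bad_set_empty_radius_bound[OF l] \<alpha> by (simp add: le_divide_eq mult.commute)
    then have "exp (ln l) \<le> exp ((c0 - u 0) / (8 - \<alpha>))" by (subst exp_le_cancel_iff)
    then show "l \<le> exp ((c0 - u 0) / (8 - \<alpha>))" using l by simp
  qed
  obtain l0 where "l0 \<in> A" using ne by blast
  then have m: "0 < m" using cSup_upper[OF _ bdd, of l0] by (auto simp: m_def A_def)
  \<comment> \<open>A violation at \<open>m\<close> persists for all radii near \<open>m\<close>,
    among them members of \<open>A\<close> from below.\<close>
  have empty: "bad_set m = {}"
  proof (rule ccontr)
    assume "bad_set m \<noteq> {}"
    then obtain x where x: "x \<noteq> 0" "norm x < m" "kelvin m x < u x" by (auto simp: bad_set_def)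
    have "isCont (\<lambda>l. kelvin l x) m"
      using kelvin_continuous_fst[OF x(1)] m by (simp add: continuous_on_eq_continuous_at)
    then have "eventually (\<lambda>l. kelvin l x < u x) (at m)"
      using x(3) by (intro order_tendstoD(2)[where y = "kelvin m x"]) (auto simp: isCont_def)
    then obtain d where d: "0 < d" "\<And>l. l \<noteq> m \<Longrightarrow> dist l m < d \<Longrightarrow> kelvin l x < u x"
      by (auto simp: eventually_at)
    have "max (norm x) (m - d) < Sup A" using x d by (auto simp: m_def[symmetric])
    then obtain l where l: "l \<in> A" "max (norm x) (m - d) < l" by (meson less_cSupD ne)
    have "l \<le> m" unfolding m_def by (rule cSup_upper[OF l(1) bdd])
    then have "kelvin l x < u x" using d x l by (cases "l = m") (auto simp: dist_real_def)
    then have "x \<in> bad_set l" using x l by (auto simp: bad_set_def)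
    then show False using l by (simp add: A_def)
  qed
  have inside: "u x = kelvin m x" if x: "x \<noteq> 0" "norm x < m" for x
  proof (rule ccontr)
    assume neq: "u x \<noteq> kelvin m x"
    obtain \<epsilon> where \<epsilon>: "0 < \<epsilon>" "\<And>l. \<lbrakk>0 < l; l \<le> m + 1; measure lborel (bad_set l) < \<epsilon>\<rbrakk> \<Longrightarrow> bad_set l = {}"
      using bad_set_empty_if_small[of "m + 1"] m by auto
    \<comment> \<open>Volume of the two regions that compactness does not reach: a ball of radius
      \<open>d\<close> at the origin, where \<open>kelvin\<close> is not continuous, and the shell
      between the radii \<open>m - d\<close> and \<open>m + d\<close>.\<close>
    have "((\<lambda>d. pi\<^sup>2 / 2 * d ^ 4 + (pi\<^sup>2 / 2 * (m + d) ^ 4 - pi\<^sup>2 / 2 * (m - d) ^ 4)) \<longlongrightarrow>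
        pi\<^sup>2 / 2 * 0 ^ 4 + (pi\<^sup>2 / 2 * (m + 0) ^ 4 - pi\<^sup>2 / 2 * (m - 0) ^ 4)) (at_right 0)"
      by (intro tendsto_intros)
    then have "eventually (\<lambda>d. pi\<^sup>2 / 2 * d ^ 4 + (pi\<^sup>2 / 2 * (m + d) ^ 4 - pi\<^sup>2 / 2 * (m - d) ^ 4) < \<epsilon>) (at_right 0)"
      using \<epsilon>(1) by (intro order_tendstoD(2)) auto
    then obtain b where b: "0 < b" "\<And>d. 0 < d \<Longrightarrow> d < b \<Longrightarrow> pi\<^sup>2 / 2 * d ^ 4 + (pi\<^sup>2 / 2 * (m + d) ^ 4 - pi\<^sup>2 / 2 * (m - d) ^ 4) < \<epsilon>"
      by (auto simp: eventually_at_right_field)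
    define d where "d = min (min 1 (m / 2)) (b / 2)"
    have d: "0 < d" "d \<le> 1" "d < m" "d < b" using m b by (auto simp: d_def)
    define C where "C = cball (0::real^4) (m - d) - ball 0 d"
    \<comment> \<open>The pairs of a radius and a point of the annulus at which strict comparison
      fails. Its projection to radii is compact and misses \<open>m\<close> by
      \<open>kelvin_strict\<close>, so slightly larger radii have all their bad points in the two
      small regions.\<close>
    define W where "W = ({m..m + 1} \<times> C) \<inter> (\<lambda>p. kelvin (fst p) (snd p) - u (snd p)) -` {..0}"
    have "compact C" unfolding C_def by (intro compact_diff) auto
    then have compact: "compact ({m..m + 1} \<times> C)" by (intro compact_Times) auto
    have "closed W"
      unfolding W_def
    proof (rule continuous_closed_preimage)
      have "continuous_on ({m..m + 1} \<times> C) (\<lambda>p. kelvin (fst p) (snd p))"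
        by (rule continuous_on_subset[OF kelvin_continuous]) (use m d in \<open>auto simp: C_def\<close>)
      then show "continuous_on ({m..m + 1} \<times> C) (\<lambda>p. kelvin (fst p) (snd p) - u (snd p))"
        by (intro continuous_intros continuous_on_compose2[OF u_continuous]) auto
    qed (use compact in \<open>auto intro: compact_imp_closed\<close>)
    then have "compact W"
      using compact_Int_closed[OF compact, of W] by (simp add: W_def Int_absorb1 Int_assoc)
    then have "closed (fst ` W)"
      by (intro compact_imp_closed compact_continuous_image continuous_intros)
    moreover have "m \<notin> fst ` W"
    proof
      assume "m \<in> fst ` W"
      then obtain y where y: "y \<in> C" "kelvin m y \<le> u y" by (auto simp: W_def)
      then have "u y < kelvin m y"
        using d by (intro kelvin_strict[OF m empty x neq]) (auto simp: C_def)
      then show False using y by simp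
    qed
    ultimately obtain r where r: "0 < r" "ball m r \<subseteq> - fst ` W"
      by (meson ComplI open_Compl open_contains_ball)
    define l where "l = m + min d (r / 2)"
    have l: "m < l" "l \<le> m + d" "l \<le> m + 1" "l \<in> ball m r" using d r by (auto simp: l_def dist_real_def)
    have sub: "bad_set l \<subseteq> ball 0 d \<union> (ball 0 l - ball 0 (m - d))"
    proof
      fix y assume y: "y \<in> bad_set l"
      show "y \<in> ball 0 d \<union> (ball 0 l - ball 0 (m - d))"
      proof (rule ccontr)
        assume "\<not> ?thesis"
        then have "(l, y) \<in> W" using y l by (auto simp: W_def C_def bad_set_def)
        then have "l \<in> fst ` W" by force
        then show False using l r by blast
      qed
    qed
    have fin: "ball (0::real^4) s \<in> fmeasurable lborel" for s
      using emeasure_lborel_ball_finite[of "0::real^4" s] by (auto simp: fmeasurable_def)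
    have "measure lborel (bad_set l) \<le> measure lborel (ball (0::real^4) d \<union> (ball 0 l - ball 0 (m - d)))"
      by (rule measure_mono_fmeasurable[OF sub]) (auto intro!: fmeasurable.Un fmeasurable_Diff fin)
    also have "\<dots> \<le> measure lborel (ball (0::real^4) d) + measure lborel (ball (0::real^4) l - ball 0 (m - d))"
      by (rule measure_Un_le) auto
    also have "measure lborel (ball (0::real^4) l - ball 0 (m - d)) = measure lborel (ball (0::real^4) l) - measure lborel (ball (0::real^4) (m - d))"
    proof -
      have "emeasure lborel (ball (0::real^4) l) \<noteq> \<infinity>"
      using emeasure_lborel_ball_finite[of "0::real^4" l] by (simp add: less_top)
      then show ?thesis using l d by (intro measure_Diff) auto
    qed
    also have "measure lborel (ball (0::real^4) d) + \<dots> = pi\<^sup>2 / 2 * d ^ 4 + (pi\<^sup>2 / 2 * l ^ 4 - pi\<^sup>2 / 2 * (m - d) ^ 4)"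
      using d l m by (simp add: measure_ball_4)
    also have "\<dots> \<le> pi\<^sup>2 / 2 * d ^ 4 + (pi\<^sup>2 / 2 * (m + d) ^ 4 - pi\<^sup>2 / 2 * (m - d) ^ 4)"
      using l m by (intro add_left_mono diff_right_mono mult_left_mono power_mono) auto
    also have "\<dots> < \<epsilon>" using b d by simp
    finally have "bad_set l = {}" using \<epsilon>(2)[of l] l m by simp
    then have "l \<in> A" using l m by (simp add: A_def)
    then have "l \<le> m" unfolding m_def by (rule cSup_upper[OF _ bdd])
    then show False using l by simp
  qed
  have "u x = kelvin m x" if x: "x \<noteq> 0" for x
  proof -
    have nx: "0 < norm x" using x by simp
    consider "norm x < m" | "norm x = m" | "m < norm x" by linarith
    then show ?thesis
    proof cases
      case 1
      then show ?thesis by (rule inside[OF x])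
    next
      case 2
      then have "inversion m x = x" "m / norm x = 1" using m by (auto simp: inversion_def)
      then show ?thesis by (simp add: kelvin_def)
    next
      case 3
      have "norm (inversion m x) < m"
        using 3 m nx by (simp add: norm_inversion power2_eq_square divide_less_eq)
      then have "u (inversion m x) = kelvin m (inversion m x)"
        using x m by (intro inside) auto
      also have "\<dots> = u x + (8 - \<alpha>) * ln (norm x / m)"
        using m by (simp add: kelvin_def norm_inversion power2_eq_square)
      also have "ln (norm x / m) = - ln (m / norm x)"
        using m nx by (simp add: ln_divide_pos)
      finally show ?thesis by (simp add: kelvin_def)
    qed
  qed
  then show ?thesis using that m by blast
qed

text \<open>Invariance evaluated along a ray to infinity, where the inverted points tend to the
  origin, turns the asymptotic constant into an equation for the radius.\<close>

theorem kelvin_invariant: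
  obtains l where "0 < l" "(8 - \<alpha>) * ln l = c0 - u 0" "\<And>x. x \<noteq> 0 \<Longrightarrow> u x = u (inversion l x) + (8 - \<alpha>) * ln (l / norm x)"
proof -
  obtain l where l: "0 < l" "\<And>x. x \<noteq> 0 \<Longrightarrow> u x = kelvin l x" by (rule moving_spheres) blast
  obtain e :: "real^4" where e: "norm e = 1" using vector_choose_size[of 1] by auto
  have "(\<lambda>n. u (inversion l (real n *\<^sub>R e)) + (8 - \<alpha>) * ln l) \<longlonglongrightarrow> u 0 + (8 - \<alpha>) * ln l"
    by (intro tendsto_intros u_inversion_ray_tendsto)
  moreover have "eventually (\<lambda>n. u (inversion l (real n *\<^sub>R e)) + (8 - \<alpha>) * ln l = u (real n *\<^sub>R e) + (8 - \<alpha>) * ln (real n)) sequentially"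
    using eventually_gt_at_top[of 0]
  proof eventually_elim
    case (elim n)
    have "real n *\<^sub>R e \<noteq> 0" using elim e by auto
    then have "u (real n *\<^sub>R e) = u (inversion l (real n *\<^sub>R e)) + (8 - \<alpha>) * ln (l / real n)"
      using l(2) e by (simp add: kelvin_def)
    also have "ln (l / real n) = ln l - ln (real n)" using l elim by (intro ln_divide_pos) auto
    finally show ?case by (simp add: right_diff_distrib)
  qed
  ultimately have "(\<lambda>n. u (real n *\<^sub>R e) + (8 - \<alpha>) * ln (real n)) \<longlonglongrightarrow> u 0 + (8 - \<alpha>) * ln l"
    by (rule Lim_transform_eventually)
  then have "u 0 + (8 - \<alpha>) * ln l = c0"
    using u_asymptotic[OF e] LIMSEQ_unique by blast
  then show ?thesis using that[OF l(1)] l(2) by (simp add: kelvin_def)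
qed

end

subsection \<open>Classification\<close>

lemma C_order_antimono: "C_order (Suc n) f \<Longrightarrow> C_order n f"
proof (induction n arbitrary: f)
  case 0
  then show ?case
    by (auto intro!: continuous_at_imp_continuous_on differentiable_imp_continuous_within)
next
  case (Suc n)
  then show ?case by simp
qed

lemma partial_deriv_eq:
  assumes "\<And>x. (f has_derivative f' x) (at x)"
  shows "partial_deriv b f = (\<lambda>x. f' x b)"
  using frechet_derivative_at[OF assms] by (auto simp: partial_deriv_def fun_eq_iff)

lemma C_order_SucI:
  assumes "\<And>x. (f has_derivative f' x) (at x)" "\<And>b. b \<in> Basis \<Longrightarrow> C_order n (\<lambda>x. f' x b)"
  shows "C_order (Suc n) f"
  using assms partial_deriv_eq[OF assms(1)] by (auto simp: differentiable_def)

lemma C_order_SucE: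
  assumes "C_order (Suc n) f"
  obtains f' where "\<And>x. (f has_derivative f' x) (at x)" "\<And>b. b \<in> Basis \<Longrightarrow> C_order n (\<lambda>x. f' x b)"
proof
  show *: "(f has_derivative frechet_derivative f (at x)) (at x)" for x
    using assms by (auto simp: frechet_derivative_works[symmetric])
  show "C_order n (\<lambda>x. frechet_derivative f (at x) b)" if "b \<in> Basis" for b
    using assms that by (simp add: partial_deriv_def[abs_def])
qed

lemma C_order_const: "C_order n (\<lambda>x. c)"
proof (induction n arbitrary: c)
  case (Suc n)
  show ?case by (rule C_order_SucI[where f' = "\<lambda>x h. 0"]) (auto intro: Suc)
qed simp

lemma C_order_add: "C_order n f \<Longrightarrow> C_order n g \<Longrightarrow> C_order n (\<lambda>x. f x + g x)"
proof (induction n arbitrary: f g)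
  case 0
  then show ?case by (auto intro: continuous_intros)
next
  case (Suc n)
  obtain f' where f: "\<And>x. (f has_derivative f' x) (at x)" "\<And>b. b \<in> Basis \<Longrightarrow> C_order n (\<lambda>x. f' x b)"
    using Suc.prems(1) by (rule C_order_SucE) blast
  obtain g' where g: "\<And>x. (g has_derivative g' x) (at x)" "\<And>b. b \<in> Basis \<Longrightarrow> C_order n (\<lambda>x. g' x b)"
    using Suc.prems(2) by (rule C_order_SucE) blast
  show ?case
    by (rule C_order_SucI[where f' = "\<lambda>x h. f' x h + g' x h"])
       (auto intro: Suc.IH f g has_derivative_add)
qed

text \<open>The product rule places the functions themselves next to their derivatives, so order
  \<open>n\<close> of \<open>f\<close> and \<open>g\<close> is needed besides that of the
  derivatives.\<close>

lemma C_order_mult: "C_order n f \<Longrightarrow> C_order n g \<Longrightarrow> C_order n (\<lambda>x. f x * g x)"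
proof (induction n arbitrary: f g)
  case 0
  then show ?case by (auto intro: continuous_intros)
next
  case (Suc n)
  obtain f' where f: "\<And>x. (f has_derivative f' x) (at x)" "\<And>b. b \<in> Basis \<Longrightarrow> C_order n (\<lambda>x. f' x b)"
    using Suc.prems(1) by (rule C_order_SucE) blast
  obtain g' where g: "\<And>x. (g has_derivative g' x) (at x)" "\<And>b. b \<in> Basis \<Longrightarrow> C_order n (\<lambda>x. g' x b)"
    using Suc.prems(2) by (rule C_order_SucE) blast
  show ?case
    by (rule C_order_SucI[where f' = "\<lambda>x h. f x * g' x h + f' x h * g x"])
       (use f g in \<open>auto intro!: C_order_add Suc.IH has_derivative_mult C_order_antimono[OF Suc.prems(1)]
          C_order_antimono[OF Suc.prems(2)] simp del: C_order.simps\<close>)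
qed

lemma C_order_inverse:
  "C_order n f \<Longrightarrow> (\<And>x. f x \<noteq> 0) \<Longrightarrow> C_order n (\<lambda>x. inverse (f x))"
proof (induction n)
  case 0
  then show ?case by (auto intro: continuous_intros)
next
  case (Suc n)
  obtain f' where f: "\<And>x. (f has_derivative f' x) (at x)" "\<And>b. b \<in> Basis \<Longrightarrow> C_order n (\<lambda>x. f' x b)"
    using Suc.prems(1) by (rule C_order_SucE) blast
  have inv: "C_order n (\<lambda>x. inverse (f x))"
    using Suc C_order_antimono by blast
  show ?case
  proof (rule C_order_SucI[where f' = "\<lambda>x h. (- 1) * (inverse (f x) * (f' x h * inverse (f x)))"])
    show "((\<lambda>x. inverse (f x)) has_derivative (\<lambda>h. (- 1) * (inverse (f x) * (f' x h * inverse (f x))))) (at x)" for x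
      using Deriv.has_derivative_inverse[OF Suc.prems(2) f(1)] by (simp add: mult.assoc)
    show "C_order n (\<lambda>x. (- 1) * (inverse (f x) * (f' x b * inverse (f x))))" if "b \<in> Basis" for b
      by (intro C_order_mult C_order_const inv f(2) that)
  qed
qed

lemma C_order_ln:
  assumes "C_order n f" "\<And>x. 0 < f x"
  shows "C_order n (\<lambda>x. ln (f x))"
proof (cases n)
  case 0
  then show ?thesis using assms by (auto intro!: continuous_intros simp: less_imp_neq[symmetric])
next
  case (Suc k)
  obtain f' where f: "\<And>x. (f has_derivative f' x) (at x)" "\<And>b. b \<in> Basis \<Longrightarrow> C_order k (\<lambda>x. f' x b)"
    using assms(1) unfolding Suc by (rule C_order_SucE) blast
  have inv: "C_order k (\<lambda>x. inverse (f x))"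
    using assms C_order_antimono[of k f] by (intro C_order_inverse) (auto simp: Suc less_imp_neq[symmetric])
  show ?thesis
    unfolding Suc
  proof (rule C_order_SucI[where f' = "\<lambda>x h. f' x h * inverse (f x)"])
    show "((\<lambda>x. ln (f x)) has_derivative (\<lambda>h. f' x h * inverse (f x))) (at x)" for x
      using has_derivative_ln[OF assms(2) f(1)] by (simp add: divide_inverse)
    show "C_order k (\<lambda>x. f' x b * inverse (f x))" if "b \<in> Basis" for b
      by (intro C_order_mult inv f(2) that)
  qed
qed

lemma C_order_affine: "C_order n (\<lambda>x. (x - a) \<bullet> b)"
proof (cases n)
  case 0
  then show ?thesis by (auto intro!: continuous_intros)
next
  case (Suc k)
  show ?thesis unfolding Suc
    by (rule C_order_SucI[where f' = "\<lambda>x h. h \<bullet> b"]) (auto intro!: derivative_eq_intros C_order_const)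
qed

lemma C_order_norm_square: "C_order n (\<lambda>x. (norm (x - a))\<^sup>2)"
proof (cases n)
  case 0
  then show ?thesis by (auto intro!: continuous_intros)
next
  case (Suc k)
  show ?thesis unfolding Suc power2_norm_eq_inner
  proof (rule C_order_SucI[where f' = "\<lambda>x h. 2 * ((x - a) \<bullet> h)"])
    show "((\<lambda>x. (x - a) \<bullet> (x - a)) has_derivative (\<lambda>h. 2 * ((x - a) \<bullet> h))) (at x)" for x
      by (auto intro!: derivative_eq_intros simp: inner_commute)
    show "C_order k (\<lambda>x. 2 * ((x - a) \<bullet> b))" for b
      by (intro C_order_mult C_order_const C_order_affine)
  qed
qed

lemma C_infinity_bubble:
  assumes "0 < C_const \<alpha>" "0 < \<mu>"
  shows "C_infinity (bubble \<alpha> \<mu> \<zeta>)"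
proof -
  have pos: "0 < 1 + \<mu>\<^sup>2 * (norm (x - \<zeta>))\<^sup>2" for x by (intro add_pos_nonneg) auto
  have "bubble \<alpha> \<mu> \<zeta> = (\<lambda>x. (8 - \<alpha>) / 2 * (ln (C_const \<alpha> * \<mu>) + (- 1) * ln (1 + \<mu>\<^sup>2 * (norm (x - \<zeta>))\<^sup>2)))"
    using assms pos by (auto simp: bubble_def fun_eq_iff ln_divide_pos)
  moreover have "C_order n (\<lambda>x. (8 - \<alpha>) / 2 * (ln (C_const \<alpha> * \<mu>) + (- 1) * ln (1 + \<mu>\<^sup>2 * (norm (x - \<zeta>))\<^sup>2)))" for n
    by (intro C_order_mult C_order_add C_order_const C_order_ln C_order_norm_square pos)
  ultimately show ?thesis by (simp add: C_infinity_def)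
qed

lemma nn_integral_bubble_profile:
  fixes \<zeta> :: "real^4"
  assumes s: "2 < s" and \<mu>: "0 < \<mu>"
  shows "(\<integral>\<^sup>+x. ennreal ((1 + \<mu>\<^sup>2 * (norm (x - \<zeta>))\<^sup>2) powr (-s)) \<partial>lborel) = ennreal (pi\<^sup>2 / (\<mu> ^ 4 * ((s - 1) * (s - 2))))"
proof -
  define g where "g r = (1 + r\<^sup>2) powr (-s)" for r :: real
  have [measurable]: "g \<in> borel_measurable borel" unfolding g_def[abs_def] by measurable
  have pos: "0 < 1 + r\<^sup>2" for r :: real by (intro add_pos_nonneg) auto
  \<comment> \<open>Writing \<open>r\<^sup>2\<close> as \<open>(1 + r\<^sup>2) - 1\<close> splits
    the radial integrand into two pure powers. This antiderivative vanishes at infinity because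
    \<open>s > 2\<close>.\<close>
  define G where "G r = pi\<^sup>2 * ((1 + r\<^sup>2) powr (2 - s) / (2 - s) - (1 + r\<^sup>2) powr (1 - s) / (1 - s))" for r :: real
  have "(\<integral>\<^sup>+x. ennreal ((1 + \<mu>\<^sup>2 * (norm (x - \<zeta>))\<^sup>2) powr (-s)) \<partial>lborel)
     = ennreal (\<bar>1 / \<mu>\<bar> ^ DIM(real^4)) * (\<integral>\<^sup>+x. ennreal ((1 + \<mu>\<^sup>2 * (norm (\<zeta> + (1 / \<mu>) *\<^sub>R x - \<zeta>))\<^sup>2) powr (-s)) \<partial>lborel)"
    using \<mu> by (intro nn_integral_dilation) auto
  also have "(\<integral>\<^sup>+x. ennreal ((1 + \<mu>\<^sup>2 * (norm (\<zeta> + (1 / \<mu>) *\<^sub>R x - \<zeta>))\<^sup>2) powr (-s)) \<partial>lborel) = (\<integral>\<^sup>+x. ennreal (g (norm (x::real^4))) \<partial>lborel)"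
    using \<mu> by (intro nn_integral_cong) (simp add: g_def power_divide)
  also have "\<dots> = (\<integral>\<^sup>+r. ennreal (2 * pi\<^sup>2 * r ^ 3) * indicator {0..} r * ennreal (g r) \<partial>lborel)"
    by (rule nn_integral_radial) measurable
  also have "\<dots> = (\<integral>\<^sup>+r. ennreal (2 * pi\<^sup>2 * r ^ 3 * g r) * indicator {0..} r \<partial>lborel)"
    by (intro nn_integral_cong) (auto simp: indicator_def ennreal_mult g_def)
  also have "\<dots> = ennreal (0 - G 0)"
  proof (rule nn_integral_FTC_atLeast)
    show "(G has_real_derivative 2 * pi\<^sup>2 * r ^ 3 * g r) (at r)" for r
    proof -
      have d: "((\<lambda>r. 1 + r\<^sup>2) has_real_derivative 2 * r) (at r)" by (auto intro!: derivative_eq_intros)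
      have p: "((\<lambda>r. (1 + r\<^sup>2) powr a) has_real_derivative a * (1 + r\<^sup>2) powr (a - 1) * (2 * r)) (at r)" for a
        using DERIV_fun_powr[OF d pos, of a] by simp
      have "(G has_real_derivative pi\<^sup>2 * ((2 - s) * (1 + r\<^sup>2) powr (2 - s - 1) * (2 * r) / (2 - s)
          - (1 - s) * (1 + r\<^sup>2) powr (1 - s - 1) * (2 * r) / (1 - s))) (at r)"
        unfolding G_def[abs_def] by (intro DERIV_cmult DERIV_diff DERIV_cdivide p)
      moreover have "(2 - s) * (1 + r\<^sup>2) powr (2 - s - 1) * (2 * r) / (2 - s) = (1 + r\<^sup>2) * g r * (2 * r)"
      proof -
        have "(1 + r\<^sup>2) powr (2 - s - 1) = (1 + r\<^sup>2) powr 1 * g r"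
          unfolding g_def powr_add[symmetric] by simp
        then show ?thesis using s pos[of r] by simp
      qed
      moreover have "(1 - s) * (1 + r\<^sup>2) powr (1 - s - 1) * (2 * r) / (1 - s) = g r * (2 * r)"
        using s by (simp add: g_def)
      ultimately have "(G has_real_derivative pi\<^sup>2 * ((1 + r\<^sup>2) * g r * (2 * r) - g r * (2 * r))) (at r)"
        by (simp only:)
      moreover have "pi\<^sup>2 * ((1 + r\<^sup>2) * g r * (2 * r) - g r * (2 * r)) = 2 * pi\<^sup>2 * r ^ 3 * g r"
        by (simp add: algebra_simps power2_eq_square power3_eq_cube)
      ultimately show ?thesis by (simp only:)
    qed
    have lim: "((\<lambda>r. (1 + r\<^sup>2) powr a) \<longlongrightarrow> 0) at_top" if "a < 0" for a :: real
    proof (rule tendsto_neg_powr[OF that])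
      show "filterlim (\<lambda>r::real. 1 + r\<^sup>2) at_top at_top"
        by (intro filterlim_tendsto_add_at_top[OF tendsto_const] filterlim_pow_at_top filterlim_ident) auto
    qed
    have "(G \<longlongrightarrow> pi\<^sup>2 * (0 / (2 - s) - 0 / (1 - s))) at_top"
      unfolding G_def[abs_def] using s by (intro tendsto_intros lim) auto
    then show "(G \<longlongrightarrow> 0) at_top" by simp
  qed (use pos in \<open>auto simp: g_def\<close>)
  also have "0 - G 0 = pi\<^sup>2 / ((s - 1) * (s - 2))"
    using s by (simp add: G_def divide_simps) (simp add: algebra_simps)
  also have "ennreal (\<bar>1 / \<mu>\<bar> ^ DIM(real^4)) * ennreal (pi\<^sup>2 / ((s - 1) * (s - 2))) = ennreal (pi\<^sup>2 / (\<mu> ^ 4 * ((s - 1) * (s - 2))))"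
    using s \<mu> by (simp add: ennreal_mult[symmetric] power_divide)
  finally show ?thesis .
qed

section \<open>Recentring and the invariance radius\<close>

lemma riesz_translate:
  assumes [measurable]: "u \<in> borel_measurable borel"
  shows "riesz \<alpha> (\<lambda>x. u (x + a)) x = riesz \<alpha> u (x + a)"
  unfolding riesz_def
  using integral_translation[of "\<lambda>y. exp (u y) * norm (x + a - y) powr (-\<alpha>)" a] by simp

lemma source_translate:
  assumes "u \<in> borel_measurable borel"
  shows "source \<alpha> (\<lambda>x. u (x + a)) x = source \<alpha> u (x + a)"
  using riesz_translate[OF assms] by (simp add: source_def)

context choquard_solution
begin

lemma translate: "choquard_solution \<alpha> c0 (\<lambda>x. u (x + a))"
proof
  show "0 < \<alpha>" "\<alpha> < 4" by (rule \<alpha>)+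
  show "(\<lambda>x. u (x + a)) \<in> borel_measurable borel" by measurable
  show "integrable lborel (source \<alpha> (\<lambda>x. u (x + a)))"
    unfolding source_translate[OF u_meas, abs_def] using F_int by (simp add: integrable_translation_iff)
  show "integrable lborel (\<lambda>y. ln (norm (x - y)) * source \<alpha> (\<lambda>x. u (x + a)) y)" for x
    unfolding source_translate[OF u_meas]
    using lnF_int[of "x + a"] integrable_translation_iff[of "\<lambda>y. ln (norm (x + a - y)) * F y" a] by simp
  show "u (x + a) = - (1 / (8 * pi\<^sup>2)) * (\<integral>y. ln (norm (x - y)) * source \<alpha> (\<lambda>x. u (x + a)) y \<partial>lborel) + c0" for x
    unfolding source_translate[OF u_meas]
    using u_eq[of "x + a"] integral_translation[of "\<lambda>y. ln (norm (x + a - y)) * F y" a] by simp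
  show "integrable lborel (\<lambda>x. exp (8 / (8 - \<alpha>) * u (x + a)))"
    using Ep_int by (subst integrable_translation_iff[of "\<lambda>x. exp (8 / (8 - \<alpha>) * u x)"]) auto
qed

text \<open>The equation of \<open>kelvin_invariant\<close> solved for the radius, with
  \<open>u x\<close> in place of \<open>u 0\<close>. It gives the invariance radius at every centre
  because translates share \<open>c0\<close>.\<close>

definition radius :: "real^4 \<Rightarrow> real" where
  "radius x = exp ((c0 - u x) / (8 - \<alpha>))"

lemma radius_measurable [measurable]: "radius \<in> borel_measurable borel"
  unfolding radius_def[abs_def] by measurable

lemma radius_pos: "0 < radius x"
  by (simp add: radius_def)

lemma exp_u_radius: "exp (u x) = exp c0 * radius x powr (- (8 - \<alpha>))"
proof -
  have "- (8 - \<alpha>) * ((c0 - u x) / (8 - \<alpha>)) = u x - c0" using \<alpha> by (simp add: field_simps)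
  then have "radius x powr (- (8 - \<alpha>)) = exp (u x - c0)"
    using radius_pos[of x] by (simp add: powr_def radius_def)
  then show ?thesis by (simp add: exp_diff)
qed

text \<open>The square of \<open>radius\<close> is multiplied by the conformal factor
  \<open>(l / norm x)\<^sup>2\<close> of the inversion. Every power of \<open>radius\<close>
  therefore has a definite conformal weight.\<close>

lemma radius_inversion:
  assumes "x \<noteq> 0"
  shows "radius (inversion (radius 0) x) = radius x * radius 0 / norm x"
proof -
  obtain l where l: "0 < l" "(8 - \<alpha>) * ln l = c0 - u 0"
    "\<And>x. x \<noteq> 0 \<Longrightarrow> u x = u (inversion l x) + (8 - \<alpha>) * ln (l / norm x)"
    by (rule kelvin_invariant) blast
  have "ln l = (c0 - u 0) / (8 - \<alpha>)" using l(2) \<alpha> by (simp add: field_simps)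
  then have r: "radius 0 = l" unfolding radius_def using l(1) by (metis exp_ln)
  have "(c0 - u (inversion l x)) / (8 - \<alpha>) = (c0 - u x) / (8 - \<alpha>) + ln (l / norm x)"
    using l(3)[OF assms] \<alpha> by (simp add: field_simps)
  then have "radius (inversion l x) = radius x * exp (ln (l / norm x))"
    unfolding radius_def exp_add[symmetric] by simp
  then show ?thesis using assms l(1) by (simp add: r)
qed

text \<open>Invariance of \<open>u\<close> under the inversion centred at \<open>0\<close> evaluates conformally weighted integrals
  in terms of \<open>radius 0\<close>. The weight with exponent \<open>10\<close> is the one paired with the kernel
  \<open>(norm y)\<^sup>2\<close>, a polynomial; that is what forces \<open>(radius x)\<^sup>2\<close> to be quadratic in \<open>x\<close>.\<close>

lemma second_moment_0:
  "(\<integral>\<^sup>+y. ennreal ((norm y)\<^sup>2 * radius y powr (-10)) \<partial>lborel)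
     = ennreal ((radius 0)\<^sup>2) * (\<integral>\<^sup>+y. ennreal (radius y powr (-10)) \<partial>lborel)"
proof -
  define l where "l = radius 0"
  have l: "0 < l" by (simp add: l_def radius_pos)
  have "(\<integral>\<^sup>+y. ennreal ((norm y)\<^sup>2 * radius y powr (-10)) \<partial>lborel)
    = (\<integral>\<^sup>+y. ennreal ((l / norm y) ^ 8) * ennreal ((norm (inversion l y))\<^sup>2 * radius (inversion l y) powr (-10)) \<partial>lborel)"
    by (rule nn_integral_inversion[OF l]) measurable
  also have "\<dots> = (\<integral>\<^sup>+y. ennreal (l\<^sup>2) * ennreal (radius y powr (-10)) \<partial>lborel)"
  proof (rule nn_integral_cong_AE)
    show "AE y in lborel. ennreal ((l / norm y) ^ 8) * ennreal ((norm (inversion l y))\<^sup>2 * radius (inversion l y) powr (-10))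
        = ennreal (l\<^sup>2) * ennreal (radius y powr (-10))"
      using AE_lborel_neq[of 0]
    proof eventually_elim
      case (elim y)
      define n where "n = norm y"
      have n: "0 < n" using elim by (simp add: n_def)
      have req: "radius (inversion l y) = radius y * (l / n)"
        using radius_inversion[OF elim] by (simp add: l_def n_def)
      have "radius (inversion l y) powr (-10) = radius y powr (-10) * (l / n) powr (-10)"
        unfolding req by (rule powr_mult)
      also have "(l / n) powr (-10) = (n / l) ^ 10"
        using n l by (simp add: powr_minus powr_divide power_divide)
      finally have r: "radius (inversion l y) powr (-10) = radius y powr (-10) * (n / l) ^ 10" .
      \<comment> \<open>Jacobian, squared norm and weight contribute the exponents 8, 2 and -10 of
        \<open>l / n\<close>, which cancel; one \<open>l\<^sup>2\<close> from the norm is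
        left.\<close>
      have "(l / n) ^ 8 * ((l\<^sup>2 / n)\<^sup>2 * (R * (n / l) ^ 10)) = l\<^sup>2 * R" for R
        using n l by (simp add: power_divide field_simps eval_nat_numeral)
      then show ?case unfolding norm_inversion r n_def[symmetric] using l n
        by (simp add: ennreal_mult[symmetric])
    qed
  qed
  also have "\<dots> = ennreal (l\<^sup>2) * (\<integral>\<^sup>+y. ennreal (radius y powr (-10)) \<partial>lborel)"
    by (rule nn_integral_cmult) measurable
  finally show ?thesis by (simp add: l_def)
qed

text \<open>Again the exponents cancel: 8 from the Jacobian, \<open>- (8 - \<alpha>)\<close> from
  \<open>exp u\<close> and \<open>- \<alpha>\<close> from the kernel. So \<open>V\<close> is a power
  of the radius, and the nonlocal factor becomes explicit.\<close>

lemma V_0: "ennreal (V 0) = ennreal (radius 0 powr (-\<alpha>)) * (\<integral>\<^sup>+y. ennreal (exp (u y)) \<partial>lborel)"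
proof -
  define l where "l = radius 0"
  have l: "0 < l" by (simp add: l_def radius_pos)
  have "ennreal (V 0) = (\<integral>\<^sup>+y. ennreal (exp (u y) * norm y powr (-\<alpha>)) \<partial>lborel)"
    unfolding riesz_def using V_integrable[of 0] by (subst nn_integral_eq_integral) auto
  also have "\<dots> = (\<integral>\<^sup>+y. ennreal ((l / norm y) ^ 8) * ennreal (exp (u (inversion l y)) * norm (inversion l y) powr (-\<alpha>)) \<partial>lborel)"
    by (rule nn_integral_inversion[OF l]) measurable
  also have "\<dots> = (\<integral>\<^sup>+y. ennreal (l powr (-\<alpha>)) * ennreal (exp (u y)) \<partial>lborel)"
  proof (rule nn_integral_cong_AE)
    show "AE y in lborel. ennreal ((l / norm y) ^ 8) * ennreal (exp (u (inversion l y)) * norm (inversion l y) powr (-\<alpha>))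
        = ennreal (l powr (-\<alpha>)) * ennreal (exp (u y))"
      using AE_lborel_neq[of 0]
    proof eventually_elim
      case (elim y)
      define q where "q = l / norm y"
      have q: "0 < q" using elim l by (simp add: q_def)
      have "radius (inversion l y) = radius y * q"
        using radius_inversion[OF elim] by (simp add: l_def q_def)
      then have "exp (u (inversion l y)) = exp (u y) * q powr (- (8 - \<alpha>))"
        using q radius_pos[of y] by (simp add: exp_u_radius powr_mult)
      moreover have "norm (inversion l y) = l * q" by (simp add: norm_inversion q_def power2_eq_square)
      then have "norm (inversion l y) powr (-\<alpha>) = l powr (-\<alpha>) * q powr (-\<alpha>)" using l q by (simp add: powr_mult)
      moreover have "q ^ 8 * (q powr (- (8 - \<alpha>)) * q powr (-\<alpha>)) = 1"
        unfolding powr_add[symmetric] using q by (simp add: powr_minus)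
      ultimately have "q ^ 8 * (exp (u (inversion l y)) * norm (inversion l y) powr (-\<alpha>)) = l powr (-\<alpha>) * exp (u y)"
        by (simp add: algebra_simps)
      then show ?case using q by (simp add: ennreal_mult[symmetric] q_def[symmetric])
    qed
  qed
  also have "\<dots> = ennreal (l powr (-\<alpha>)) * (\<integral>\<^sup>+y. ennreal (exp (u y)) \<partial>lborel)"
    by (rule nn_integral_cmult) measurable
  finally show ?thesis by (simp add: l_def)
qed

text \<open>The upper bound on \<open>u\<close> is a positive lower bound on \<open>radius\<close>;
  used at the inverted point, it turns into linear growth.\<close>

lemma radius_lower:
  obtains k where "0 < k" "\<And>x. k \<le> radius x" "\<And>x. k * norm x \<le> radius x"
proof -
  obtain M where M: "\<And>x. u x \<le> M" by (rule u_bounded_above) blast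
  define m where "m = exp ((c0 - M) / (8 - \<alpha>))"
  have m: "0 < m" "m \<le> radius x" for x
    using M[of x] \<alpha> by (auto simp: m_def radius_def divide_right_mono)
  define k where "k = min m (m / radius 0)"
  have "k * norm x \<le> radius x" for x
  proof (cases "x = 0")
    case False
    have "m \<le> radius (inversion (radius 0) x)" by (rule m)
    also have "\<dots> = radius x * radius 0 / norm x" by (rule radius_inversion[OF False])
    finally have "m / radius 0 * norm x \<le> radius x"
      using False radius_pos[of 0] by (simp add: field_simps)
    moreover have "k * norm x \<le> m / radius 0 * norm x" by (intro mult_right_mono) (auto simp: k_def)
    ultimately show ?thesis by linarith
  qed (use radius_pos[of 0] in \<open>simp add: less_imp_le\<close>)
  moreover have "0 < k" using m radius_pos[of 0] by (simp add: k_def)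
  moreover have "k \<le> radius x" for x using m(2)[of x] by (simp add: k_def)
  ultimately show ?thesis using that by blast
qed

text \<open>Linear growth makes the second moment comparable with \<open>norm y powr (-8)\<close> at
  infinity. Finiteness is what permits expanding the square below.\<close>

lemma radius_moments_integrable:
  shows "integrable lborel (\<lambda>y. radius y powr (-10))"
    and "integrable lborel (\<lambda>y. (norm y)\<^sup>2 * radius y powr (-10))"
proof -
  obtain k where k: "0 < k" "\<And>x. k \<le> radius x" "\<And>x. k * norm x \<le> radius x" by (rule radius_lower) blast
  have dom: "integrable lborel (\<lambda>y::real^4. k powr (-10) * (norm (0 - y) powr (-8) * indicator (- ball 0 1) y) + k powr (-10) * indicator (ball 0 1) y)"
    using power_kernel_tail[of 8 1 0] by (intro Bochner_Integration.integrable_add integrable_mult_right) (auto simp: has_bochner_integral_iff)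
  have b: "(1 + (norm y)\<^sup>2) * radius y powr (-10) \<le> 2 * (k powr (-10) * (norm (0 - y) powr (-8) * indicator (- ball 0 1) y) + k powr (-10) * indicator (ball 0 1) y)" for y
  proof (cases "norm y < 1")
    case True
    have "radius y powr (-10) \<le> k powr (-10)" using k by (intro powr_mono2') auto
    moreover have "1 + (norm y)\<^sup>2 \<le> 2" using True by (simp add: power_le_one)
    ultimately have "(1 + (norm y)\<^sup>2) * radius y powr (-10) \<le> 2 * k powr (-10)" by (intro mult_mono) auto
    then show ?thesis using True by simp
  next
    case False
    then have y: "1 \<le> norm y" by simp
    have "0 < k * norm y" using k(1) y by (intro mult_pos_pos) linarith+
    then have "radius y powr (-10) \<le> (k * norm y) powr (-10)" using k by (intro powr_mono2') auto
    also have "\<dots> = k powr (-10) * norm y powr (-10)" using k y by (simp add: powr_mult)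
    finally have 1: "radius y powr (-10) \<le> k powr (-10) * norm y powr (-10)" .
    have "1 + (norm y)\<^sup>2 \<le> 2 * (norm y)\<^sup>2" using y by (simp add: one_le_power)
    then have "(1 + (norm y)\<^sup>2) * radius y powr (-10) \<le> (2 * (norm y)\<^sup>2) * (k powr (-10) * norm y powr (-10))"
      using 1 by (intro mult_mono) auto
    also have "\<dots> = 2 * (k powr (-10) * ((norm y)\<^sup>2 * norm y powr (-10)))" by simp
    also have "(norm y)\<^sup>2 * norm y powr (-10) = norm y powr (-8)"
    proof -
      have "norm y powr (-8) = norm y powr 2 * norm y powr (-10)" unfolding powr_add[symmetric] by simp
      moreover have "y \<noteq> 0" using y by auto
      ultimately show ?thesis by simp
    qed
    finally show ?thesis using False by simp
  qed
  have "\<bar>z * radius y powr (-10)\<bar> \<le> \<bar>2 * (k powr (-10) * (norm (0 - y) powr (-8) * indicator (- ball 0 1) y) + k powr (-10) * indicator (ball 0 1) y)\<bar>"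
    if "0 \<le> z" "z \<le> 1 + (norm y)\<^sup>2" for z y
  proof -
    have "z * radius y powr (-10) \<le> (1 + (norm y)\<^sup>2) * radius y powr (-10)" using that by (intro mult_right_mono) auto
    moreover have "0 \<le> z * radius y powr (-10)" using that by simp
    ultimately show ?thesis using b[of y] by linarith
  qed note bd = this
  show "integrable lborel (\<lambda>y. radius y powr (-10))"
    by (rule Bochner_Integration.integrable_bound[OF integrable_mult_right[OF dom, of 2]])
       (use bd[of 1] in \<open>auto intro!: AE_I2\<close>)
  show "integrable lborel (\<lambda>y. (norm y)\<^sup>2 * radius y powr (-10))"
    by (rule Bochner_Integration.integrable_bound[OF integrable_mult_right[OF dom, of 2]])
       (use bd in \<open>auto intro!: AE_I2\<close>)
qed

lemma second_moment:
  "(\<integral>y. (norm (x - y))\<^sup>2 * radius y powr (-10) \<partial>lborel) = (radius x)\<^sup>2 * (\<integral>y. radius y powr (-10) \<partial>lborel)"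
proof -
  interpret T: choquard_solution \<alpha> c0 "\<lambda>y. u (y + x)" by (rule translate)
  have rad: "T.radius y = radius (y + x)" for y by (simp add: T.radius_def radius_def)
  have "ennreal ((radius x)\<^sup>2 * (\<integral>y. radius y powr (-10) \<partial>lborel))
      = ennreal ((radius x)\<^sup>2) * (\<integral>\<^sup>+y. ennreal (radius y powr (-10)) \<partial>lborel)"
    using radius_moments_integrable(1) by (simp add: ennreal_mult nn_integral_eq_integral)
  also have "(\<integral>\<^sup>+y. ennreal (radius y powr (-10)) \<partial>lborel) = (\<integral>\<^sup>+y. ennreal (radius (y + x) powr (-10)) \<partial>lborel)"
    by (rule nn_integral_translation[symmetric]) measurable
  also have "ennreal ((radius x)\<^sup>2) * \<dots> = (\<integral>\<^sup>+y. ennreal ((norm y)\<^sup>2 * radius (y + x) powr (-10)) \<partial>lborel)"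
    using T.second_moment_0 by (simp add: rad)
  also have "\<dots> = ennreal (\<integral>y. (norm y)\<^sup>2 * radius (y + x) powr (-10) \<partial>lborel)"
    using T.radius_moments_integrable(2) by (simp add: rad nn_integral_eq_integral)
  also have "(\<integral>y. (norm y)\<^sup>2 * radius (y + x) powr (-10) \<partial>lborel) = (\<integral>y. (norm (x - y))\<^sup>2 * radius y powr (-10) \<partial>lborel)"
    using integral_translation[of "\<lambda>y. (norm (x - y))\<^sup>2 * radius y powr (-10)" x] by simp
  finally show ?thesis
    by (subst (asm) ennreal_inj) (auto intro!: mult_nonneg_nonneg Bochner_Integration.integral_nonneg)
qed

text \<open>Expanding \<open>(norm (x - y))\<^sup>2\<close> under the integral makes the moment a
  quadratic polynomial in \<open>x\<close> with leading coefficient \<open>m\<close>. Dividing by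
  \<open>m\<close> and completing the square gives centre and offset; the offset is
  \<open>(radius \<zeta>)\<^sup>2\<close> and hence positive.\<close>

lemma radius_quadratic:
  obtains \<zeta> d where "0 < d" "\<And>x. (radius x)\<^sup>2 = d + (norm (x - \<zeta>))\<^sup>2"
proof -
  define w where "w y = radius y powr (-10)" for y
  have w: "0 < w y" for y using radius_pos[of y] by (simp add: w_def)
  have [measurable]: "w \<in> borel_measurable borel" unfolding w_def[abs_def] by measurable
  have int: "integrable lborel w" "integrable lborel (\<lambda>y. (norm y)\<^sup>2 * w y)"
    using radius_moments_integrable by (simp_all add: w_def[abs_def])
  have int1: "integrable lborel (\<lambda>y. w y *\<^sub>R y)"
  proof (rule Bochner_Integration.integrable_bound)
    show "integrable lborel (\<lambda>y. w y + (norm y)\<^sup>2 * w y)" using int by simp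
    have "norm (w y *\<^sub>R y) \<le> norm (w y + (norm y)\<^sup>2 * w y)" for y
    proof -
      have "0 \<le> (norm y - 1)\<^sup>2" by simp
      then have "2 * norm y \<le> 1 + (norm y)\<^sup>2" by (simp add: power2_diff)
      then have "norm y \<le> 1 + (norm y)\<^sup>2" using norm_ge_zero[of y] by linarith
      from mult_left_mono[OF this less_imp_le[OF w[of y]]]
      show ?thesis using w[of y] by (simp add: algebra_simps)
    qed
    then show "AE y in lborel. norm (w y *\<^sub>R y) \<le> norm (w y + (norm y)\<^sup>2 * w y)" by simp
  qed measurable
  define m where "m = (\<integral>y. w y \<partial>lborel)"
  have m: "0 < m" unfolding m_def by (rule integral_lborel_pos[where a = 0, OF int(1)]) (use w less_imp_le in auto)
  define v where "v = (\<integral>y. w y *\<^sub>R y \<partial>lborel)"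
  define s where "s = (\<integral>y. (norm y)\<^sup>2 * w y \<partial>lborel)"
  have inner: "integrable lborel (\<lambda>y. x \<bullet> (w y *\<^sub>R y))" "(\<integral>y. x \<bullet> (w y *\<^sub>R y) \<partial>lborel) = x \<bullet> v" for x
    unfolding v_def by (intro integrable_inner_right int1, rule integral_inner_right, rule int1)
  have q: "(radius x)\<^sup>2 * m = (norm x)\<^sup>2 * m - 2 * (x \<bullet> v) + s" for x
  proof -
    have "(radius x)\<^sup>2 * m = (\<integral>y. (norm (x - y))\<^sup>2 * w y \<partial>lborel)"
      using second_moment[of x] by (simp add: m_def w_def)
    also have "\<dots> = (\<integral>y. ((norm x)\<^sup>2 * w y - 2 * (x \<bullet> (w y *\<^sub>R y))) + (norm y)\<^sup>2 * w y \<partial>lborel)"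
      by (intro Bochner_Integration.integral_cong) (auto simp: power2_norm_eq_inner inner_diff inner_commute algebra_simps)
    also have "\<dots> = ((norm x)\<^sup>2 * m - 2 * (x \<bullet> v)) + s"
    proof -
      define h where "h y = x \<bullet> (w y *\<^sub>R y)" for y
      have "integrable lborel h" "(\<integral>y. h y \<partial>lborel) = x \<bullet> v" using inner[of x] by (simp_all only: h_def[abs_def])
      then show ?thesis unfolding h_def[symmetric] using int by (simp add: m_def s_def)
    qed
    finally show ?thesis .
  qed
  define \<zeta> where "\<zeta> = (1 / m) *\<^sub>R v"
  have v: "v = m *\<^sub>R \<zeta>" using m by (simp add: \<zeta>_def)
  define d where "d = s / m - (norm \<zeta>)\<^sup>2"
  have "(radius x)\<^sup>2 = d + (norm (x - \<zeta>))\<^sup>2" for x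
  proof -
    have "(radius x)\<^sup>2 * m = m * (d + (norm (x - \<zeta>))\<^sup>2)"
      unfolding q[of x] v d_def using m
      by (simp add: power2_norm_eq_inner inner_diff inner_commute algebra_simps)
    then show ?thesis using m by simp
  qed
  moreover from this[of \<zeta>] have "0 < d" using radius_pos[of \<zeta>] by (simp add: zero_less_power2) (metis zero_less_power)
  ultimately show ?thesis using that by blast
qed

lemma V_radius: "ennreal (V x) = ennreal (radius x powr (-\<alpha>)) * (\<integral>\<^sup>+y. ennreal (exp (u y)) \<partial>lborel)"
proof -
  interpret T: choquard_solution \<alpha> c0 "\<lambda>y. u (y + x)" by (rule translate)
  have "T.radius 0 = radius x" by (simp add: T.radius_def radius_def)
  moreover have "T.V 0 = V x" using riesz_translate[OF u_meas, of \<alpha> x 0] by simp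
  moreover have "(\<integral>\<^sup>+y. ennreal (exp (u (y + x))) \<partial>lborel) = (\<integral>\<^sup>+y. ennreal (exp (u y)) \<partial>lborel)"
    by (rule nn_integral_translation) measurable
  ultimately show ?thesis using T.V_0 by simp
qed

lemma mass_eq: "mass = 8 * pi\<^sup>2 * (8 - \<alpha>)"
  using slope_eq by (simp add: slope_def field_simps)

theorem u_eq_bubble:
  obtains \<mu> \<zeta> where "0 < \<mu>" "u = bubble \<alpha> \<mu> \<zeta>"
proof -
  obtain \<zeta> d where d: "0 < d" "\<And>x. (radius x)\<^sup>2 = d + (norm (x - \<zeta>))\<^sup>2"
    by (rule radius_quadratic) blast
  \<comment> \<open>This choice writes \<open>(radius x)\<^sup>2\<close> as
    \<open>P x / \<mu>\<^sup>2\<close> with the denominator \<open>P\<close> of the bubble.\<close>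
  define \<mu> where "\<mu> = 1 / sqrt d"
  have \<mu>: "0 < \<mu>" "\<mu>\<^sup>2 = 1 / d" using d by (auto simp: \<mu>_def power_divide)
  define \<kappa> where "\<kappa> = (8 - \<alpha>) / 2"
  have \<kappa>: "2 < \<kappa>" using \<alpha> by (simp add: \<kappa>_def)
  define P where "P x = 1 + \<mu>\<^sup>2 * (norm (x - \<zeta>))\<^sup>2" for x
  have P: "0 < P x" for x unfolding P_def by (intro add_pos_nonneg) auto
  have [measurable]: "P \<in> borel_measurable borel" unfolding P_def[abs_def] by measurable
  have rP: "radius x = P x powr (1 / 2) / \<mu>" for x
  proof -
    have "(radius x)\<^sup>2 = P x / \<mu>\<^sup>2" using d \<mu> by (simp add: P_def field_simps)
    also have "\<dots> = (P x powr (1 / 2) / \<mu>)\<^sup>2" using P[of x] by (simp add: power_divide powr_half_sqrt)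
    finally show ?thesis using radius_pos[of x] P[of x] \<mu> by (simp add: power2_eq_iff_nonneg)
  qed
  have rpow: "radius x powr (-b) = \<mu> powr b * P x powr (- (b / 2))" for x b
    unfolding rP using P[of x] \<mu> by (simp add: powr_divide powr_powr powr_minus field_simps)
  define A where "A = exp c0 * \<mu> powr (8 - \<alpha>)"
  have A: "0 < A" using \<mu> by (simp add: A_def)
  have E: "exp (u x) = A * P x powr (-\<kappa>)" for x
    unfolding exp_u_radius rpow A_def \<kappa>_def by (simp add: minus_divide_left)
  define I where "I = A * (pi\<^sup>2 / (\<mu> ^ 4 * ((\<kappa> - 1) * (\<kappa> - 2))))"
  have I0: "0 < I" using A \<mu> \<kappa> by (simp add: I_def)
  have I: "(\<integral>\<^sup>+y. ennreal (exp (u y)) \<partial>lborel) = ennreal I"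
  proof -
    have "(\<integral>\<^sup>+y. ennreal (exp (u y)) \<partial>lborel) = (\<integral>\<^sup>+y. ennreal A * ennreal (P y powr (-\<kappa>)) \<partial>lborel)"
      using A by (intro nn_integral_cong) (simp add: E ennreal_mult)
    also have "\<dots> = ennreal A * (\<integral>\<^sup>+y. ennreal (P y powr (-\<kappa>)) \<partial>lborel)"
      by (rule nn_integral_cmult) measurable
    also have "\<dots> = ennreal I"
      unfolding P_def nn_integral_bubble_profile[OF \<kappa> \<mu>(1)] I_def using A \<kappa> \<mu>
      by (intro ennreal_mult[symmetric]) auto
    finally show ?thesis .
  qed
  have V: "V x = I * \<mu> powr \<alpha> * P x powr (- (\<alpha> / 2))" for x
  proof -
    have "ennreal (V x) = ennreal (radius x powr (-\<alpha>) * I)"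
      unfolding V_radius I using I0 by (simp add: ennreal_mult)
    then have "V x = radius x powr (-\<alpha>) * I" using V_nonneg I0 by (subst (asm) ennreal_inj) auto
    then show ?thesis by (simp add: rpow)
  qed
  have F: "F x = (I * \<mu> powr \<alpha> * A) * P x powr (-4)" for x
  proof -
    have "P x powr (- (\<alpha> / 2)) * P x powr (-\<kappa>) = P x powr (-4)"
      unfolding powr_add[symmetric] by (rule arg_cong[where f = "\<lambda>t. P x powr t"]) (simp add: \<kappa>_def field_simps)
    then show ?thesis by (simp add: source_def V E algebra_simps)
  qed
  \<comment> \<open>The mass is now computed a second time, from the explicit profile. Equating it
    with the Pohozaev value leaves one equation between \<open>A\<close> and \<open>\<mu>\<close>,
    which determines \<open>C_const \<alpha>\<close>.\<close>
  have "ennreal mass = (\<integral>\<^sup>+x. ennreal (I * \<mu> powr \<alpha> * A) * ennreal (P x powr (-4)) \<partial>lborel)"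
    unfolding nn_integral_F[symmetric] using I0 A by (intro nn_integral_cong) (simp add: F ennreal_mult)
  also have "\<dots> = ennreal (I * \<mu> powr \<alpha> * A) * (\<integral>\<^sup>+x. ennreal (P x powr (-4)) \<partial>lborel)"
    by (rule nn_integral_cmult) measurable
  also have "\<dots> = ennreal (I * \<mu> powr \<alpha> * A * (pi\<^sup>2 / (\<mu> ^ 4 * ((4 - 1) * (4 - 2)))))"
  proof -
    have "(\<integral>\<^sup>+x. ennreal (P x powr (-4)) \<partial>lborel) = ennreal (pi\<^sup>2 / (\<mu> ^ 4 * ((4 - 1) * (4 - 2))))"
      unfolding P_def by (rule nn_integral_bubble_profile) (use \<mu> in auto)
    then show ?thesis using \<mu> I0 A by (simp only:) (intro ennreal_mult[symmetric]; simp)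
  qed
  finally have "mass = I * \<mu> powr \<alpha> * A * (pi\<^sup>2 / (\<mu> ^ 4 * ((4 - 1) * (4 - 2))))"
    using mass_nonneg I0 A \<mu> by (subst (asm) ennreal_inj) auto
  moreover define D where "D = (\<kappa> - 1) * (\<kappa> - 2)"
  ultimately have "8 * pi\<^sup>2 * (8 - \<alpha>) = A * (pi\<^sup>2 / (\<mu> ^ 4 * D)) * \<mu> powr \<alpha> * A * (pi\<^sup>2 / (\<mu> ^ 4 * 6))"
    by (simp add: mass_eq I_def D_def)
  also have "\<dots> = (A\<^sup>2 * (\<mu> powr \<alpha> / (\<mu> ^ 4 * \<mu> ^ 4))) * (pi\<^sup>2 * pi\<^sup>2 / (6 * D))"
  proof -
    have "A * (p / (n * D)) * t * A * (p / (n * 6)) = (A\<^sup>2 * (t / (n * n))) * (p * p / (6 * D))" for p n t :: real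
      by (simp add: power2_eq_square ac_simps)
    then show ?thesis .
  qed
  also have "\<mu> ^ 4 * \<mu> ^ 4 = \<mu> ^ 8" by (simp flip: power_add)
  finally have m: "8 * pi\<^sup>2 * (8 - \<alpha>) = (A\<^sup>2 * (\<mu> powr \<alpha> / \<mu> ^ 8)) * (pi\<^sup>2 * pi\<^sup>2 / (6 * D))" .
  have D: "D = (6 - \<alpha>) * (4 - \<alpha>) / 4" by (simp add: D_def \<kappa>_def field_simps)
  have "D \<noteq> 0" using \<kappa> by (simp add: D_def)
  have "X = 48 * D * s / p" if "8 * p * s = X * (p * p / (6 * D))" "p \<noteq> 0" for X p s
    using that \<open>D \<noteq> 0\<close> by (simp add: field_simps)
  from this[OF m] have C: "A\<^sup>2 * (\<mu> powr \<alpha> / \<mu> ^ 8) = 12 * (8 - \<alpha>) * (6 - \<alpha>) * (4 - \<alpha>) / pi\<^sup>2"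
    unfolding D by simp
  \<comment> \<open>The numerator of the bubble: \<open>exp (u x)\<close> is the power
    \<open>\<kappa>\<close> of \<open>a / P x\<close>, so
    \<open>a = C_const \<alpha> * \<mu>\<close> remains to be shown.\<close>
  define a where "a = A powr (1 / \<kappa>)"
  have a: "0 < a" "a powr \<kappa> = A" using A \<kappa> by (auto simp: a_def powr_powr)
  have "(a / \<mu>) powr (8 - \<alpha>) = A\<^sup>2 * (\<mu> powr \<alpha> / \<mu> ^ 8)"
  proof -
    have "a powr (8 - \<alpha>) = a powr \<kappa> * a powr \<kappa>"
      unfolding powr_add[symmetric] by (simp add: \<kappa>_def)
    then have "a powr (8 - \<alpha>) = A\<^sup>2" using a by (simp add: power2_eq_square)
    moreover have "\<mu> powr (8 - \<alpha>) = \<mu> ^ 8 / \<mu> powr \<alpha>" using \<mu> by (simp add: powr_diff)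
    ultimately show ?thesis using a \<mu> by (simp add: powr_divide)
  qed
  then have "C_const \<alpha> = ((a / \<mu>) powr (8 - \<alpha>)) powr (1 / (8 - \<alpha>))"
    unfolding C_const_def C by simp
  also have "\<dots> = a / \<mu>" using a \<mu> \<alpha> by (simp add: powr_powr)
  finally have Ca: "C_const \<alpha> * \<mu> = a" using \<mu> by simp
  have "u x = bubble \<alpha> \<mu> \<zeta> x" for x
  proof -
    have "exp (u x) = (a / P x) powr \<kappa>"
      unfolding E powr_divide powr_minus_divide a(2) by simp
    also have "\<dots> = exp (\<kappa> * ln (a / P x))" using a P[of x] by (simp add: powr_def)
    finally show ?thesis by (simp add: bubble_def Ca \<kappa>_def P_def)
  qed
  then have "u = bubble \<alpha> \<mu> \<zeta>" by (rule ext)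
  then show ?thesis using that \<mu> by blast
qed

end

section \<open>Passage from Lebesgue to Borel hypotheses, and conclusion\<close>

lemma C_const_pos: "0 < \<alpha> \<Longrightarrow> \<alpha> < 4 \<Longrightarrow> 0 < C_const \<alpha>"
  by (simp add: C_const_def)

lemma exp_bubble:
  assumes "0 < \<alpha>" "\<alpha> < 4" "0 < \<mu>"
  shows "exp (8 / (8 - \<alpha>) * bubble \<alpha> \<mu> \<zeta> x) = C_const \<alpha> ^ 4 * \<mu> ^ 4 * (1 + \<mu>\<^sup>2 * (norm (x - \<zeta>))\<^sup>2) powr (-4)"
proof -
  define q where "q = C_const \<alpha> * \<mu> / (1 + \<mu>\<^sup>2 * (norm (x - \<zeta>))\<^sup>2)"
  have P: "0 < 1 + \<mu>\<^sup>2 * (norm (x - \<zeta>))\<^sup>2" by (intro add_pos_nonneg) auto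
  have q: "0 < q" using C_const_pos[OF assms(1,2)] assms P by (simp add: q_def)
  have "8 / (8 - \<alpha>) * bubble \<alpha> \<mu> \<zeta> x = 4 * ln q"
    using assms by (simp add: bubble_def q_def)
  then have "exp (8 / (8 - \<alpha>) * bubble \<alpha> \<mu> \<zeta> x) = q powr 4" using q by (simp add: powr_def)
  also have "\<dots> = q ^ 4" using q by simp
  finally have "exp (8 / (8 - \<alpha>) * bubble \<alpha> \<mu> \<zeta> x) = q ^ 4" .
  then show ?thesis using P by (simp add: q_def power_divide power_mult_distrib powr_minus_divide)
qed

text \<open>The source is at first only locally integrable and Lebesgue measurable. The
  representation holds at every point, so replacing the source by a Borel version under the integral
  shows that \<open>u\<close> itself is Borel, and then \<open>rhs\<close> agrees with
  \<open>source\<close> everywhere.\<close>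

lemma normal_solution_imp_choquard_solution:
  assumes \<alpha>: "0 < \<alpha>" "\<alpha> < 4" and sol: "normal_solution \<alpha> u"
    and Ep: "(\<integral>\<^sup>+x. ennreal (exp (8 / (8 - \<alpha>) * u x)) \<partial>lebesgue) < \<infinity>"
  obtains c0 where "choquard_solution \<alpha> c0 u"
proof -
  obtain C where C: "\<And>x. integrable lebesgue (\<lambda>y. ln (norm (x - y)) * rhs \<alpha> u y)"
    "\<And>x. u x = - (1 / (8 * pi\<^sup>2)) * (\<integral>y. ln (norm (x - y)) * rhs \<alpha> u y \<partial>lebesgue) + C"
    using sol by (auto simp: normal_solution_def)
  have "locally_integrable (rhs \<alpha> u)"
    using sol by (simp add: normal_solution_def distributional_solution_def)
  then have loc: "integrable lebesgue (\<lambda>y. indicator (cball 0 n) y * rhs \<alpha> u y)" for n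
    by (simp add: locally_integrable_def set_integrable_def)
  have F_meas: "rhs \<alpha> u \<in> borel_measurable lebesgue"
  proof (rule borel_measurable_LIMSEQ_real)
    show "(\<lambda>n. indicator (cball 0 (real n)) y * rhs \<alpha> u y) \<longlonglongrightarrow> rhs \<alpha> u y" for y
    proof (rule tendsto_eventually)
      obtain N where "norm y < real N" using reals_Archimedean2 by blast
      then show "eventually (\<lambda>n. indicator (cball 0 (real n)) y * rhs \<alpha> u y = rhs \<alpha> u y) sequentially"
        by (intro eventually_sequentiallyI[of N]) (auto simp: indicator_def)
    qed
    show "(\<lambda>y. indicator (cball 0 (real n)) y * rhs \<alpha> u y) \<in> borel_measurable lebesgue" for n
      using loc[of "real n"] by auto
  qed
  have F_int: "integrable lebesgue (rhs \<alpha> u)"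
  proof (rule Bochner_Integration.integrable_bound)
    \<comment> \<open>Since \<open>3 \<ge> exp 1\<close>, the logarithm is at least 1 outside this
      ball, so integrability of \<open>ln (norm y) * rhs \<alpha> u y\<close> controls the source
      there; inside, local integrability does.\<close>
    show "integrable lebesgue (\<lambda>y. norm (indicator (cball 0 3) y * rhs \<alpha> u y) + norm (ln (norm (0 - y)) * rhs \<alpha> u y))"
      using loc[of 3] C(1)[of 0] by (intro Bochner_Integration.integrable_add integrable_norm)
    have "norm (rhs \<alpha> u y) \<le> norm (norm (indicator (cball 0 3) y * rhs \<alpha> u y) + norm (ln (norm (0 - y)) * rhs \<alpha> u y))" for y
    proof (cases "norm y \<le> 3")
      case False
      have "exp 1 \<le> norm y" using exp_le False by linarith
      then have "ln (exp 1) \<le> ln (norm y)" by (intro ln_mono) auto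
      then have "1 * \<bar>rhs \<alpha> u y\<bar> \<le> \<bar>ln (norm y)\<bar> * \<bar>rhs \<alpha> u y\<bar>" by (intro mult_right_mono) auto
      then show ?thesis using False by (simp add: abs_mult)
    qed simp
    then show "AE y in lebesgue. norm (rhs \<alpha> u y) \<le> norm (norm (indicator (cball 0 3) y * rhs \<alpha> u y) + norm (ln (norm (0 - y)) * rhs \<alpha> u y))"
      by simp
  qed (rule F_meas)
  obtain G where G [measurable]: "G \<in> borel_measurable lborel" and AE: "AE y in lborel. rhs \<alpha> u y = G y"
    using completion_ex_borel_measurable_real[OF F_meas] by blast
  have AE': "AE y in lebesgue. rhs \<alpha> u y = G y" using AE by (rule AE_completion)
  have u_G: "u x = - (1 / (8 * pi\<^sup>2)) * (\<integral>y. ln (norm (x - y)) * G y \<partial>lborel) + C" for x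
  proof -
    have "(\<integral>y. ln (norm (x - y)) * rhs \<alpha> u y \<partial>lebesgue) = (\<integral>y. ln (norm (x - y)) * G y \<partial>lebesgue)"
    proof (rule integral_cong_AE)
      show "AE y in lebesgue. ln (norm (x - y)) * rhs \<alpha> u y = ln (norm (x - y)) * G y"
        using AE' by eventually_elim simp
      show "(\<lambda>y. ln (norm (x - y)) * rhs \<alpha> u y) \<in> borel_measurable lebesgue" using C(1)[of x] by auto
      show "(\<lambda>y. ln (norm (x - y)) * G y) \<in> borel_measurable lebesgue"
        by (rule measurable_completion) measurable
    qed
    also have "\<dots> = (\<integral>y. ln (norm (x - y)) * G y \<partial>lborel)" by (rule integral_completion) measurable
    finally show ?thesis using C(2)[of x] by simp
  qed
  have u_meas [measurable]: "u \<in> borel_measurable borel"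
    unfolding u_G[abs_def] by measurable
  have rhs_eq: "rhs \<alpha> u = source \<alpha> u"
  proof
    fix x
    have "(\<integral>y. riesz_integrand \<alpha> u x y \<partial>lebesgue) = (\<integral>y. exp (u y) * norm (x - y) powr (-\<alpha>) \<partial>lebesgue)"
      by (simp add: riesz_integrand_def powr_minus divide_inverse)
    also have "\<dots> = riesz \<alpha> u x"
      unfolding riesz_def by (rule integral_completion) measurable
    finally show "rhs \<alpha> u x = source \<alpha> u x" by (simp add: rhs_def source_def)
  qed
  have [measurable]: "source \<alpha> u \<in> borel_measurable borel"
    unfolding source_def[abs_def] riesz_def[abs_def] by measurable
  have "choquard_solution \<alpha> C u"
  proof
    show "integrable lborel (source \<alpha> u)"
      using F_int unfolding rhs_eq by (subst (asm) integrable_completion) auto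
    show "integrable lborel (\<lambda>y. ln (norm (x - y)) * source \<alpha> u y)" for x
      using C(1)[of x] unfolding rhs_eq by (subst (asm) integrable_completion) auto
    show "u x = - (1 / (8 * pi\<^sup>2)) * (\<integral>y. ln (norm (x - y)) * source \<alpha> u y \<partial>lborel) + C" for x
      using C(2)[of x] unfolding rhs_eq by (subst (asm) integral_completion) auto
    show "integrable lborel (\<lambda>x. exp (8 / (8 - \<alpha>) * u x))"
      using Ep by (intro integrableI_nonneg) (auto simp: nn_integral_completion)
  qed (use \<alpha> u_meas in auto)
  then show ?thesis using that by blast
qed

theorem theorem1p1:
  fixes \<alpha> :: real and u :: "real^4 \<Rightarrow> real"
  assumes "0 < \<alpha>" and "\<alpha> < 4"
    and "normal_solution \<alpha> u"
    and "(\<integral>\<^sup>+x. ennreal (exp (8 / (8 - \<alpha>) * u x)) \<partial>lebesgue) < \<infinity>"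
  shows "C_infinity u \<and>
    (\<exists>\<mu>>0. \<exists>\<zeta>. u = bubble \<alpha> \<mu> \<zeta> \<and>
      (\<integral>\<^sup>+x. ennreal (exp (8 / (8 - \<alpha>) * bubble \<alpha> \<mu> \<zeta> x)) \<partial>lebesgue)
        = ennreal (pi\<^sup>2 / 6 * C_const \<alpha> ^ 4) \<and>
      (\<integral>\<^sup>+y. (\<integral>\<^sup>+x. ennreal (exp (bubble \<alpha> \<mu> \<zeta> x) * exp (bubble \<alpha> \<mu> \<zeta> y) / norm (x - y) powr \<alpha>)
          \<partial>lebesgue) \<partial>lebesgue)
        = ennreal (8 * pi\<^sup>2 * (8 - \<alpha>)))"
proof -
  obtain c0 where "choquard_solution \<alpha> c0 u"
    by (rule normal_solution_imp_choquard_solution[OF assms])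
  then interpret choquard_solution \<alpha> c0 u .
  obtain \<mu> \<zeta> where \<mu>: "0 < \<mu>" and u: "u = bubble \<alpha> \<mu> \<zeta>" by (rule u_eq_bubble)
  have "(\<integral>\<^sup>+x. ennreal (exp (8 / (8 - \<alpha>) * u x)) \<partial>lebesgue)
      = (\<integral>\<^sup>+x. ennreal (C_const \<alpha> ^ 4 * \<mu> ^ 4) * ennreal ((1 + \<mu>\<^sup>2 * (norm (x - \<zeta>))\<^sup>2) powr (-4)) \<partial>lborel)"
    unfolding nn_integral_completion u exp_bubble[OF assms(1,2) \<mu>]
    using \<mu> C_const_pos[OF assms(1,2)] by (intro nn_integral_cong ennreal_mult) auto
  also have "\<dots> = ennreal (C_const \<alpha> ^ 4 * \<mu> ^ 4) * ennreal (pi\<^sup>2 / (\<mu> ^ 4 * ((4 - 1) * (4 - 2))))"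
    using \<mu> by (subst nn_integral_cmult) (auto simp: nn_integral_bubble_profile)
  also have "\<dots> = ennreal (pi\<^sup>2 / 6 * C_const \<alpha> ^ 4)"
    using \<mu> C_const_pos[OF assms(1,2)] by (subst ennreal_mult[symmetric]) auto
  finally have 1: "(\<integral>\<^sup>+x. ennreal (exp (8 / (8 - \<alpha>) * u x)) \<partial>lebesgue) = ennreal (pi\<^sup>2 / 6 * C_const \<alpha> ^ 4)" .
  \<comment> \<open>The inner integral is the source at \<open>y\<close>, so the double integral is
    the mass, whose value is known from the Pohozaev identity.\<close>
  have "(\<integral>\<^sup>+x. ennreal (exp (u x) * exp (u y) / norm (x - y) powr \<alpha>) \<partial>lborel) = ennreal (F y)" for y
  proof -
    have "(\<integral>\<^sup>+x. ennreal (exp (u x) * exp (u y) / norm (x - y) powr \<alpha>) \<partial>lborel)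
       = (\<integral>\<^sup>+x. ennreal (exp (u y)) * ennreal (exp (u x) * norm (y - x) powr (-\<alpha>)) \<partial>lborel)"
      by (intro nn_integral_cong) (simp add: ennreal_mult[symmetric] norm_minus_commute powr_minus divide_inverse mult_ac)
    also have "\<dots> = ennreal (exp (u y)) * (\<integral>\<^sup>+x. ennreal (exp (u x) * norm (y - x) powr (-\<alpha>)) \<partial>lborel)"
      by (rule nn_integral_cmult) measurable
    also have "(\<integral>\<^sup>+x. ennreal (exp (u x) * norm (y - x) powr (-\<alpha>)) \<partial>lborel) = ennreal (V y)"
      unfolding riesz_def by (rule nn_integral_eq_integral[OF V_integrable]) auto
    finally show ?thesis using V_nonneg by (simp add: source_def ennreal_mult mult.commute)
  qed
  then have 2: "(\<integral>\<^sup>+y. (\<integral>\<^sup>+x. ennreal (exp (u x) * exp (u y) / norm (x - y) powr \<alpha>) \<partial>lebesgue) \<partial>lebesgue)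
      = ennreal (8 * pi\<^sup>2 * (8 - \<alpha>))"
    unfolding nn_integral_completion by (simp add: nn_integral_F mass_eq)
  have "C_infinity u"
    unfolding u by (rule C_infinity_bubble[OF C_const_pos[OF assms(1,2)] \<mu>])
  with 1 2 u \<mu> show ?thesis by blast
qed

end
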